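(* Every finitely satisfiable $\mathrm{UNFO}{+}\mathcal{S}$ formula $\phi$ has a finite (admissible) model of size bounded triply exponentially in $|\phi|$, i.e. of size at most $2^{2^{2^{p(|\phi|)}}}$ for some fixed polynomial $p$.
   Context: Signatures are purely relational, $\sigma=\sigma_{\mathrm{base}}\cup\sigma_{\mathrm{dist}}$ with $\sigma_{\mathrm{dist}}=\{T_1,\dots,T_{2k}\}$ binary. $\mathrm{UNFO}$ formulas are given by $\phi ::= B\bar x \mid x=y \mid \phi\wedge\phi \mid \phi\vee\phi \mid \exists x\,\phi \mid \neg\phi(x)$, where $B$ is any relation symbol and in the last clause $\phi$ has at most the free variable $x$. $\mathrm{UNFO}{+}\mathcal{S}$ has the same syntax, but admissible structures must interpret each $T_u$ as a transitive relation and $T_{2u}$ as the inverse of $T_{2u-1}$ ($1\le u\le k$). *)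

theory Defs
  imports "HOL-Computational_Algebra.Polynomial"
begin

datatype rel_symbol = Base nat | T nat

text \<open>The base part of a signature is a partial arity function: its domain is the set of base
  symbols.  The distinguished symbols are \<open>T 1, \<dots>, T (2 * k)\<close>, where \<open>k\<close> is \<open>num_pairs\<close>.\<close>

record signature =
  base_arity :: "nat \<rightharpoonup> nat"
  num_pairs :: nat

fun arity :: "signature \<Rightarrow> rel_symbol \<Rightarrow> nat option" where
  "arity \<sigma> (Base b) = base_arity \<sigma> b"
| "arity \<sigma> (T u) = (if 1 \<le> u \<and> u \<le> 2 * num_pairs \<sigma> then Some 2 else None)"

datatype form =
    Atom rel_symbol "nat list"
  | Eq nat nat
  | Conj form form
  | Disj form form
  | Ex nat form
  | Neg form

primrec fv :: "form \<Rightarrow> nat set" where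
  "fv (Atom B xs) = set xs"
| "fv (Eq x y) = {x, y}"
| "fv (Conj \<phi> \<psi>) = fv \<phi> \<union> fv \<psi>"
| "fv (Disj \<phi> \<psi>) = fv \<phi> \<union> fv \<psi>"
| "fv (Ex x \<phi>) = fv \<phi> - {x}"
| "fv (Neg \<phi>) = fv \<phi>"

primrec unfo :: "signature \<Rightarrow> form \<Rightarrow> bool" where
  "unfo \<sigma> (Atom B xs) \<longleftrightarrow> arity \<sigma> B = Some (length xs)"
| "unfo \<sigma> (Eq x y) \<longleftrightarrow> True"
| "unfo \<sigma> (Conj \<phi> \<psi>) \<longleftrightarrow> unfo \<sigma> \<phi> \<and> unfo \<sigma> \<psi>"
| "unfo \<sigma> (Disj \<phi> \<psi>) \<longleftrightarrow> unfo \<sigma> \<phi> \<and> unfo \<sigma> \<psi>"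
| "unfo \<sigma> (Ex x \<phi>) \<longleftrightarrow> unfo \<sigma> \<phi>"
| "unfo \<sigma> (Neg \<phi>) \<longleftrightarrow> unfo \<sigma> \<phi> \<and> (\<exists>x. fv \<phi> \<subseteq> {x})"

text \<open>The length of a formula is its number of symbol occurrences; relation symbols, variables,
  the equality sign, connectives and quantifiers count 1 each.\<close>

primrec form_length :: "form \<Rightarrow> nat" where
  "form_length (Atom B xs) = 1 + length xs"
| "form_length (Eq x y) = 3"
| "form_length (Conj \<phi> \<psi>) = 1 + form_length \<phi> + form_length \<psi>"
| "form_length (Disj \<phi> \<psi>) = 1 + form_length \<phi> + form_length \<psi>"
| "form_length (Ex x \<phi>) = 2 + form_length \<phi>"
| "form_length (Neg \<phi>) = 1 + form_length \<phi>"

record 'a struct =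
  universe :: "'a set"
  interp :: "rel_symbol \<Rightarrow> 'a list set"

definition is_struct :: "signature \<Rightarrow> 'a struct \<Rightarrow> bool" where
  "is_struct \<sigma> M \<longleftrightarrow> universe M \<noteq> {} \<and>
     (\<forall>B n. arity \<sigma> B = Some n \<longrightarrow>
        interp M B \<subseteq> {as. length as = n \<and> set as \<subseteq> universe M})"

definition dist_rel :: "'a struct \<Rightarrow> nat \<Rightarrow> 'a rel" where
  "dist_rel M u = {(a, b). [a, b] \<in> interp M (T u)}"

definition admissible :: "signature \<Rightarrow> 'a struct \<Rightarrow> bool" where
  "admissible \<sigma> M \<longleftrightarrow> is_struct \<sigma> M \<and>
     (\<forall>u\<in>{1..2 * num_pairs \<sigma>}. trans (dist_rel M u)) \<and>
     (\<forall>u\<in>{1..num_pairs \<sigma>}. dist_rel M (2 * u) = (dist_rel M (2 * u - 1))\<inverse>)"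

primrec sat :: "'a struct \<Rightarrow> (nat \<Rightarrow> 'a) \<Rightarrow> form \<Rightarrow> bool" where
  "sat M v (Atom B xs) \<longleftrightarrow> map v xs \<in> interp M B"
| "sat M v (Eq x y) \<longleftrightarrow> v x = v y"
| "sat M v (Conj \<phi> \<psi>) \<longleftrightarrow> sat M v \<phi> \<and> sat M v \<psi>"
| "sat M v (Disj \<phi> \<psi>) \<longleftrightarrow> sat M v \<phi> \<or> sat M v \<psi>"
| "sat M v (Ex x \<phi>) \<longleftrightarrow> (\<exists>a\<in>universe M. sat M (v(x := a)) \<phi>)"
| "sat M v (Neg \<phi>) \<longleftrightarrow> \<not> sat M v \<phi>"

text \<open>Formulas may have free variables; a model is then an admissible structure satisfying the
  formula under some assignment.  For sentences the choice of assignment is irrelevant.\<close>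

definition finite_model :: "signature \<Rightarrow> 'a struct \<Rightarrow> form \<Rightarrow> bool" where
  "finite_model \<sigma> M \<phi> \<longleftrightarrow> admissible \<sigma> M \<and> finite (universe M) \<and>
     (\<exists>v. range v \<subseteq> universe M \<and> sat M v \<phi>)"

text \<open>HOL cannot quantify over the type of elements inside a definition, so finite models are
  taken with universes consisting of natural numbers.  By \<open>finite_model_nat\<close> below, a finite model
  over any other type has a copy of the same size over the natural numbers.\<close>

definition finitely_satisfiable :: "signature \<Rightarrow> form \<Rightarrow> bool" where
  "finitely_satisfiable \<sigma> \<phi> \<longleftrightarrow> (\<exists>M :: nat struct. finite_model \<sigma> M \<phi>)"

definition image_struct :: "('a \<Rightarrow> 'b) \<Rightarrow> 'a struct \<Rightarrow> 'b struct" where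
  "image_struct f M = \<lparr>universe = f ` universe M,
     interp = (\<lambda>B. map f ` (interp M B \<inter> lists (universe M)))\<rparr>"

lemma map_in_image_lists:
  assumes "inj_on f U" "set as \<subseteq> U"
  shows "map f as \<in> map f ` (R \<inter> lists U) \<longleftrightarrow> as \<in> R"
proof
  assume "map f as \<in> map f ` (R \<inter> lists U)"
  then obtain bs where "bs \<in> R" "set bs \<subseteq> U" "map f as = map f bs" by auto
  moreover have "inj_on f (set as \<union> set bs)"
    using assms \<open>set bs \<subseteq> U\<close> by (meson Un_least inj_on_subset)
  ultimately show "as \<in> R" by (metis inj_on_map_eq_map)
next
  assume "as \<in> R"
  then show "map f as \<in> map f ` (R \<inter> lists U)" using assms by auto
qed

lemma sat_image_struct:
  assumes "inj_on f (universe M)" "range v \<subseteq> universe M"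
  shows "sat (image_struct f M) (f \<circ> v) \<phi> \<longleftrightarrow> sat M v \<phi>"
  using assms(2)
proof (induction \<phi> arbitrary: v)
  case (Atom B xs)
  then have "set (map v xs) \<subseteq> universe M" by auto
  from map_in_image_lists[OF assms(1) this, of "interp M B"]
  show ?case by (simp add: image_struct_def comp_def)
next
  case (Eq x y)
  then have "v x \<in> universe M" "v y \<in> universe M" by auto
  then show ?case using assms(1) by (simp add: inj_on_eq_iff)
next
  case (Ex x \<phi>)
  have "sat (image_struct f M) ((f \<circ> v)(x := f a)) \<phi> \<longleftrightarrow> sat M (v(x := a)) \<phi>"
    if "a \<in> universe M" for a
  proof -
    have "range (v(x := a)) \<subseteq> universe M" using Ex.prems that by auto
    moreover have "(f \<circ> v)(x := f a) = f \<circ> v(x := a)" by auto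
    ultimately show ?thesis using Ex.IH by metis
  qed
  then show ?case by (simp add: image_struct_def comp_def)
qed auto

lemma dist_rel_image_struct:
  assumes "inj_on f (universe M)"
  shows "dist_rel (image_struct f M) u
    = map_prod f f ` (dist_rel M u \<inter> universe M \<times> universe M)"
  by (force simp: dist_rel_def image_struct_def Cons_eq_map_conv)

lemma admissible_image_struct:
  assumes inj: "inj_on f (universe M)" and adm: "admissible \<sigma> M"
  shows "admissible \<sigma> (image_struct f M)"
proof -
  note D = dist_rel_image_struct[OF inj]
  have "is_struct \<sigma> (image_struct f M)"
    using adm by (fastforce simp: admissible_def is_struct_def image_struct_def)
  moreover have "trans (dist_rel (image_struct f M) u)" if "u \<in> {1..2 * num_pairs \<sigma>}" for u
  proof -
    have tr: "trans (dist_rel M u)" using adm that by (simp add: admissible_def)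
    show ?thesis unfolding D
      by (rule transI) (use inj in \<open>auto simp: inj_on_eq_iff dest: transD[OF tr]\<close>)
  qed
  moreover have "dist_rel (image_struct f M) (2 * u) = (dist_rel (image_struct f M) (2 * u - 1))\<inverse>"
    if "u \<in> {1..num_pairs \<sigma>}" for u
  proof -
    have "dist_rel M (2 * u) = (dist_rel M (2 * u - 1))\<inverse>"
      using adm that by (simp add: admissible_def)
    then show ?thesis unfolding D by force
  qed
  ultimately show ?thesis by (simp add: admissible_def)
qed

lemma finite_model_nat:
  fixes M :: "'a struct"
  assumes "finite_model \<sigma> M \<phi>"
  shows "\<exists>N :: nat struct. finite_model \<sigma> N \<phi> \<and> card (universe N) = card (universe M)"
proof -
  from assms obtain v where adm: "admissible \<sigma> M" and fin: "finite (universe M)"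
    and v: "range v \<subseteq> universe M" "sat M v \<phi>"
    by (auto simp: finite_model_def)
  obtain f :: "'a \<Rightarrow> nat" where inj: "inj_on f (universe M)"
    using finite_imp_inj_to_nat_seg[OF fin] by blast
  have "finite_model \<sigma> (image_struct f M) \<phi>"
    unfolding finite_model_def
  proof (intro conjI exI)
    show "admissible \<sigma> (image_struct f M)" by (rule admissible_image_struct[OF inj adm])
    show "finite (universe (image_struct f M))" using fin by (simp add: image_struct_def)
    show "range (f \<circ> v) \<subseteq> universe (image_struct f M)" using v by (auto simp: image_struct_def)
    show "sat (image_struct f M) (f \<circ> v) \<phi>" using sat_image_struct[OF inj v(1)] v(2) by simp
  qed
  moreover have "card (universe (image_struct f M)) = card (universe M)"
    using inj by (simp add: image_struct_def card_image)
  ultimately show ?thesis by blast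
qed

end

theory Submission
  imports Defs
begin

text \<open>A finite model is turned into a finite structure with binary relations in which every element
  \<open>a\<close> has a small bag \<open>W a\<close> of witnesses. It suffices to find a small structure in which every element
  has a copy of such a bag while every set of \<open>K\<close> points still maps to the given structure, with the
  types of single elements preserved. Unravelling along bags gives a tree with these properties; it
  could be folded to a finite structure if the paths of every transitive relation were bounded in it.

  Two kinds of long paths have to be removed. Cliques of a relation are replaced by finite components,
  which are obtained by induction on the number of relations that are not total. Strict descents are
  cut short by a first-in-first-out rule: among the relations that run along the current branch, the
  one that runs longest has priority, and every new node is moved down along this relation to an
  element of the same type below which, outside its clique, the type does not reappear. Finiteness
  of the given model is used here. Hence the oldest relation stops after as many steps as there are
  types, and every other one becomes the oldest or stops. Now all paths are bounded, and remembering
  two long blocks of the branch is enough: any \<open>K\<close> points miss some depth range, and cutting there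
  unfolds the finite structure into the tree.\<close>

section \<open>Components and partial homomorphisms\<close>

text \<open>The size is governed by two numbers. The number \<open>M\<close> of types of
  \<open>K + 1\<close> points is doubly exponential, and the block length \<open>D\<close> grows
  linearly with \<open>M\<close>. A folded tree has about as many elements as there are paths of
  length \<open>2 * D\<close>, so every level of the recursion over cliques raises the size to a
  power of order \<open>D\<close>. There are at most \<open>2 * n + 1\<close> levels, hence the
  final exponent is of order \<open>D\<close> to a linear power, which is still doubly exponential.
  The value \<open>K = 2 * n\<close> comes from the formulas. A true formula is witnessed by at most
  \<open>n\<close> elements and \<open>n\<close> facts, and apart from these only unary information
  has to be transferred, because negation is applied to formulas with at most one free variable.
  Bags carry witnesses from the given model into the new one; local maps on \<open>K\<close> points
  carry witnesses found in the new model back. Neither direction needs more than equality of types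
  up to \<open>eqv\<close>, which is what allows elements to be exchanged freely during the
  construction.\<close>

text \<open>The finite structures are built recursively from smaller components, so a single type serves
  as carrier at all levels. \<open>N a \<pi>' \<pi> c\<close> is the element \<open>c\<close> of the component at the
  node \<open>\<pi>\<close> of a tree of components; \<open>\<pi>'\<close> is the path through the preceding block, starting
  at \<open>a\<close>. Paths list their last step first.\<close>

datatype 'a el = L | N 'a "('a el \<times> 'a) list" "('a el \<times> 'a) list" "'a el"

text \<open>Every center \<open>c\<close> carries a chart, that is, a copy of the given structure in which \<open>c\<close> sits at
  \<open>cp c\<close>. Charts are glued along bag elements: the point at \<open>w\<close> in the chart of \<open>c\<close> is the center
  \<open>cg c w\<close> (written \<open>Inl\<close>) if \<open>w\<close> lies in the bag and in the domain, and the private point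
  \<open>Inr (c, w)\<close> otherwise. The relations \<open>cQ\<close> live on these points.\<close>

record ('a, 'i) comp =
  cB :: "'a el set"
  cr :: "'a el"
  cp :: "'a el \<Rightarrow> 'a"
  cg :: "'a el \<Rightarrow> 'a \<Rightarrow> 'a el"
  cQ :: "'i \<Rightarrow> ('a el + 'a el \<times> 'a) rel"

locale bag_structure =
  fixes A :: "'a set" and r :: "'i \<Rightarrow> 'a rel" and I J :: "'i set" and iv :: "'i \<Rightarrow> 'i"
    and W :: "'a \<Rightarrow> 'a set" and K :: nat
  assumes finA: "finite A" and finI: "finite I" and JI: "J \<subseteq> I"
    and rA: "i \<in> I \<Longrightarrow> r i \<subseteq> A \<times> A"
    and trans_r: "j \<in> J \<Longrightarrow> trans (r j)"
    and iv_J: "j \<in> J \<Longrightarrow> iv j \<in> J" and r_iv: "j \<in> J \<Longrightarrow> r (iv j) = (r j)\<inverse>"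
    and W_self: "a \<in> A \<Longrightarrow> a \<in> W a" and W_A: "a \<in> A \<Longrightarrow> W a \<subseteq> A"
begin

text \<open>The bound leaves room for the base point and the images of \<open>K\<close> further points.\<close>

definition covers :: "'a \<Rightarrow> 'a \<Rightarrow> bool" where
  "covers s t \<longleftrightarrow> (\<forall>Y. Y \<subseteq> A \<longrightarrow> card Y \<le> K + 1 \<longrightarrow> t \<in> Y \<longrightarrow>
     (\<exists>e. e ` Y \<subseteq> A \<and> e t = s \<and> (\<forall>i\<in>I. \<forall>x\<in>Y. \<forall>y\<in>Y. (x, y) \<in> r i \<longrightarrow> (e x, e y) \<in> r i)))"

definition eqv :: "'a \<Rightarrow> 'a \<Rightarrow> bool" where
  "eqv s t \<longleftrightarrow> s \<in> A \<and> t \<in> A \<and> covers s t \<and> covers t s"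

lemma covers_refl: "covers s s"
  unfolding covers_def by (intro allI impI exI[of _ id]) auto

lemma covers_trans:
  assumes "covers s t" "covers t u" shows "covers s u"
  unfolding covers_def
proof (intro allI impI)
  fix Y assume Y: "Y \<subseteq> A" "card Y \<le> K + 1" "u \<in> Y"
  then obtain e where e: "e ` Y \<subseteq> A" "e u = t"
    "\<forall>i\<in>I. \<forall>x\<in>Y. \<forall>y\<in>Y. (x, y) \<in> r i \<longrightarrow> (e x, e y) \<in> r i"
    using assms(2) unfolding covers_def by meson
  have "card (e ` Y) \<le> K + 1"
    using card_image_le[of Y e] Y finA by (meson finite_subset le_trans)
  moreover have "t \<in> e ` Y" using e Y by auto
  ultimately obtain e' where e': "e' ` e ` Y \<subseteq> A" "e' t = s"
    "\<forall>i\<in>I. \<forall>x\<in>e ` Y. \<forall>y\<in>e ` Y. (x, y) \<in> r i \<longrightarrow> (e' x, e' y) \<in> r i"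
    using assms(1) e(1) unfolding covers_def by meson
  show "\<exists>e. e ` Y \<subseteq> A \<and> e u = s \<and> (\<forall>i\<in>I. \<forall>x\<in>Y. \<forall>y\<in>Y. (x, y) \<in> r i \<longrightarrow> (e x, e y) \<in> r i)"
    using e e' by (intro exI[of _ "e' \<circ> e"]) auto
qed

lemma eqv_refl: "s \<in> A \<Longrightarrow> eqv s s" by (simp add: eqv_def covers_refl)
lemma eqv_sym: "eqv s t \<Longrightarrow> eqv t s" by (simp add: eqv_def)
lemma eqv_trans: "eqv s t \<Longrightarrow> eqv t u \<Longrightarrow> eqv s u" by (meson eqv_def covers_trans)

text \<open>Taking \<open>Y = {s}\<close> shows that loops are part of the type. Unary information
  is therefore stored as loops and survives every replacement of an element by an equivalent
  one.\<close>

lemma eqv_loop: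
  assumes "eqv s t" "i \<in> I" "(s, s) \<in> r i" shows "(t, t) \<in> r i"
proof -
  have "covers t s" "s \<in> A" using assms by (auto simp: eqv_def)
  then obtain e where "e s = t" "\<forall>i\<in>I. \<forall>x\<in>{s}. \<forall>y\<in>{s}. (x, y) \<in> r i \<longrightarrow> (e x, e y) \<in> r i"
    unfolding covers_def by (metis empty_subsetI insert_subset card.empty card_insert_disjoint empty_iff
        finite.emptyI insertI1 le_add2 One_nat_def)
  then show ?thesis using assms by auto
qed

definition cls :: "'a \<Rightarrow> 'a set" where "cls s = {t. eqv s t}"

lemma cls_eq: "s \<in> A \<Longrightarrow> cls s = cls t \<longleftrightarrow> eqv s t"
  unfolding cls_def using eqv_refl eqv_sym eqv_trans by blast

definition M :: nat where "M = card (cls ` A)"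

section \<open>Charts and local maps\<close>

definition tot :: "'a set \<Rightarrow> 'i \<Rightarrow> bool" where "tot X j \<longleftrightarrow> X \<times> X \<subseteq> r j"

definition io :: "'a set \<Rightarrow> ('a, 'i) comp \<Rightarrow> 'a el \<Rightarrow> 'a \<Rightarrow> 'a el + 'a el \<times> 'a" where
  "io X C c x = (if x \<in> W (cp C c) \<inter> X then Inl (cg C c x) else Inr (c, x))"

text \<open>Relations outside \<open>J\<close> have no closure conditions and live inside single
  charts, so they are checked chart by chart. Those in \<open>J\<close> are transitive and must be
  preserved between any two points of the domain.\<close>

definition partial_hom :: "'c set \<Rightarrow> ('c \<Rightarrow> 'a \<Rightarrow> 'p) \<Rightarrow> ('i \<Rightarrow> 'p rel) \<Rightarrow> 'p set \<Rightarrow> ('p \<Rightarrow> 'a) \<Rightarrow> bool" where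
  "partial_hom Cs ch Q D h \<longleftrightarrow> (\<forall>u\<in>D. h u \<in> A) \<and>
     (\<forall>i\<in>I. \<forall>c\<in>Cs. \<forall>x y. (x, y) \<in> r i \<longrightarrow> ch c x \<in> D \<longrightarrow> ch c y \<in> D \<longrightarrow> (h (ch c x), h (ch c y)) \<in> r i) \<and>
     (\<forall>j\<in>J. \<forall>u\<in>D. \<forall>v\<in>D. (u, v) \<in> Q j \<longrightarrow> (h u, h v) \<in> r j)"

definition cov :: "('c \<Rightarrow> 'a \<Rightarrow> 'p) \<Rightarrow> 'c set \<Rightarrow> 'p set" where
  "cov ch C = (\<Union>c\<in>C. ch c ` A)"

text \<open>The map is required to be the identity on a whole chart; only the points outside of that chart
  are limited in number. This keeps \<open>K\<close> unchanged through the whole construction.\<close>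

definition locally_maps :: "'c set \<Rightarrow> ('c \<Rightarrow> 'a \<Rightarrow> 'p) \<Rightarrow> ('i \<Rightarrow> 'p rel) \<Rightarrow> 'c set \<Rightarrow> bool" where
  "locally_maps Cs ch Q C \<longleftrightarrow> (\<forall>b\<in>C. \<forall>S. S \<subseteq> cov ch C \<longrightarrow> finite S \<longrightarrow> card S \<le> K \<longrightarrow>
     (\<exists>h. (\<forall>x\<in>A. h (ch b x) = x) \<and> partial_hom Cs ch Q (S \<union> ch b ` A) h))"

lemma locally_mapsD:
  assumes "locally_maps Cs ch Q C" "b \<in> C" "S \<subseteq> cov ch C" "finite S" "card S \<le> K"
  obtains h where "\<And>x. x \<in> A \<Longrightarrow> h (ch b x) = x" "partial_hom Cs ch Q (S \<union> ch b ` A) h"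
  using assms unfolding locally_maps_def by meson

lemma partial_homI:
  assumes "\<And>u. u \<in> D \<Longrightarrow> h u \<in> A"
    and "\<And>i c x y. i \<in> I \<Longrightarrow> c \<in> Cs \<Longrightarrow> (x, y) \<in> r i \<Longrightarrow> ch c x \<in> D \<Longrightarrow> ch c y \<in> D \<Longrightarrow> (h (ch c x), h (ch c y)) \<in> r i"
    and "\<And>j u v. j \<in> J \<Longrightarrow> u \<in> D \<Longrightarrow> v \<in> D \<Longrightarrow> (u, v) \<in> Q j \<Longrightarrow> (h u, h v) \<in> r j"
  shows "partial_hom Cs ch Q D h"
  using assms unfolding partial_hom_def by blast

lemma partial_homD:
  assumes "partial_hom Cs ch Q D h"
  shows "u \<in> D \<Longrightarrow> h u \<in> A"
    and "i \<in> I \<Longrightarrow> c \<in> Cs \<Longrightarrow> (x, y) \<in> r i \<Longrightarrow> ch c x \<in> D \<Longrightarrow> ch c y \<in> D \<Longrightarrow> (h (ch c x), h (ch c y)) \<in> r i"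
    and "j \<in> J \<Longrightarrow> u \<in> D \<Longrightarrow> v \<in> D \<Longrightarrow> (u, v) \<in> Q j \<Longrightarrow> (h u, h v) \<in> r j"
  using assms unfolding partial_hom_def by blast+

text \<open>The points of \<open>C1\<close> are first mapped to the chart of \<open>c1\<close>, and from there, by \<open>eqv\<close>, to the
  chart of \<open>c2\<close>; a path between the two families runs through \<open>z\<close>.\<close>

lemma amalgam_half:
  fixes ch :: "'c \<Rightarrow> 'a \<Rightarrow> 'p"
  assumes l1: "locally_maps Cs ch Q C1" and l2: "locally_maps Cs ch Q C2" and sub: "C1 \<subseteq> Cs" "C2 \<subseteq> Cs"
    and meet: "cov ch C1 \<inter> cov ch C2 \<subseteq> {z}"
    and c1: "c1 \<in> C1" "w1 \<in> A" "ch c1 w1 = z" and c2: "c2 \<in> C2" "w2 \<in> A" "ch c2 w2 = z"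
    and eq: "eqv w1 w2"
    and tr: "\<And>j. j \<in> J \<Longrightarrow> trans (Q j)"
    and chart: "\<And>j c x y. j \<in> J \<Longrightarrow> c \<in> Cs \<Longrightarrow> (x, y) \<in> r j \<Longrightarrow> (ch c x, ch c y) \<in> Q j"
    and sepJ: "\<And>j u v. j \<in> J \<Longrightarrow> u \<in> cov ch C1 - {z} \<Longrightarrow> v \<in> cov ch C2 - {z} \<Longrightarrow>
        (u, v) \<in> Q j \<Longrightarrow> (u, z) \<in> Q j \<and> (z, v) \<in> Q j"
    and sepJ': "\<And>j u v. j \<in> J \<Longrightarrow> u \<in> cov ch C1 - {z} \<Longrightarrow> v \<in> cov ch C2 - {z} \<Longrightarrow>
        (v, u) \<in> Q j \<Longrightarrow> (v, z) \<in> Q j \<and> (z, u) \<in> Q j"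
    and sepI: "\<And>c. c \<in> Cs \<Longrightarrow> ch c ` A \<inter> (cov ch C1 - {z}) = {} \<or> ch c ` A \<inter> (cov ch C2 - {z}) = {}"
    and b: "b \<in> C2" and S: "S \<subseteq> cov ch (C1 \<union> C2)" "finite S" "card S \<le> K"
  shows "\<exists>h. (\<forall>x\<in>A. h (ch b x) = x) \<and> partial_hom Cs ch Q (S \<union> ch b ` A) h"
proof -
  define S1 where "S1 = S - cov ch C2"
  have S1: "S1 \<subseteq> cov ch C1" "finite S1" "card S1 \<le> K"
  proof -
    show "S1 \<subseteq> cov ch C1" using S(1) unfolding S1_def cov_def by auto
    show "finite S1" using S(2) unfolding S1_def by simp
    have "S1 \<subseteq> S" unfolding S1_def by auto
    then show "card S1 \<le> K" using card_mono[OF S(2)] S(3) by (meson order_trans)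
  qed
  obtain e where e: "\<And>x. x \<in> A \<Longrightarrow> e (ch c1 x) = x" "partial_hom Cs ch Q (S1 \<union> ch c1 ` A) e"
    using locally_mapsD[OF l1 c1(1) S1] by blast
  have ez: "e z = w1" using e(1) c1 by metis
  have zC: "z \<in> ch c1 ` A" "z \<in> ch c2 ` A"
    using imageI[OF c1(2), of "ch c1"] imageI[OF c2(2), of "ch c2"] c1(3) c2(3) by simp_all
  define Y where "Y = insert w1 (e ` S1)"
  have Y: "Y \<subseteq> A" "card Y \<le> K + 1" "w1 \<in> Y"
  proof -
    show "Y \<subseteq> A" using partial_homD(1)[OF e(2)] c1 unfolding Y_def by auto
    have "card (e ` S1) \<le> K" using card_image_le[OF S1(2), of e] S1(3) by linarith
    then show "card Y \<le> K + 1" unfolding Y_def using S1(2)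
      by (simp add: card_insert_if)
  qed (simp add: Y_def)
  have "covers w2 w1" using eq by (simp add: eqv_def)
  then obtain t where t: "t ` Y \<subseteq> A" "t w1 = w2"
    "\<forall>i\<in>I. \<forall>x\<in>Y. \<forall>y\<in>Y. (x, y) \<in> r i \<longrightarrow> (t x, t y) \<in> r i"
    using Y unfolding covers_def by meson
  \<comment> \<open>\<open>f\<close> moves all of \<open>S\<close> into the second family without
    increasing the number of points, so the hypothesis on \<open>C2\<close> applies to the image
    with the same \<open>K\<close>.\<close>
  define f where "f u = (if u \<in> cov ch C2 then u else ch c2 (t (e u)))" for u
  define S2 where "S2 = f ` S"
  have tA: "t (e u) \<in> A" if "u \<in> S1" for u using that t(1) Y_def by auto
  have S2: "S2 \<subseteq> cov ch C2" "finite S2" "card S2 \<le> K"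
  proof -
    show "S2 \<subseteq> cov ch C2"
      using tA c2 unfolding S2_def f_def S1_def cov_def by auto
    show "card S2 \<le> K" using card_image_le[OF S(2), of f] S(3) unfolding S2_def by linarith
  qed (simp add: S2_def S)
  obtain h where h: "\<And>x. x \<in> A \<Longrightarrow> h (ch b x) = x" "partial_hom Cs ch Q (S2 \<union> ch b ` A) h"
    using locally_mapsD[OF l2 b S2] by blast
  note hD = partial_homD[OF h(2)]
  have bcov: "ch b ` A \<subseteq> cov ch C2" using b unfolding cov_def by auto
  define D where "D = S \<union> ch b ` A"
  have fD: "f u \<in> S2 \<union> ch b ` A" if "u \<in> D" for u
    using that bcov unfolding D_def S2_def f_def by auto
  have side: "u \<in> cov ch C2 \<or> u \<in> S1" if "u \<in> D" for u
    using that bcov unfolding D_def S1_def by auto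
  have S1D: "u \<in> cov ch C1 - {z} \<and> f u = ch c2 (t (e u)) \<and> u \<notin> cov ch C2" if "u \<in> S1" for u
  proof -
    have "u \<in> cov ch C1" "u \<notin> cov ch C2" using that S1 unfolding S1_def by auto
    moreover have "z \<in> cov ch C2" using zC c2(1) unfolding cov_def by auto
    ultimately show ?thesis unfolding f_def by auto
  qed
  have zf: "f z = z" using zC c2(1) unfolding f_def cov_def by auto
  have zt: "z = ch c2 (t (e z))" using ez t(2) c2(3) by simp
  have ze: "z \<in> S1 \<union> ch c1 ` A" using zC by auto
  have c2s: "c2 \<in> Cs" using c2 sub by auto
  have eY: "e u \<in> Y" if "u \<in> insert z S1" for u using that ez unfolding Y_def by auto
  have tr_ed: "(t (e u), t (e v)) \<in> r i" if "i \<in> I" "(e u, e v) \<in> r i" "u \<in> insert z S1" "v \<in> insert z S1" for i u v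
    using t(3) eY that by blast
  have fz: "f u = ch c2 (t (e u))" if "u \<in> insert z S1" for u using that S1D zf zt by auto
  have subD: "insert z S1 \<subseteq> S1 \<union> ch c1 ` A" using ze by auto
  have "partial_hom Cs ch Q D (h \<circ> f)"
  proof (rule partial_homI)
    fix u assume "u \<in> D" then show "(h \<circ> f) u \<in> A" using fD hD(1) by simp
  next
    fix i c x y assume i: "i \<in> I" and c: "c \<in> Cs" and xy: "(x, y) \<in> r i"
      and D: "ch c x \<in> D" "ch c y \<in> D"
    have xyA: "x \<in> A" "y \<in> A" using rA[OF i] xy by auto
    show "((h \<circ> f) (ch c x), (h \<circ> f) (ch c y)) \<in> r i"
    proof (cases "ch c x \<in> S1 \<or> ch c y \<in> S1")
      case False
      then have "f (ch c x) = ch c x" "f (ch c y) = ch c y" using side D unfolding f_def by auto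
      then show ?thesis using hD(2)[OF i c xy] fD D by (metis comp_apply)
    next
      case True
      then have "ch c ` A \<inter> (cov ch C2 - {z}) = {}" using sepI[OF c] S1D xyA by blast
      then have ins: "ch c x \<in> insert z S1" "ch c y \<in> insert z S1"
        using side D xyA by blast+
      have "(e (ch c x), e (ch c y)) \<in> r i"
        using partial_homD(2)[OF e(2) i c xy] ins subD by blast
      then have "(t (e (ch c x)), t (e (ch c y))) \<in> r i" using tr_ed i ins by blast
      then have "(h (ch c2 (t (e (ch c x)))), h (ch c2 (t (e (ch c y))))) \<in> r i"
        using hD(2)[OF i c2s] fD D fz ins by metis
      then show ?thesis using fz ins by simp
    qed
  next
    fix j u v assume j: "j \<in> J" and D: "u \<in> D" "v \<in> D" and uv: "(u, v) \<in> Q j"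
    have jI: "j \<in> I" using j JI by auto
    have both: "(f u', f v') \<in> Q j" if "u' \<in> insert z S1" "v' \<in> insert z S1" "(u', v') \<in> Q j" for u' v'
    proof -
      have "(e u', e v') \<in> r j" using partial_homD(3)[OF e(2) j] subD that by blast
      then have "(t (e u'), t (e v')) \<in> r j" using tr_ed jI that by blast
      then show ?thesis using chart[OF j c2s] fz that by metis
    qed
    \<comment> \<open>An edge on the second side is unchanged, one on the first side is copied into
      the chart of \<open>c2\<close> by \<open>both\<close>. An edge between the sides is split at
      \<open>z\<close>, and its halves are joined again by transitivity.\<close>
    have "(f u, f v) \<in> Q j"
    proof (cases "u \<in> S1")
      case True
      show ?thesis
      proof (cases "v \<in> insert z S1")
        case True then show ?thesis using both \<open>u \<in> S1\<close> uv by blast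
      next
        case False
        then have v: "v \<in> cov ch C2 - {z}" using side D by auto
        from sepJ[OF j _ v uv] True S1D have "(u, z) \<in> Q j" "(z, v) \<in> Q j" by auto
        then have "(f u, z) \<in> Q j" using both[of u z] True zf by auto
        moreover have "f v = v" using v unfolding f_def by auto
        ultimately show ?thesis using \<open>(z, v) \<in> Q j\<close> tr[OF j] by (metis transD)
      qed
    next
      case uF: False
      then have u: "u \<in> cov ch C2" using side D by auto
      then have fu: "f u = u" unfolding f_def by auto
      show ?thesis
      proof (cases "v \<in> S1")
        case False
        then have "f v = v" using side D unfolding f_def by auto
        then show ?thesis using fu uv by simp
      next
        case True
        show ?thesis
        proof (cases "u = z")
          case True then show ?thesis using both[of u v] \<open>v \<in> S1\<close> uv by auto
        next
          case False
          from sepJ'[OF j _ _ uv] \<open>v \<in> S1\<close> S1D u False have "(u, z) \<in> Q j" "(z, v) \<in> Q j" by auto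
          then have "(z, f v) \<in> Q j" using both[of z v] \<open>v \<in> S1\<close> zf by auto
          then show ?thesis using \<open>(u, z) \<in> Q j\<close> tr[OF j] fu by (metis transD)
        qed
      qed
    qed
    then show "((h \<circ> f) u, (h \<circ> f) v) \<in> r j" using hD(3)[OF j] fD D by simp
  qed
  moreover have "\<forall>x\<in>A. (h \<circ> f) (ch b x) = x"
    using h(1) bcov unfolding f_def by auto
  ultimately show ?thesis unfolding D_def by blast
qed

text \<open>The anchor chart \<open>b\<close> may belong to either family; the hypotheses, including
  \<open>eqv\<close>, are symmetric, so both cases are instances of
  \<open>amalgam_half\<close>.\<close>

lemma amalgam:
  fixes ch :: "'c \<Rightarrow> 'a \<Rightarrow> 'p"
  assumes l1: "locally_maps Cs ch Q C1" and l2: "locally_maps Cs ch Q C2" and sub: "C1 \<subseteq> Cs" "C2 \<subseteq> Cs"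
    and meet: "cov ch C1 \<inter> cov ch C2 \<subseteq> {z}"
    and c1: "c1 \<in> C1" "w1 \<in> A" "ch c1 w1 = z" and c2: "c2 \<in> C2" "w2 \<in> A" "ch c2 w2 = z"
    and eq: "eqv w1 w2"
    and tr: "\<And>j. j \<in> J \<Longrightarrow> trans (Q j)"
    and chart: "\<And>j c x y. j \<in> J \<Longrightarrow> c \<in> Cs \<Longrightarrow> (x, y) \<in> r j \<Longrightarrow> (ch c x, ch c y) \<in> Q j"
    and sepJ: "\<And>j u v. j \<in> J \<Longrightarrow> u \<in> cov ch C1 - {z} \<Longrightarrow> v \<in> cov ch C2 - {z} \<Longrightarrow>
        (u, v) \<in> Q j \<Longrightarrow> (u, z) \<in> Q j \<and> (z, v) \<in> Q j"
    and sepJ': "\<And>j u v. j \<in> J \<Longrightarrow> u \<in> cov ch C1 - {z} \<Longrightarrow> v \<in> cov ch C2 - {z} \<Longrightarrow>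
        (v, u) \<in> Q j \<Longrightarrow> (v, z) \<in> Q j \<and> (z, u) \<in> Q j"
    and sepI: "\<And>c. c \<in> Cs \<Longrightarrow> ch c ` A \<inter> (cov ch C1 - {z}) = {} \<or> ch c ` A \<inter> (cov ch C2 - {z}) = {}"
  shows "locally_maps Cs ch Q (C1 \<union> C2)"
  unfolding locally_maps_def
proof (intro ballI allI impI)
  fix b S assume b: "b \<in> C1 \<union> C2" and S: "S \<subseteq> cov ch (C1 \<union> C2)" "finite S" "card S \<le> K"
  have meet': "cov ch C2 \<inter> cov ch C1 \<subseteq> {z}" using meet by blast
  have S': "S \<subseteq> cov ch (C2 \<union> C1)" using S by (simp add: Un_commute)
  have sepI': "ch c ` A \<inter> (cov ch C2 - {z}) = {} \<or> ch c ` A \<inter> (cov ch C1 - {z}) = {}" if "c \<in> Cs" for c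
    using sepI[OF that] by blast
  show "\<exists>h. (\<forall>x\<in>A. h (ch b x) = x) \<and> partial_hom Cs ch Q (S \<union> ch b ` A) h"
  proof (cases "b \<in> C2")
    case True
    show ?thesis
      by (rule amalgam_half[OF l1 l2 sub meet c1 c2 eq tr chart sepJ sepJ' sepI True S])
  next
    case False
    then have "b \<in> C1" using b by simp
    show ?thesis
      by (rule amalgam_half[OF l2 l1 sub(2,1) meet' c2 c1 eqv_sym[OF eq] tr chart sepJ' sepJ sepI' \<open>b \<in> C1\<close> S' S(2,3)])
  qed
qed

text \<open>The invariant of the recursion. A center glued at a bag element agrees with it only up
  to type. The clause on \<open>tot\<close> makes the centers of a component over a clique
  interchangeable for the relation of that clique, so leaving from any center counts as leaving from
  the root.\<close>

definition good :: "'a set \<Rightarrow> 'a \<Rightarrow> ('a, 'i) comp \<Rightarrow> bool" where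
  "good X a C \<longleftrightarrow> finite (cB C) \<and> cr C \<in> cB C \<and> cp C (cr C) = a \<and> cp C ` cB C \<subseteq> X \<and>
     (\<forall>c\<in>cB C. \<forall>w\<in>W (cp C c) \<inter> X. cg C c w \<in> cB C \<and> eqv (cp C (cg C c w)) w) \<and>
     (\<forall>c\<in>cB C. cg C c (cp C c) = c) \<and>
     (\<forall>j\<in>J. trans (cQ C j) \<and> cQ C (iv j) = (cQ C j)\<inverse> \<and>
        (\<forall>c\<in>cB C. \<forall>x y. (x, y) \<in> r j \<longrightarrow> (io X C c x, io X C c y) \<in> cQ C j) \<and>
        (tot X j \<longrightarrow> (\<forall>c\<in>cB C. \<forall>d\<in>cB C. (Inl c, Inl d) \<in> cQ C j))) \<and>
     locally_maps (cB C) (io X C) (cQ C) (cB C)"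

lemma goodD:
  assumes "good X a C"
  shows "finite (cB C)" "cr C \<in> cB C" "cp C (cr C) = a"
    and "c \<in> cB C \<Longrightarrow> cp C c \<in> X"
    and "c \<in> cB C \<Longrightarrow> w \<in> W (cp C c) \<Longrightarrow> w \<in> X \<Longrightarrow> cg C c w \<in> cB C"
    and "c \<in> cB C \<Longrightarrow> w \<in> W (cp C c) \<Longrightarrow> w \<in> X \<Longrightarrow> eqv (cp C (cg C c w)) w"
    and "c \<in> cB C \<Longrightarrow> cg C c (cp C c) = c"
    and "j \<in> J \<Longrightarrow> trans (cQ C j)"
    and "j \<in> J \<Longrightarrow> cQ C (iv j) = (cQ C j)\<inverse>"
    and "j \<in> J \<Longrightarrow> c \<in> cB C \<Longrightarrow> (x, y) \<in> r j \<Longrightarrow> (io X C c x, io X C c y) \<in> cQ C j"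
    and "j \<in> J \<Longrightarrow> tot X j \<Longrightarrow> c \<in> cB C \<Longrightarrow> d \<in> cB C \<Longrightarrow> (Inl c, Inl d) \<in> cQ C j"
    and "locally_maps (cB C) (io X C) (cQ C) (cB C)"
  using assms unfolding good_def by auto

lemma io_center:
  assumes "good X a C" "X \<subseteq> A" "c \<in> cB C"
  shows "io X C c (cp C c) = Inl c"
  using goodD(4)[OF assms(1,3)] goodD(7)[OF assms(1,3)] W_self assms(2) by (auto simp: io_def)

text \<open>With \<open>S = {}\<close> a local map is a left inverse of the chart of
  \<open>c\<close>. Hence charts are injective and, in \<open>io_refl\<close>, reflect the relations
  in \<open>J\<close>.\<close>

lemma io_inj:
  assumes "good X a C" "c \<in> cB C" "x \<in> A" "y \<in> A" "io X C c x = io X C c y"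
  shows "x = y"
proof -
  obtain h where "\<And>x. x \<in> A \<Longrightarrow> h (io X C c x) = x"
    using locally_mapsD[OF goodD(12)[OF assms(1)] assms(2), of "{}"] by auto
  then show ?thesis using assms by metis
qed

lemma io_refl:
  assumes "good X a C" "c \<in> cB C" "x \<in> A" "y \<in> A" "j \<in> J" "(io X C c x, io X C c y) \<in> cQ C j"
  shows "(x, y) \<in> r j"
proof -
  obtain h where h: "\<And>x. x \<in> A \<Longrightarrow> h (io X C c x) = x" "partial_hom (cB C) (io X C) (cQ C) ({} \<union> io X C c ` A) h"
    using locally_mapsD[OF goodD(12)[OF assms(1)] assms(2), of "{}"] by auto
  have "(h (io X C c x), h (io X C c y)) \<in> r j"
    using partial_homD(3)[OF h(2) assms(5)] assms by auto
  then show ?thesis using h(1) assms by auto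
qed

text \<open>The end of the recursion: one center, whose chart is a copy of the whole given structure
  with \<open>a\<close> marked.\<close>

definition triv :: "'a \<Rightarrow> ('a, 'i) comp" where
  "triv a = \<lparr>cB = {L}, cr = L, cp = (\<lambda>_. a), cg = (\<lambda>_ _. L),
     cQ = (\<lambda>j. {(if x = a then Inl L else Inr (L, x), if y = a then Inl L else Inr (L, y)) | x y. (x, y) \<in> r j})\<rparr>"

lemma triv_sel: "cB (triv a) = {L}" "cr (triv a) = L" "cp (triv a) c = a" "cg (triv a) c w = L"
  unfolding triv_def by simp_all

lemma io_triv: "a \<in> A \<Longrightarrow> io {a} (triv a) c x = (if x = a then Inl L else Inr (c, x))"
  using W_self by (auto simp: io_def triv_sel)

lemma good_trivial:
  assumes a: "a \<in> A" shows "good {a} a (triv a)"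
proof -
  let ?f = "\<lambda>x. if x = a then Inl L else Inr (L, x) :: 'a el + 'a el \<times> 'a"
  define h where "h = case_sum (\<lambda>_ :: 'a el. a) (snd :: 'a el \<times> 'a \<Rightarrow> 'a)"
  have hf: "h (?f x) = x" for x by (simp add: h_def)
  have io: "io {a} (triv a) L = ?f" using io_triv[OF a] by auto
  have Q: "cQ (triv a) j = {(?f x, ?f y) | x y. (x, y) \<in> r j}" for j
    unfolding triv_def comp.select_convs by (rule refl)
  have inj: "?f x = ?f y \<longleftrightarrow> x = y" for x y by auto
  have "trans (cQ (triv a) j)" if "j \<in> J" for j
  proof (rule transI)
    fix u v w assume "(u, v) \<in> cQ (triv a) j" "(v, w) \<in> cQ (triv a) j"
    then obtain x y y' z where "u = ?f x" "v = ?f y" "v = ?f y'" "w = ?f z" "(x, y) \<in> r j" "(y', z) \<in> r j"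
      unfolding Q by blast
    moreover from this have "y = y'" using inj by metis
    ultimately show "(u, w) \<in> cQ (triv a) j" unfolding Q using trans_r[OF that] by (blast dest: transD)
  qed
  moreover have "cQ (triv a) (iv j) = (cQ (triv a) j)\<inverse>" if "j \<in> J" for j
    unfolding Q r_iv[OF that] by blast
  moreover have "locally_maps (cB (triv a)) (io {a} (triv a)) (cQ (triv a)) (cB (triv a))"
    unfolding locally_maps_def
  proof (intro ballI allI impI, intro exI[of _ h] conjI)
    fix b S assume b: "b \<in> cB (triv a)" and S: "S \<subseteq> cov (io {a} (triv a)) (cB (triv a))"
    have b: "b = L" using b by (simp add: triv_sel)
    show "\<forall>x\<in>A. h (io {a} (triv a) b x) = x" unfolding b io using hf by auto
    have S: "S \<subseteq> ?f ` A" using S unfolding cov_def by (simp add: triv_sel io)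
    show "partial_hom (cB (triv a)) (io {a} (triv a)) (cQ (triv a)) (S \<union> io {a} (triv a) b ` A) h"
    proof (rule partial_homI)
      fix u assume "u \<in> S \<union> io {a} (triv a) b ` A"
      then obtain x where "x \<in> A" "u = ?f x" using S unfolding b io by blast
      then show "h u \<in> A" using hf[of x] by (simp only:)
    next
      fix i c x y assume "c \<in> cB (triv a)" "(x, y) \<in> r i"
      then show "(h (io {a} (triv a) c x), h (io {a} (triv a) c y)) \<in> r i"
        using hf io by (simp add: triv_sel)
    next
      fix j u v assume "(u, v) \<in> cQ (triv a) j"
      then obtain x y where "(x, y) \<in> r j" "u = ?f x" "v = ?f y" unfolding Q by blast
      then show "(h u, h v) \<in> r j" using hf[of x] hf[of y] by (simp only:)
    qed
  qed
  moreover have "(io {a} (triv a) L x, io {a} (triv a) L y) \<in> cQ (triv a) j" if "(x, y) \<in> r j" for x y j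
    unfolding io Q using that by blast
  moreover have "(Inl L, Inl L) \<in> cQ (triv a) j" if "tot {a} j" for j
  proof -
    have "(a, a) \<in> r j" using that by (simp add: tot_def)
    then have "(?f a, ?f a) \<in> cQ (triv a) j" unfolding Q by blast
    then show ?thesis by simp
  qed
  ultimately show ?thesis
    unfolding good_def triv_sel using eqv_refl[OF a] by blast
qed

end

section \<open>Trees of components\<close>

fun idx :: "'b \<Rightarrow> 'b list \<Rightarrow> nat" where
  "idx j [] = 0"
| "idx j (x # xs) = (if x = j then 0 else Suc (idx j xs))"

lemma idx_less: "j \<in> set q \<Longrightarrow> idx j q < length q"
  by (induction q) auto

text \<open>In a queue whose entries only drop out and whose newcomers join at the back, a survivor
  never moves away from the head; it moves closer once the head drops out
  (\<open>idx_filter_less\<close>).\<close>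

lemma idx_filter: "j \<in> set q \<Longrightarrow> P j \<Longrightarrow> idx j (filter P q @ ys) \<le> idx j q"
  by (induction q) auto

lemma idx_filter_less:
  assumes "j \<in> set q" "P j" "\<not> P (hd q)" shows "idx j (filter P q @ ys) < idx j q"
proof (cases q)
  case (Cons x xs)
  then have "j \<in> set xs" "x \<noteq> j" "filter P q = filter P xs" using assms by auto
  then show ?thesis using idx_filter[of j xs P ys] assms(2) Cons by simp
qed (use assms in simp)

type_synonym 'a path = "('a el \<times> 'a) list"

type_synonym 'b pt = "('b path \<times> 'b el) + (('b path \<times> 'b el) \<times> 'b)"

locale tree_frame = bag_structure A r I J iv W K
  for A :: "'a set" and r :: "'i \<Rightarrow> 'a rel" and I J :: "'i set" and iv :: "'i \<Rightarrow> 'i"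
    and W :: "'a \<Rightarrow> 'a set" and K :: nat +
  fixes X :: "'a set" and D :: nat and CP :: "'a \<times> 'i list \<Rightarrow> ('a, 'i) comp"
  assumes XA: "X \<subseteq> A"
begin

definition NT :: "'i set" where "NT = {j \<in> J. \<not> tot X j}"
text \<open>The state of a node is the value of its root and a queue of the non-total relations that lead
  from the root of the parent into the node, the longest running one first. The component of the node lives on
  the clique of the root with respect to the head of the queue. The root of a child is replaced by
  an element of the same type that is minimal for the new head, so along a run of this head no type
  occurs twice. At depth \<open>D\<close> the tree starts afresh from a representative.\<close>

definition jl :: "'i list" where "jl = (SOME l. set l = NT \<and> distinct l)"
definition cl :: "'i \<Rightarrow> 'a \<Rightarrow> 'a set" where "cl j a = insert a {x \<in> X. (a, x) \<in> r j \<and> (x, a) \<in> r j}"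
definition Xs :: "'a \<times> 'i list \<Rightarrow> 'a set" where
  "Xs st = (if snd st = [] then {fst st} else cl (hd (snd st)) (fst st))"
definition okst :: "'a \<times> 'i list \<Rightarrow> bool" where
  "okst st \<longleftrightarrow> fst st \<in> X \<and> set (snd st) \<subseteq> NT \<and> distinct (snd st)"
definition rep :: "'a \<Rightarrow> 'a" where "rep w = (SOME x. x \<in> X \<and> eqv x w)"
definition minim :: "'i \<Rightarrow> 'a \<Rightarrow> 'a" where
  "minim j w = (SOME x. x \<in> X \<and> eqv x w \<and> (x = w \<or> (w, x) \<in> r j) \<and>
     (\<forall>y\<in>X. eqv y x \<longrightarrow> (x, y) \<in> r j \<longrightarrow> (y, x) \<in> r j))"
definition run :: "'a \<times> 'i list \<Rightarrow> 'a el \<times> 'a \<Rightarrow> 'i \<Rightarrow> bool" where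
  "run st s j \<longleftrightarrow> (Inl (cr (CP st)), Inr s) \<in> cQ (CP st) j"
text \<open>Survivors keep their order and newcomers line up behind them; \<open>jl\<close> merely
  fixes the order among the newcomers of one step.\<close>

definition upd :: "'a \<times> 'i list \<Rightarrow> 'a el \<times> 'a \<Rightarrow> 'i list" where
  "upd st s = filter (run st s) (snd st) @ filter (\<lambda>j. j \<notin> set (snd st) \<and> run st s j) jl"
definition nxt :: "nat \<Rightarrow> 'a \<times> 'i list \<Rightarrow> 'a el \<times> 'a \<Rightarrow> 'a \<times> 'i list" where
  "nxt d st s = (if Suc d = D then (rep (snd s), [])
     else (if upd st s = [] then snd s else minim (hd (upd st s)) (snd s), upd st s))"

fun sta :: "'a \<Rightarrow> 'a path \<Rightarrow> 'a \<times> 'i list" where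
  "sta a [] = (a, [])"
| "sta a (s # \<pi>) = nxt (length \<pi>) (sta a \<pi>) s"

abbreviation "Cm a \<pi> \<equiv> CP (sta a \<pi>)"
abbreviation "XX a \<pi> \<equiv> Xs (sta a \<pi>)"

text \<open>Bag elements in the current clique are served inside the component; only those outside
  of it open a child.\<close>

fun valid :: "'a \<Rightarrow> 'a path \<Rightarrow> bool" where
  "valid a [] \<longleftrightarrow> a \<in> X"
| "valid a (s # \<pi>) \<longleftrightarrow> valid a \<pi> \<and> fst s \<in> cB (Cm a \<pi>) \<and>
     snd s \<in> W (cp (Cm a \<pi>) (fst s)) \<inter> X - XX a \<pi>"

end

text \<open>\<open>CPt\<close> takes care of singleton domains: the head relation may lack a loop
  there, so totality could not link several centers to the root, whereas \<open>triv\<close> has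
  only one center.\<close>

locale component_tree = tree_frame A r I J iv W K X D CP
  for A :: "'a set" and r :: "'i \<Rightarrow> 'a rel" and I J :: "'i set" and iv :: "'i \<Rightarrow> 'i"
    and W :: "'a \<Rightarrow> 'a set" and K :: nat
    and X :: "'a set" and D :: nat and CP :: "'a \<times> 'i list \<Rightarrow> ('a, 'i) comp" +
  assumes CPg: "okst st \<Longrightarrow> good (Xs st) (fst st) (CP st)"
    and CPt: "okst st \<Longrightarrow> Xs st = {fst st} \<Longrightarrow> CP st = triv (fst st)"
begin

section \<open>States of nodes and minimal elements of a type\<close>

lemma finNT: "finite NT" using finI JI unfolding NT_def by (auto intro: finite_subset)

lemma jl: "set jl = NT" "distinct jl"
proof -
  have "\<exists>l. set l = NT \<and> distinct l" using finite_distinct_list[OF finNT] by blast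
  then have "set jl = NT \<and> distinct jl" unfolding jl_def by (rule someI_ex)
  then show "set jl = NT" "distinct jl" by auto
qed

lemma rep:
  assumes "w \<in> X" shows "rep w \<in> X" "eqv (rep w) w"
proof -
  have "\<exists>x. x \<in> X \<and> eqv x w" using assms XA eqv_refl by blast
  then have "rep w \<in> X \<and> eqv (rep w) w" unfolding rep_def by (rule someI_ex)
  then show "rep w \<in> X" "eqv (rep w) w" by auto
qed

lemma minim_ex:
  assumes "w \<in> X" "j \<in> J"
  shows "\<exists>x. x \<in> X \<and> eqv x w \<and> (x = w \<or> (w, x) \<in> r j) \<and>
     (\<forall>y\<in>X. eqv y x \<longrightarrow> (x, y) \<in> r j \<longrightarrow> (y, x) \<in> r j)"
proof -
  define Y where "Y = {x \<in> X. eqv x w \<and> (x = w \<or> (w, x) \<in> r j)}"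
  \<comment> \<open>\<open>f\<close> counts the elements of \<open>Y\<close> still reachable from
    \<open>x\<close>. A strict descent loses at least \<open>x\<close> itself, so a minimum of
    \<open>f\<close> admits none.\<close>
  define f where "f x = card {y \<in> Y. y = x \<or> (x, y) \<in> r j}" for x
  have finY: "finite Y" using finA XA unfolding Y_def by (auto intro: finite_subset)
  have "w \<in> Y" using assms XA eqv_refl unfolding Y_def by auto
  then obtain x where x: "x \<in> Y" "\<And>y. y \<in> Y \<Longrightarrow> f x \<le> f y"
    using ex_min_if_finite[of "f ` Y"] finY by (metis empty_iff finite_imageI imageE imageI not_le_imp_less)
  have "(y, x) \<in> r j" if y: "y \<in> X" "eqv y x" "(x, y) \<in> r j" for y
  proof (rule ccontr)
    assume n: "(y, x) \<notin> r j"
    have yY: "y \<in> Y"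
      using x(1) y eqv_trans transD[OF trans_r[OF assms(2)]] unfolding Y_def by blast
    have "{u \<in> Y. u = y \<or> (y, u) \<in> r j} \<subset> {u \<in> Y. u = x \<or> (x, u) \<in> r j}"
    proof (rule psubsetI)
      show "{u \<in> Y. u = y \<or> (y, u) \<in> r j} \<subseteq> {u \<in> Y. u = x \<or> (x, u) \<in> r j}"
        using y(3) transD[OF trans_r[OF assms(2)]] by blast
      have "x \<notin> {u \<in> Y. u = y \<or> (y, u) \<in> r j}" using n y(3) by auto
      then show "{u \<in> Y. u = y \<or> (y, u) \<in> r j} \<noteq> {u \<in> Y. u = x \<or> (x, u) \<in> r j}"
        using x(1) by blast
    qed
    then have "f y < f x" unfolding f_def by (intro psubset_card_mono) (use finY in auto)
    then show False using x(2)[OF yY] by simp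
  qed
  then show ?thesis using x(1) unfolding Y_def by blast
qed

lemma minim:
  assumes "w \<in> X" "j \<in> J"
  shows "minim j w \<in> X" "eqv (minim j w) w" "minim j w = w \<or> (w, minim j w) \<in> r j"
    "\<And>y. y \<in> X \<Longrightarrow> eqv y (minim j w) \<Longrightarrow> (minim j w, y) \<in> r j \<Longrightarrow> (y, minim j w) \<in> r j"
  using someI_ex[OF minim_ex[OF assms]] unfolding minim_def[symmetric] by blast+

lemma upd_NT: "okst st \<Longrightarrow> set (upd st s) \<subseteq> NT \<and> distinct (upd st s)"
  unfolding upd_def okst_def using jl by auto

lemma NTJ: "NT \<subseteq> J" unfolding NT_def by auto

lemma nxt:
  assumes "okst st" "snd s \<in> X"
  shows "okst (nxt d st s)" "eqv (fst (nxt d st s)) (snd s)"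
proof -
  have hd: "hd (upd st s) \<in> J" if "upd st s \<noteq> []"
    using that upd_NT[OF assms(1), of s] NTJ by (meson hd_in_set subsetD)
  show "okst (nxt d st s)" "eqv (fst (nxt d st s)) (snd s)"
    using upd_NT[OF assms(1), of s] rep[OF assms(2)] assms(2) minim(1,2)[OF assms(2) hd] eqv_refl XA
    unfolding nxt_def okst_def by auto
qed

lemma valid_ok: "valid a \<pi> \<Longrightarrow> okst (sta a \<pi>)"
proof (induction \<pi>)
  case Nil then show ?case by (simp add: okst_def)
next
  case (Cons s \<pi>) then show ?case using nxt(1) by simp
qed

lemma valid_eqv: "valid a (s # \<pi>) \<Longrightarrow> eqv (fst (sta a (s # \<pi>))) (snd s)"
  using nxt(2) valid_ok[of a \<pi>] by simp

lemma valid_good: "valid a \<pi> \<Longrightarrow> good (XX a \<pi>) (fst (sta a \<pi>)) (Cm a \<pi>)"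
  using CPg valid_ok by blast

lemma Xs_X: "okst st \<Longrightarrow> Xs st \<subseteq> X \<and> fst st \<in> Xs st"
  unfolding Xs_def cl_def okst_def by auto

lemma XX_X: "valid a \<pi> \<Longrightarrow> XX a \<pi> \<subseteq> X" using Xs_X valid_ok by blast
lemma XX_A: "valid a \<pi> \<Longrightarrow> XX a \<pi> \<subseteq> A" using XX_X XA by blast

lemma valid_append: "valid a (\<xi> @ \<mu>) \<Longrightarrow> valid a \<mu>"
  by (induction \<xi>) auto


section \<open>The tree, its gates and its relations\<close>

definition chU :: "'a \<Rightarrow> 'a path \<times> 'a el \<Rightarrow> 'a \<Rightarrow> 'a pt" where
  "chU a u x = (let \<pi> = fst u; c = snd u in
     if x \<in> W (cp (Cm a \<pi>) c) \<inter> X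
     then if x \<in> XX a \<pi> then Inl (\<pi>, cg (Cm a \<pi>) c x) else Inl ((c, x) # \<pi>, cr (Cm a ((c, x) # \<pi>)))
     else Inr ((\<pi>, c), x))"

definition CU :: "'a \<Rightarrow> ('a path \<times> 'a el) set" where
  "CU a = {(\<pi>, c). valid a \<pi> \<and> c \<in> cB (Cm a \<pi>)}"
definition nodeC :: "'a \<Rightarrow> 'a path \<Rightarrow> ('a path \<times> 'a el) set" where
  "nodeC a \<pi> = {\<pi>} \<times> cB (Cm a \<pi>)"

definition node :: "'a pt \<Rightarrow> 'a path" where "node u = (case u of Inl v \<Rightarrow> fst v | Inr w \<Rightarrow> fst (fst w))"
definition lcl :: "'a pt \<Rightarrow> 'a el + 'a el \<times> 'a" where
  "lcl u = (case u of Inl v \<Rightarrow> Inl (snd v) | Inr w \<Rightarrow> Inr (snd (fst w), snd w))"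
definition val :: "'a \<Rightarrow> 'a pt \<Rightarrow> 'a" where
  "val a u = (case u of Inl v \<Rightarrow> cp (Cm a (fst v)) (snd v) | Inr w \<Rightarrow> snd w)"

text \<open>\<open>gate a \<mu> u\<close> is the point of the component at \<open>\<mu>\<close> through which every path from \<open>u\<close> enters
  that component.\<close>

fun gt :: "'a \<Rightarrow> 'a path \<Rightarrow> 'a path \<Rightarrow> 'a el + 'a el \<times> 'a \<Rightarrow> 'a el + 'a el \<times> 'a" where
  "gt a \<mu> [] l = (if \<mu> = [] then l else Inl (cr (Cm a \<mu>)))"
| "gt a \<mu> (s # \<pi>) l = (if s # \<pi> = \<mu> then l else gt a \<mu> \<pi> (Inr s))"

definition gate :: "'a \<Rightarrow> 'a path \<Rightarrow> 'a pt \<Rightarrow> 'a el + 'a el \<times> 'a" where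
  "gate a \<mu> u = gt a \<mu> (node u) (lcl u)"

lemma gt_same: "gt a \<pi> \<pi> l = l" by (cases \<pi>) auto
lemma gt_indep: "\<mu> \<noteq> \<pi> \<Longrightarrow> gt a \<mu> \<pi> l = gt a \<mu> \<pi> l'" by (cases \<pi>) auto
text \<open>From outside the subtree of \<open>\<mu>\<close> one enters through the root of
  \<open>\<mu>\<close>; from below the child at step \<open>s\<close> one enters through
  \<open>Inr s\<close>, which is \<open>gt_suffix\<close>.\<close>

lemma gt_nosuffix: "(\<And>\<xi>. \<pi> \<noteq> \<xi> @ \<mu>) \<Longrightarrow> gt a \<mu> \<pi> l = Inl (cr (Cm a \<mu>))"
proof (induction \<pi> arbitrary: l)
  case Nil then show ?case by auto
next
  case (Cons s \<pi>)
  then show ?case by (metis append_Cons append_Nil gt.simps(2))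
qed
lemma gt_short: "length \<mu> > length \<pi> \<Longrightarrow> gt a \<mu> \<pi> l = Inl (cr (Cm a \<mu>))"
  by (rule gt_nosuffix) auto
lemma gt_suffix: "gt a \<mu> (\<xi> @ s # \<mu>) l = Inr s"
proof (induction \<xi> arbitrary: l)
  case Nil show ?case by (simp add: gt_same)
next
  case (Cons t \<xi>)
  have "length (t # \<xi> @ s # \<mu>) \<noteq> length \<mu>" by simp
  then have "t # \<xi> @ s # \<mu> \<noteq> \<mu>" by metis
  then show ?case using Cons by simp
qed

definition gn :: "'a \<Rightarrow> 'a path \<Rightarrow> 'a path \<Rightarrow> 'a el + 'a el \<times> 'a" where
  "gn a \<mu> \<pi> = gt a \<mu> \<pi> (Inl (cr (Cm a \<mu>)))"

text \<open>All points of a chart look alike from any other node, so an edge inside a chart is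
  visible only at its own component. This includes the root of a child, whose gate at the child is
  the root anyway.\<close>

lemma gate_chart:
  assumes "valid a \<pi>"
  shows "gate a \<mu> (chU a (\<pi>, c) x) = (if \<mu> = \<pi> then io (XX a \<pi>) (Cm a \<pi>) c x else gn a \<mu> \<pi>)"
proof -
  have XX: "XX a \<pi> \<subseteq> X" by (rule XX_X[OF assms])
  let ?in = "x \<in> W (cp (Cm a \<pi>) c) \<inter> X"
  have ne: "(c, x) # \<pi> \<noteq> \<pi>" by simp
  consider (a) "?in" "x \<in> XX a \<pi>" | (b) ?in "x \<notin> XX a \<pi>" | (c) "\<not> ?in" by blast
  then show ?thesis
  proof cases
    case a
    then have "chU a (\<pi>, c) x = Inl (\<pi>, cg (Cm a \<pi>) c x)" by (simp add: chU_def)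
    then show ?thesis using a gt_same gt_indep[of \<mu> \<pi>]
      by (auto simp: gate_def node_def lcl_def io_def gn_def)
  next
    case b
    then have ch: "chU a (\<pi>, c) x = Inl ((c, x) # \<pi>, cr (Cm a ((c, x) # \<pi>)))" by (simp add: chU_def)
    show ?thesis
    proof (cases "\<mu> = (c, x) # \<pi>")
      case True
      then show ?thesis using ch gt_short[of \<pi> \<mu>] by (simp add: gate_def node_def lcl_def gn_def)
    next
      case False
      then have "gate a \<mu> (chU a (\<pi>, c) x) = gt a \<mu> \<pi> (Inr (c, x))"
        using ch by (auto simp: gate_def node_def lcl_def)
      then show ?thesis using b gt_same gt_indep[of \<mu> \<pi>] by (auto simp: io_def gn_def)
    qed
  next
    case c
    then have "chU a (\<pi>, c) x = Inr ((\<pi>, c), x)" by (auto simp: chU_def)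
    then show ?thesis using c XX gt_same gt_indep[of \<mu> \<pi>]
      by (auto simp: gate_def node_def lcl_def io_def gn_def)
  qed
qed

lemma chart_io_eq:
  assumes "valid a \<pi>" "io (XX a \<pi>) (Cm a \<pi>) c x = io (XX a \<pi>) (Cm a \<pi>) d y"
  shows "chU a (\<pi>, c) x = chU a (\<pi>, d) y"
  using assms(2) XX_X[OF assms(1)] by (auto simp: io_def chU_def split: if_splits)

lemma cov_nodeC: "u \<in> cov (chU a) (nodeC a \<pi>) \<longleftrightarrow> (\<exists>c\<in>cB (Cm a \<pi>). \<exists>x\<in>A. u = chU a (\<pi>, c) x)"
  unfolding cov_def nodeC_def by auto

lemma gate_ne: "valid a \<pi> \<Longrightarrow> u \<in> cov (chU a) (nodeC a \<pi>) \<Longrightarrow> \<mu> \<noteq> \<pi> \<Longrightarrow> gate a \<mu> u = gn a \<mu> \<pi>"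
proof -
  assume v: "valid a \<pi>" and u: "u \<in> cov (chU a) (nodeC a \<pi>)" and ne: "\<mu> \<noteq> \<pi>"
  obtain c x where "u = chU a (\<pi>, c) x" using u unfolding cov_nodeC by blast
  then show ?thesis using gate_chart[OF v, of \<mu> c x] ne by (simp only: if_False)
qed

lemma gate_inj:
  assumes "valid a \<pi>" "u \<in> cov (chU a) (nodeC a \<pi>)" "v \<in> cov (chU a) (nodeC a \<pi>)" "gate a \<pi> u = gate a \<pi> v"
  shows "u = v"
proof -
  obtain c x d y where u: "u = chU a (\<pi>, c) x" and v: "v = chU a (\<pi>, d) y"
    using assms(2,3) unfolding cov_nodeC by blast
  then have "io (XX a \<pi>) (Cm a \<pi>) c x = io (XX a \<pi>) (Cm a \<pi>) d y"
    using assms(4) unfolding u v gate_chart[OF assms(1)] by simp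
  then show ?thesis using chart_io_eq[OF assms(1)] u v by metis
qed

lemma chU_inj:
  assumes "(\<pi>, c) \<in> CU a" "x \<in> A" "y \<in> A" "chU a (\<pi>, c) x = chU a (\<pi>, c) y" shows "x = y"
proof -
  have v: "valid a \<pi>" "c \<in> cB (Cm a \<pi>)" using assms(1) by (auto simp: CU_def)
  have "io (XX a \<pi>) (Cm a \<pi>) c x = io (XX a \<pi>) (Cm a \<pi>) c y"
    using arg_cong[OF assms(4), of "gate a \<pi>"] unfolding gate_chart[OF v(1)] by simp
  then show ?thesis using io_inj[OF valid_good[OF v(1)] v(2)] assms(2,3) by blast
qed

lemma valid_child:
  assumes "valid a \<pi>" "c \<in> cB (Cm a \<pi>)" "x \<in> W (cp (Cm a \<pi>) c)" "x \<in> X" "x \<notin> XX a \<pi>"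
  shows "valid a ((c, x) # \<pi>)" using assms by simp

text \<open>Gluing inside a component, \<open>minim\<close> and \<open>rep\<close> all replace an
  element by an equivalent one, so a chart of the tree reproduces values only up to type.\<close>

lemma val_chart:
  assumes "(\<pi>, c) \<in> CU a" "x \<in> A" shows "eqv (val a (chU a (\<pi>, c) x)) x"
proof -
  have v: "valid a \<pi>" "c \<in> cB (Cm a \<pi>)" using assms(1) by (auto simp: CU_def)
  let ?in = "x \<in> W (cp (Cm a \<pi>) c) \<inter> X"
  consider (a) "?in" "x \<in> XX a \<pi>" | (b) ?in "x \<notin> XX a \<pi>" | (c) "\<not> ?in" by blast
  then show ?thesis
  proof cases
    case a
    then have "chU a (\<pi>, c) x = Inl (\<pi>, cg (Cm a \<pi>) c x)" by (simp add: chU_def)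
    then show ?thesis using goodD(6)[OF valid_good[OF v(1)] v(2)] a by (auto simp: val_def)
  next
    case b
    then have ch: "chU a (\<pi>, c) x = Inl ((c, x) # \<pi>, cr (Cm a ((c, x) # \<pi>)))" by (simp add: chU_def)
    have "valid a ((c, x) # \<pi>)" using valid_child v b by blast
    from valid_eqv[OF this] goodD(3)[OF valid_good[OF this]] show ?thesis using ch by (simp add: val_def)
  next
    case c
    then have "chU a (\<pi>, c) x = Inr ((\<pi>, c), x)" by (auto simp: chU_def)
    then show ?thesis using eqv_refl[OF assms(2)] by (simp add: val_def)
  qed
qed

lemma chart_loop_iff:
  assumes "(\<pi>, c) \<in> CU a" "x \<in> A" "i \<in> I"
  shows "(val a (chU a (\<pi>, c) x), val a (chU a (\<pi>, c) x)) \<in> r i \<longleftrightarrow> (x, x) \<in> r i"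
  using val_chart[OF assms(1,2)] eqv_loop eqv_sym assms(3) by blast

definition pts :: "'a \<Rightarrow> 'a pt set" where "pts a = cov (chU a) (CU a)"

lemma ptsE:
  assumes "u \<in> pts a"
  obtains \<pi> c x where "(\<pi>, c) \<in> CU a" "x \<in> A" "u = chU a (\<pi>, c) x" "valid a \<pi>" "c \<in> cB (Cm a \<pi>)"
  using assms unfolding pts_def cov_def CU_def by auto

text \<open>Reading the relation off at all gates yields transitivity for free. The last clause is needed
  because the gates of \<open>u\<close> and \<open>u\<close> always agree.\<close>

definition QU :: "'a \<Rightarrow> 'i \<Rightarrow> 'a pt rel" where
  "QU a j = {(u, v). u \<in> pts a \<and> v \<in> pts a \<and>
     (\<forall>\<mu>. valid a \<mu> \<longrightarrow> gate a \<mu> u = gate a \<mu> v \<or> (gate a \<mu> u, gate a \<mu> v) \<in> cQ (Cm a \<mu>) j) \<and>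
     (u = v \<longrightarrow> (val a u, val a u) \<in> r j)}"

lemma nodeC_pts: "valid a \<pi> \<Longrightarrow> cov (chU a) (nodeC a \<pi>) \<subseteq> pts a"
  unfolding pts_def cov_def nodeC_def CU_def by blast

lemma root_chart:
  assumes v: "valid a \<nu>"
  shows "chU a (\<nu>, cr (Cm a \<nu>)) (fst (sta a \<nu>)) = Inl (\<nu>, cr (Cm a \<nu>))"
    "fst (sta a \<nu>) \<in> A" "(\<nu>, cr (Cm a \<nu>)) \<in> nodeC a \<nu>"
proof -
  note g = valid_good[OF v]
  show A: "fst (sta a \<nu>) \<in> A" using valid_ok[OF v] XA by (auto simp: okst_def)
  have "io (XX a \<nu>) (Cm a \<nu>) (cr (Cm a \<nu>)) (fst (sta a \<nu>)) = Inl (cr (Cm a \<nu>))"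
    using io_center[OF g XX_A[OF v] goodD(2)[OF g]] goodD(3)[OF g] by simp
  then show "chU a (\<nu>, cr (Cm a \<nu>)) (fst (sta a \<nu>)) = Inl (\<nu>, cr (Cm a \<nu>))"
    using XX_X[OF v] by (auto simp: io_def chU_def split: if_splits)
  show "(\<nu>, cr (Cm a \<nu>)) \<in> nodeC a \<nu>" using goodD(2)[OF g] by (simp add: nodeC_def)
qed

text \<open>The critical case is the root of a child: the chart of the parent contains it, but it
  belongs to the node of the child, where it is the point of its own chart given by
  \<open>root_chart\<close>.\<close>

lemma node_local:
  assumes "u \<in> pts a"
  shows "valid a (node u)" "u \<in> cov (chU a) (nodeC a (node u))"
proof -
  obtain \<pi> c x where u: "(\<pi>, c) \<in> CU a" "x \<in> A" "u = chU a (\<pi>, c) x" "valid a \<pi>" "c \<in> cB (Cm a \<pi>)"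
    using ptsE[OF assms] .
  let ?in = "x \<in> W (cp (Cm a \<pi>) c) \<inter> X"
  consider (a) "?in" "x \<in> XX a \<pi>" | (b) ?in "x \<notin> XX a \<pi>" | (c) "\<not> ?in" by blast
  then have "valid a (node u) \<and> u \<in> cov (chU a) (nodeC a (node u))"
  proof cases
    case b
    then have ch: "u = Inl ((c, x) # \<pi>, cr (Cm a ((c, x) # \<pi>)))" by (simp add: chU_def u)
    have v: "valid a ((c, x) # \<pi>)" using valid_child u(4,5) b by blast
    have "chU a ((c, x) # \<pi>, cr (Cm a ((c, x) # \<pi>))) (fst (sta a ((c, x) # \<pi>))) = u"
      unfolding ch by (rule root_chart(1)[OF v])
    moreover have "node u = (c, x) # \<pi>" using ch by (simp add: node_def)
    ultimately show ?thesis unfolding cov_nodeC using v root_chart(2,3)[OF v] unfolding nodeC_def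
      by (metis SigmaD2)
  qed (use u in \<open>auto simp: node_def chU_def cov_nodeC\<close>)
  then show "valid a (node u)" "u \<in> cov (chU a) (nodeC a (node u))" by auto
qed

lemma CU_nodeC: "valid a \<pi> \<Longrightarrow> nodeC a \<pi> \<subseteq> CU a" by (auto simp: nodeC_def CU_def)

text \<open>Distinct points have distinct gates at the node of \<open>u\<close>, unless \<open>u\<close> is the root of its component;
  then they differ at the parent node.\<close>

lemma QU_loop:
  assumes uv: "(u, v) \<in> QU a j" and vu: "(v, u) \<in> QU a j" and j: "j \<in> J"
  shows "(val a u, val a u) \<in> r j"
proof (cases "u = v")
  case True then show ?thesis using uv by (auto simp: QU_def)
next
  case False
  have up: "u \<in> pts a" "v \<in> pts a" using uv by (auto simp: QU_def)
  have jI: "j \<in> I" using j JI by auto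
  have loop: "(gate a \<mu> u, gate a \<mu> u) \<in> cQ (Cm a \<mu>) j" if "valid a \<mu>" "gate a \<mu> u \<noteq> gate a \<mu> v" for \<mu>
  proof -
    have "(gate a \<mu> u, gate a \<mu> v) \<in> cQ (Cm a \<mu>) j" "(gate a \<mu> v, gate a \<mu> u) \<in> cQ (Cm a \<mu>) j"
      using uv vu that by (auto simp: QU_def)
    then show ?thesis using goodD(8)[OF valid_good[OF that(1)] j] by (meson transD)
  qed
  let ?\<pi> = "node u"
  note nu = node_local[OF up(1)]
  show ?thesis
  proof (cases "gate a ?\<pi> u = gate a ?\<pi> v")
    case False
    obtain c x where c: "c \<in> cB (Cm a ?\<pi>)" "x \<in> A" "u = chU a (?\<pi>, c) x" using nu(2) cov_nodeC by blast
    have g: "gate a ?\<pi> u = io (XX a ?\<pi>) (Cm a ?\<pi>) c x"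
      using gate_chart[OF nu(1), of ?\<pi> c x] unfolding c(3)[symmetric] by (simp only: if_True simp_thms)
    have "(x, x) \<in> r j"
      using loop[OF nu(1) False] io_refl[OF valid_good[OF nu(1)] c(1) c(2) c(2) j] g by simp
    moreover have "(?\<pi>, c) \<in> CU a" using c nu by (auto simp: CU_def)
    ultimately show ?thesis using chart_loop_iff c jI by metis
  next
    case eq: True
    have notin: "v \<notin> cov (chU a) (nodeC a ?\<pi>)" using gate_inj[OF nu(1) nu(2) _ eq] False by blast
    then have nv: "node v \<noteq> ?\<pi>" using node_local[OF up(2)] by metis
    have lu: "gate a ?\<pi> u = lcl u" by (simp add: gate_def gt_same)
    have gv: "gate a ?\<pi> v = gn a ?\<pi> (node v)" using gate_ne node_local[OF up(2)] nv by metis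
    \<comment> \<open>If \<open>v\<close> were below the node of \<open>u\<close>, then
      \<open>u\<close> would be the private point at which a child is attached; but such a point is
      represented by the root of that child.\<close>
    have noext: "node v \<noteq> \<xi> @ s # ?\<pi>" for \<xi> s
    proof
      assume ext: "node v = \<xi> @ s # ?\<pi>"
      then have "lcl u = Inr s" using eq lu gv gt_suffix by (simp add: gn_def)
      then obtain c x where s: "s = (c, x)" and u: "u = Inr ((?\<pi>, c), x)"
        by (cases u) (auto simp: lcl_def node_def)
      have vs: "valid a (s # ?\<pi>)" using node_local(1)[OF up(2)] ext valid_append by metis
      obtain c' x' where "u = chU a (?\<pi>, c') x'" using nu(2) cov_nodeC by blast
      then have "chU a (?\<pi>, c') x' = Inr ((?\<pi>, c), x)" using u by metis
      then show False using vs s by (auto simp: chU_def Let_def split: if_splits)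
    qed
    have nosuf: "node v \<noteq> \<xi> @ ?\<pi>" for \<xi>
    proof
      assume e: "node v = \<xi> @ ?\<pi>"
      show False
      proof (cases \<xi> rule: rev_cases)
        case Nil then show ?thesis using e nv by simp
      next
        case (snoc ys s) then show ?thesis using e noext[of ys s] by simp
      qed
    qed
    then have "gate a ?\<pi> v = Inl (cr (Cm a ?\<pi>))" using gv gt_nosuffix by (simp add: gn_def)
    then have u: "u = Inl (?\<pi>, cr (Cm a ?\<pi>))" using eq lu by (cases u) (auto simp: lcl_def node_def)
    obtain s \<mu> where p: "?\<pi> = s # \<mu>" using nosuf[of "node v"] by (cases ?\<pi>) auto
    have vm: "valid a \<mu>" "fst s \<in> cB (Cm a \<mu>)" and vs: "valid a (s # \<mu>)" using nu(1) p by auto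
    have gu: "gate a \<mu> u = Inr s" using gt_suffix[of a \<mu> "[]" s] p by (simp add: gate_def)
    have ios: "Inr s = io (XX a \<mu>) (Cm a \<mu>) (fst s) (snd s)" using vs by (auto simp: io_def)
    have "gate a \<mu> v \<noteq> Inr s"
    proof
      assume g: "gate a \<mu> v = Inr s"
      have us: "u = chU a (\<mu>, fst s) (snd s)" using u p vs by (auto simp: chU_def)
      show False
      proof (cases "v \<in> cov (chU a) (nodeC a \<mu>)")
        case True
        have "snd s \<in> A" using vs XA by auto
        then have "u \<in> cov (chU a) (nodeC a \<mu>)" using us vm cov_nodeC by blast
        then show False using gate_inj[OF vm(1) _ True] g gu False by simp
      next
        case F: False
        have "node v \<noteq> \<mu>" using F node_local(2)[OF up(2)] by metis
        then have gg: "gt a \<mu> (node v) (Inl (cr (Cm a \<mu>))) = Inr s" using g gate_ne node_local[OF up(2)]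
          by (metis gn_def)
        then obtain \<xi> where x: "node v = \<xi> @ \<mu>" using gt_nosuffix[of "node v" \<mu>] by fastforce
        show False
        proof (cases \<xi> rule: rev_cases)
          case Nil then show ?thesis using x \<open>node v \<noteq> \<mu>\<close> by simp
        next
          case (snoc ys s')
          then have "node v = ys @ s' # \<mu>" using x by simp
          then have "s' = s" using gg gt_suffix by simp
          then show ?thesis using \<open>node v = ys @ s' # \<mu>\<close> nosuf[of ys] p by simp
        qed
      qed
    qed
    then have "(Inr s, Inr s) \<in> cQ (Cm a \<mu>) j" using loop[OF vm(1)] gu by metis
    then have "(snd s, snd s) \<in> r j"
      using io_refl[OF valid_good[OF vm(1)] vm(2) _ _ j] ios vs XA by auto
    then have "(fst (sta a (s # \<mu>)), fst (sta a (s # \<mu>))) \<in> r j"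
      using eqv_loop[OF eqv_sym[OF valid_eqv[OF vs]] jI] by blast
    then show ?thesis using u p goodD(3)[OF valid_good[OF vs]] by (simp add: val_def)
  qed
qed

text \<open>Gates compose inside each component, and the clause for equal end points is
  \<open>QU_loop\<close>.\<close>

lemma QU_trans: assumes "j \<in> J" shows "trans (QU a j)"
proof (rule transI)
  fix u v w assume uv: "(u, v) \<in> QU a j" and vw: "(v, w) \<in> QU a j"
  have "gate a \<mu> u = gate a \<mu> w \<or> (gate a \<mu> u, gate a \<mu> w) \<in> cQ (Cm a \<mu>) j" if "valid a \<mu>" for \<mu>
    using uv vw that transD[OF goodD(8)[OF valid_good[OF that] assms]] unfolding QU_def
    by (smt (verit, ccfv_threshold) case_prodD mem_Collect_eq)
  moreover have "u = w \<longrightarrow> (val a u, val a u) \<in> r j" using QU_loop uv vw assms by blast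
  ultimately show "(u, w) \<in> QU a j" using uv vw by (auto simp: QU_def)
qed

lemma QU_nodeI:
  assumes v: "valid a \<pi>" and u: "c \<in> cB (Cm a \<pi>)" "x \<in> A" and w: "d \<in> cB (Cm a \<pi>)" "y \<in> A"
    and e: "(io (XX a \<pi>) (Cm a \<pi>) c x, io (XX a \<pi>) (Cm a \<pi>) d y) \<in> cQ (Cm a \<pi>) j" and j: "j \<in> J"
  shows "(chU a (\<pi>, c) x, chU a (\<pi>, d) y) \<in> QU a j"
proof -
  have C: "(\<pi>, c) \<in> CU a" "(\<pi>, d) \<in> CU a" using v u w by (auto simp: CU_def)
  have "(x, x) \<in> r j" if "chU a (\<pi>, c) x = chU a (\<pi>, d) y"
  proof -
    have "io (XX a \<pi>) (Cm a \<pi>) c x = io (XX a \<pi>) (Cm a \<pi>) d y"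
      using arg_cong[OF that, of "gate a \<pi>"] unfolding gate_chart[OF v] by simp
    then show ?thesis using io_refl[OF valid_good[OF v] u(1) u(2) u(2) j] e by simp
  qed
  then have "chU a (\<pi>, c) x = chU a (\<pi>, d) y \<longrightarrow> (val a (chU a (\<pi>, c) x), val a (chU a (\<pi>, c) x)) \<in> r j"
    using chart_loop_iff[OF C(1) u(2)] j JI by blast
  moreover have "chU a (\<pi>, c) x \<in> pts a" "chU a (\<pi>, d) y \<in> pts a" using C u w by (auto simp: pts_def cov_def)
  ultimately show ?thesis using e unfolding QU_def by (simp add: gate_chart[OF v])
qed

lemma QU_chart:
  assumes "j \<in> J" "p \<in> CU a" "(x, y) \<in> r j" shows "(chU a p x, chU a p y) \<in> QU a j"
proof -
  obtain \<pi> c where p: "p = (\<pi>, c)" "valid a \<pi>" "c \<in> cB (Cm a \<pi>)" using assms(2) by (auto simp: CU_def)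
  have "x \<in> A" "y \<in> A" using assms rA JI by blast+
  then show ?thesis
    using QU_nodeI[OF p(2,3) _ p(3)] goodD(10)[OF valid_good[OF p(2)] assms(1) p(3) assms(3)] assms(1) p(1) by blast
qed

text \<open>Distinct points of a node have distinct gates there, so the edge must show. For equal
  points the loop is recovered from the value, since loops depend on the type only.\<close>

lemma QU_same:
  assumes "j \<in> J" "valid a \<pi>" "u \<in> cov (chU a) (nodeC a \<pi>)" "v \<in> cov (chU a) (nodeC a \<pi>)" "(u, v) \<in> QU a j"
  shows "(gate a \<pi> u, gate a \<pi> v) \<in> cQ (Cm a \<pi>) j"
proof (cases "u = v")
  case False
  then show ?thesis using assms gate_inj[OF assms(2-4)] by (auto simp: QU_def)
next
  case True
  obtain c x where c: "c \<in> cB (Cm a \<pi>)" "x \<in> A" "u = chU a (\<pi>, c) x" using assms(3) cov_nodeC by blast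
  have "(val a u, val a u) \<in> r j" using assms(5) True by (auto simp: QU_def)
  then have "(x, x) \<in> r j" using chart_loop_iff[of \<pi> c a x j] c assms JI by (auto simp: CU_def)
  then have "(io (XX a \<pi>) (Cm a \<pi>) c x, io (XX a \<pi>) (Cm a \<pi>) c x) \<in> cQ (Cm a \<pi>) j"
    using goodD(10)[OF valid_good[OF assms(2)] assms(1) c(1)] by blast
  then show ?thesis unfolding True[symmetric] c(3) gate_chart[OF assms(2)] by simp
qed

lemma QU_iv:
  assumes "j \<in> J" shows "QU a (iv j) = (QU a j)\<inverse>"
proof -
  have "cQ (Cm a \<mu>) (iv j) = (cQ (Cm a \<mu>) j)\<inverse>" if "valid a \<mu>" for \<mu>
    using goodD(9)[OF valid_good[OF that] assms] .
  then have "(u, v) \<in> QU a (iv j) \<longleftrightarrow> (v, u) \<in> QU a j" for u v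
    unfolding QU_def r_iv[OF assms] by (auto simp: eq_commute)
  then show ?thesis by auto
qed

end

context component_tree
begin

lemma center_chart:
  assumes "(\<pi>, c) \<in> CU a"
  shows "chU a (\<pi>, c) (cp (Cm a \<pi>) c) = Inl (\<pi>, c)" "cp (Cm a \<pi>) c \<in> X" "Inl (\<pi>, c) \<in> pts a"
    "gate a \<mu> (Inl (\<pi>, c)) = (if \<mu> = \<pi> then Inl c else gn a \<mu> \<pi>)"
proof -
  have v: "valid a \<pi>" "c \<in> cB (Cm a \<pi>)" using assms by (auto simp: CU_def)
  note g = valid_good[OF v(1)]
  have io: "io (XX a \<pi>) (Cm a \<pi>) c (cp (Cm a \<pi>) c) = Inl c" by (rule io_center[OF g XX_A[OF v(1)] v(2)])
  show ch: "chU a (\<pi>, c) (cp (Cm a \<pi>) c) = Inl (\<pi>, c)"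
    using io XX_X[OF v(1)] by (auto simp: io_def chU_def split: if_splits)
  show X: "cp (Cm a \<pi>) c \<in> X" using goodD(4)[OF g v(2)] XX_X[OF v(1)] by blast
  have "chU a (\<pi>, c) (cp (Cm a \<pi>) c) \<in> pts a" using X assms XA unfolding pts_def cov_def by blast
  then show "Inl (\<pi>, c) \<in> pts a" unfolding ch .
  show "gate a \<mu> (Inl (\<pi>, c)) = (if \<mu> = \<pi> then Inl c else gn a \<mu> \<pi>)"
    using gate_chart[OF v(1), of \<mu> c "cp (Cm a \<pi>) c"] unfolding ch io .
qed

text \<open>From every node a center looks like a center or like a chart point over
  \<open>X\<close>. Totality of \<open>j\<close> on \<open>X\<close> links the latter to its center
  in both directions, and the clause on \<open>tot\<close> in \<open>good\<close> links all
  centers.\<close>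

lemma QU_tot:
  assumes j: "j \<in> J" "tot X j" and u: "u \<in> CU a" and v: "v \<in> CU a"
  shows "(Inl u, Inl v) \<in> QU a j"
proof -
  have gate: "gate a \<mu> w \<in> Inl ` cB (Cm a \<mu>) \<or> (\<exists>c x. gate a \<mu> w = io (XX a \<mu>) (Cm a \<mu>) c x \<and> c \<in> cB (Cm a \<mu>) \<and> x \<in> X)"
    if w: "w \<in> Inl ` CU a" and m: "valid a \<mu>" for w \<mu>
  proof -
    obtain \<pi> c where wc: "w = Inl (\<pi>, c)" "(\<pi>, c) \<in> CU a" using w by auto
    have vp: "valid a \<pi>" "c \<in> cB (Cm a \<pi>)" using wc by (auto simp: CU_def)
    show ?thesis
    proof (cases "\<mu> = \<pi>")
      case True
      have "gate a \<mu> w = Inl c" using center_chart(4)[OF wc(2), of \<mu>] unfolding wc(1) by (rule trans) (simp add: True)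
      then show ?thesis using vp True by blast
    next
      case False
      then have g: "gate a \<mu> w = gn a \<mu> \<pi>" using center_chart(4)[OF wc(2), of \<mu>] unfolding wc(1) by (simp only: if_False)
      show ?thesis
      proof (cases "\<exists>\<xi>. \<pi> = \<xi> @ \<mu>")
        case True
        then obtain \<xi> where x: "\<pi> = \<xi> @ \<mu>" by blast
        then obtain ys s where "\<xi> = ys @ [s]" using False by (cases \<xi> rule: rev_cases) auto
        then have x: "\<pi> = ys @ s # \<mu>" using x by simp
        then have vs: "valid a (s # \<mu>)" using vp valid_append by blast
        have "gate a \<mu> w = Inr s" using g x gt_suffix by (simp add: gn_def)
        moreover have "Inr s = io (XX a \<mu>) (Cm a \<mu>) (fst s) (snd s)" using vs by (auto simp: io_def)
        moreover have "fst s \<in> cB (Cm a \<mu>)" "snd s \<in> X" using vs by auto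
        ultimately show ?thesis by (intro disjI2 exI[of _ "fst s"] exI[of _ "snd s"]) simp
      next
        case False
        then have "gate a \<mu> w = Inl (cr (Cm a \<mu>))" using g gt_nosuffix by (simp add: gn_def)
        then show ?thesis using goodD(2)[OF valid_good[OF m]] by blast
      qed
    qed
  qed
  have all: "(gate a \<mu> (Inl u), gate a \<mu> (Inl v)) \<in> cQ (Cm a \<mu>) j" if m: "valid a \<mu>" for \<mu>
  proof -
    note g = valid_good[OF m]
    note tr = transD[OF goodD(8)[OF g j(1)]]
    have tX: "tot (XX a \<mu>) j" using j(2) XX_X[OF m] unfolding tot_def by blast
    have cc: "(Inl c, Inl d) \<in> cQ (Cm a \<mu>) j" if "c \<in> cB (Cm a \<mu>)" "d \<in> cB (Cm a \<mu>)" for c d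
      using goodD(11)[OF g j(1) tX] that by blast
    have cx: "(Inl c, io (XX a \<mu>) (Cm a \<mu>) c x) \<in> cQ (Cm a \<mu>) j \<and> (io (XX a \<mu>) (Cm a \<mu>) c x, Inl c) \<in> cQ (Cm a \<mu>) j"
      if c: "c \<in> cB (Cm a \<mu>)" and x: "x \<in> X" for c x
    proof -
      have "cp (Cm a \<mu>) c \<in> X" using goodD(4)[OF g c] XX_X[OF m] by blast
      then have "(cp (Cm a \<mu>) c, x) \<in> r j" "(x, cp (Cm a \<mu>) c) \<in> r j" using j(2) x unfolding tot_def by blast+
      then show ?thesis using goodD(10)[OF g j(1) c] unfolding io_center[OF g XX_A[OF m] c, symmetric] by blast
    qed
    have "\<exists>c\<in>cB (Cm a \<mu>). (gate a \<mu> w, Inl c) \<in> cQ (Cm a \<mu>) j \<and> (Inl c, gate a \<mu> w) \<in> cQ (Cm a \<mu>) j"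
      if "w \<in> Inl ` CU a" for w
      using gate[OF that m]
    proof
      assume "gate a \<mu> w \<in> Inl ` cB (Cm a \<mu>)"
      then obtain c where "c \<in> cB (Cm a \<mu>)" "gate a \<mu> w = Inl c" by blast
      then show ?thesis using cc[of c c] by (intro bexI[of _ c]) simp_all
    next
      assume "\<exists>c x. gate a \<mu> w = io (XX a \<mu>) (Cm a \<mu>) c x \<and> c \<in> cB (Cm a \<mu>) \<and> x \<in> X"
      then obtain c x where "gate a \<mu> w = io (XX a \<mu>) (Cm a \<mu>) c x" "c \<in> cB (Cm a \<mu>)" "x \<in> X" by blast
      then show ?thesis using cx[of c x] by (intro bexI[of _ c]) simp_all
    qed
    then obtain c d where "c \<in> cB (Cm a \<mu>)" "(gate a \<mu> (Inl u), Inl c) \<in> cQ (Cm a \<mu>) j"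
      "d \<in> cB (Cm a \<mu>)" "(Inl d, gate a \<mu> (Inl v)) \<in> cQ (Cm a \<mu>) j" using u v by blast
    then show ?thesis using tr[OF tr[OF _ cc]] by blast
  qed
  obtain \<pi> c where uc: "u = (\<pi>, c)" by fastforce
  have "val a (Inl u) \<in> X" using center_chart(2)[of \<pi> c a] u uc by (simp add: val_def)
  then have "(val a (Inl u), val a (Inl u)) \<in> r j" using j(2) unfolding tot_def by blast
  moreover have "Inl u \<in> pts a" "Inl v \<in> pts a" using center_chart(3) u v by (metis surj_pair)+
  ultimately show ?thesis using all unfolding QU_def by blast
qed

section \<open>Local maps on the tree\<close>

abbreviation cvn where "cvn a \<pi> \<equiv> cov (chU a) (nodeC a \<pi>)"

lemma cov_nodeI: "c \<in> cB (Cm a \<pi>) \<Longrightarrow> x \<in> A \<Longrightarrow> chU a (\<pi>, c) x \<in> cvn a \<pi>"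
  using cov_nodeC by blast

text \<open>Seen from one node, all points of another have the same gate, while the points of the
  node itself are told apart by their gates.\<close>

lemma nodes_meet:
  assumes "valid a \<pi>" "valid a \<mu>" "\<pi> \<noteq> \<mu>" "u \<in> cvn a \<pi> \<inter> cvn a \<mu>" "v \<in> cvn a \<pi> \<inter> cvn a \<mu>"
  shows "u = v"
proof -
  have "gate a \<pi> u = gn a \<pi> \<mu>" "gate a \<pi> v = gn a \<pi> \<mu>"
    using gate_ne[OF assms(2)] assms(3-5) by blast+
  then show ?thesis using gate_inj[OF assms(1)] assms(4,5) by simp
qed

text \<open>The gate at \<open>\<pi>\<close> identifies the points of the node with those of its
  component, so the local maps of the component can be pulled back.\<close>

lemma locally_maps_node:
  assumes v: "valid a \<pi>"
  shows "locally_maps (CU a) (chU a) (QU a) (nodeC a \<pi>)"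
  unfolding locally_maps_def
proof (intro ballI allI impI)
  fix b S assume b: "b \<in> nodeC a \<pi>" and S: "S \<subseteq> cvn a \<pi>" "finite S" "card S \<le> K"
  obtain b0 where b0: "b = (\<pi>, b0)" "b0 \<in> cB (Cm a \<pi>)" using b by (auto simp: nodeC_def)
  note g = valid_good[OF v]
  let ?io = "io (XX a \<pi>) (Cm a \<pi>)"
  have "gate a \<pi> ` S \<subseteq> cov ?io (cB (Cm a \<pi>))"
  proof
    fix s assume "s \<in> gate a \<pi> ` S"
    then obtain u where u: "u \<in> S" "s = gate a \<pi> u" by auto
    then obtain c x where "c \<in> cB (Cm a \<pi>)" "x \<in> A" "u = chU a (\<pi>, c) x" using S(1) cov_nodeC by blast
    then show "s \<in> cov ?io (cB (Cm a \<pi>))" using u gate_chart[OF v, of \<pi> c x] unfolding cov_def by auto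
  qed
  moreover have "card (gate a \<pi> ` S) \<le> K" using card_image_le[OF S(2), of "gate a \<pi>"] S(3) by linarith
  ultimately obtain h where h: "\<And>x. x \<in> A \<Longrightarrow> h (?io b0 x) = x"
      "partial_hom (cB (Cm a \<pi>)) ?io (cQ (Cm a \<pi>)) (gate a \<pi> ` S \<union> ?io b0 ` A) h"
    using locally_mapsD[OF goodD(12)[OF g] b0(2)] S(2) by blast
  note hD = partial_homD[OF h(2)]
  let ?D = "S \<union> chU a b ` A"
  have bD: "chU a b ` A \<subseteq> cvn a \<pi>" using b0 by (auto intro: cov_nodeI)
  have gb: "gate a \<pi> (chU a b x) = ?io b0 x" for x unfolding b0(1) gate_chart[OF v] by simp
  have gD: "gate a \<pi> u \<in> gate a \<pi> ` S \<union> ?io b0 ` A" if "u \<in> ?D" for u using that gb by auto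
  have Dc: "u \<in> cvn a \<pi>" if "u \<in> ?D" for u using that S(1) bD by auto
  have "partial_hom (CU a) (chU a) (QU a) ?D (h \<circ> gate a \<pi>)"
  proof (rule partial_homI)
    fix u assume "u \<in> ?D" then show "(h \<circ> gate a \<pi>) u \<in> A" using hD(1) gD by simp
  next
    fix i c x y assume i: "i \<in> I" and c: "c \<in> CU a" and xy: "(x, y) \<in> r i"
      and D: "chU a c x \<in> ?D" "chU a c y \<in> ?D"
    have A: "x \<in> A" "y \<in> A" using rA[OF i] xy by auto
    obtain \<mu> c0 where c0: "c = (\<mu>, c0)" "valid a \<mu>" "c0 \<in> cB (Cm a \<mu>)" using c by (auto simp: CU_def)
    obtain c1 x1 y1 where e: "c1 \<in> cB (Cm a \<pi>)" "(x1, y1) \<in> r i" "chU a c x = chU a (\<pi>, c1) x1" "chU a c y = chU a (\<pi>, c1) y1"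
    proof (cases "\<mu> = \<pi>")
      case True then show ?thesis using that[of c0 x y] c0 xy by simp
    next
      \<comment> \<open>A chart of another node meets this node in at most one point, so the edge is
        a loop, and a loop can be moved to a chart of this node by
        \<open>chart_loop_iff\<close>.\<close>
      case False
      have "chU a c x \<in> cvn a \<mu>" "chU a c y \<in> cvn a \<mu>" unfolding c0(1) using c0(3) A by (auto intro: cov_nodeI)
      then have eq: "chU a c x = chU a c y" using nodes_meet[OF v c0(2)] False Dc D by blast
      then have "x = y" using chU_inj c c0 A by blast
      obtain c1 x1 where c1: "c1 \<in> cB (Cm a \<pi>)" "x1 \<in> A" "chU a c x = chU a (\<pi>, c1) x1"
        using Dc[OF D(1)] cov_nodeC by blast
      have "(val a (chU a c x), val a (chU a c x)) \<in> r i"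
        using chart_loop_iff[of \<mu> c0 a x i] c c0 A i xy \<open>x = y\<close> by blast
      then have "(x1, x1) \<in> r i" using chart_loop_iff[of \<pi> c1 a x1 i] c1 v i by (auto simp: CU_def)
      then show ?thesis using that[of c1 x1 x1] c1 eq by simp
    qed
    have "gate a \<pi> (chU a c x) = ?io c1 x1" "gate a \<pi> (chU a c y) = ?io c1 y1"
      unfolding e(3,4) gate_chart[OF v] by simp_all
    then show "((h \<circ> gate a \<pi>) (chU a c x), (h \<circ> gate a \<pi>) (chU a c y)) \<in> r i"
      using hD(2)[OF i e(1,2)] gD[OF D(1)] gD[OF D(2)] by simp
  next
    fix j u w assume j: "j \<in> J" and D: "u \<in> ?D" "w \<in> ?D" and uw: "(u, w) \<in> QU a j"
    have "(gate a \<pi> u, gate a \<pi> w) \<in> cQ (Cm a \<pi>) j" using QU_same[OF j v] Dc D uw by blast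
    then show "((h \<circ> gate a \<pi>) u, (h \<circ> gate a \<pi>) w) \<in> r j" using hD(3)[OF j] gD D by simp
  qed
  moreover have "\<forall>x\<in>A. (h \<circ> gate a \<pi>) (chU a b x) = x" using h(1) gb by simp
  ultimately show "\<exists>h. (\<forall>x\<in>A. h (chU a b x) = x) \<and> partial_hom (CU a) (chU a) (QU a) ?D h" by blast
qed

lemma gate_child_root:
  assumes v: "valid a (s # \<mu>)"
  shows "chU a (\<mu>, fst s) (snd s) = Inl (s # \<mu>, cr (Cm a (s # \<mu>)))"
  using v by (auto simp: chU_def Let_def)

lemma not_ext:
  assumes "valid a \<pi>" "u \<in> cvn a \<pi>" "\<And>\<xi>. \<pi> \<noteq> \<xi> @ \<nu>" shows "gate a \<nu> u = Inl (cr (Cm a \<nu>))"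
proof -
  have "\<nu> \<noteq> \<pi>" using assms(3)[of "[]"] by auto
  then show ?thesis using gate_ne[OF assms(1,2)] gt_nosuffix[OF assms(3)] by (simp add: gn_def)
qed

lemma QU_I:
  assumes "u \<noteq> v" "u \<in> pts a" "v \<in> pts a"
    "\<And>\<mu>. valid a \<mu> \<Longrightarrow> gate a \<mu> u = gate a \<mu> v \<or> (gate a \<mu> u, gate a \<mu> v) \<in> cQ (Cm a \<mu>) j"
  shows "(u, v) \<in> QU a j"
  using assms unfolding QU_def by simp

lemma QU_D:
  assumes "(u, v) \<in> QU a j" "valid a \<mu>"
  shows "gate a \<mu> u = gate a \<mu> v \<or> (gate a \<mu> u, gate a \<mu> v) \<in> cQ (Cm a \<mu>) j"
  using assms unfolding QU_def by blast

text \<open>No node of \<open>V\<close> lies below the new one, so the two sides meet only in its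
  root \<open>z\<close>, which is also the point at \<open>snd s\<close> in a chart of the parent.
  This is the situation of \<open>amalgam\<close>.\<close>

lemma locally_maps_attach:
  assumes l: "locally_maps (CU a) (chU a) (QU a) (\<Union>\<pi>\<in>V. nodeC a \<pi>)" and V: "\<And>\<pi>. \<pi> \<in> V \<Longrightarrow> valid a \<pi>"
    and nu: "valid a (s # \<mu>)" and mu: "\<mu> \<in> V" and ext: "\<And>\<pi> \<xi>. \<pi> \<in> V \<Longrightarrow> \<pi> \<noteq> \<xi> @ s # \<mu>"
  shows "locally_maps (CU a) (chU a) (QU a) (nodeC a (s # \<mu>) \<union> (\<Union>\<pi>\<in>V. nodeC a \<pi>))"
proof -
  let ?\<nu> = "s # \<mu>"
  define z where "z = (Inl (?\<nu>, cr (Cm a ?\<nu>)) :: 'a pt)"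
  define C2 where "C2 = (\<Union>\<pi>\<in>V. nodeC a \<pi>)"
  have covC2: "u \<in> cov (chU a) C2 \<longleftrightarrow> (\<exists>\<pi>\<in>V. u \<in> cvn a \<pi>)" for u unfolding cov_def C2_def by auto
  have zc: "chU a (?\<nu>, cr (Cm a ?\<nu>)) (fst (sta a ?\<nu>)) = z" "fst (sta a ?\<nu>) \<in> A"
      "(?\<nu>, cr (Cm a ?\<nu>)) \<in> nodeC a ?\<nu>"
    using root_chart[OF nu] unfolding z_def by auto
  have zn: "z \<in> cvn a ?\<nu>" using zc(3) imageI[OF zc(2), of "chU a (?\<nu>, cr (Cm a ?\<nu>))"] unfolding zc(1) cov_def by blast
  have zm: "chU a (\<mu>, fst s) (snd s) = z" using gate_child_root[OF nu] unfolding z_def .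
  have sA: "snd s \<in> A" "fst s \<in> cB (Cm a \<mu>)" using nu XA by auto
  have zmu: "z \<in> cvn a \<mu>" using cov_nodeI[OF sA(2,1)] unfolding zm .
  have g2: "gate a ?\<nu> u = Inl (cr (Cm a ?\<nu>))" if uc: "u \<in> cov (chU a) C2" for u
  proof -
    obtain \<pi> where p: "\<pi> \<in> V" "u \<in> cvn a \<pi>" using uc unfolding covC2 by blast
    show ?thesis
    proof (rule not_ext[OF V[OF p(1)] p(2)])
      show "\<pi> \<noteq> \<xi> @ s # \<mu>" for \<xi> by (rule ext[OF p(1)])
    qed
  qed
  have z2: "z \<in> cov (chU a) C2" unfolding covC2 using mu zmu by (rule bexI[rotated])
  have g1: "gate a \<kappa> u = gate a \<kappa> z" if "u \<in> cvn a ?\<nu>" "\<kappa> \<noteq> ?\<nu>" for u \<kappa>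
    by (rule trans[OF gate_ne[OF nu that] gate_ne[OF nu zn that(2), symmetric]])
  have meet: "u = z" if "u \<in> cvn a ?\<nu>" "u \<in> cov (chU a) C2" for u
    by (rule gate_inj[OF nu that(1) zn trans[OF g2[OF that(2)] g2[OF z2, symmetric]]])
  have pt: "u \<in> pts a" if "u \<in> cvn a ?\<nu> \<or> u \<in> cov (chU a) C2" for u
    using that V nodeC_pts nu unfolding covC2 by blast
  \<comment> \<open>\<open>z\<close> lies between the two sides: at every node its gate is that of
    \<open>u\<close> or that of \<open>v\<close>. Hence an edge between \<open>u\<close> and
    \<open>v\<close> splits at \<open>z\<close>.\<close>
  have gz: "gate a \<kappa> z = gate a \<kappa> v \<or> gate a \<kappa> z = gate a \<kappa> u"
    if "u \<in> cvn a ?\<nu>" "v \<in> cov (chU a) C2" for u v \<kappa>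
  proof (cases "\<kappa> = ?\<nu>")
    case True
    show ?thesis unfolding True g2[OF that(2)] g2[OF z2] by simp
  next
    case False
    show ?thesis using g1[OF that(1) False] by (simp only: simp_thms)
  qed
  have sub1: "nodeC a ?\<nu> \<subseteq> CU a" by (rule CU_nodeC[OF nu])
  have sub2: "C2 \<subseteq> CU a" using CU_nodeC V unfolding C2_def by blast
  have sepI: "chU a c ` A \<inter> (cvn a ?\<nu> - {z}) = {} \<or> chU a c ` A \<inter> (cov (chU a) C2 - {z}) = {}"
    if c: "c \<in> CU a" for c
  proof -
    obtain \<pi> c0 where c0: "c = (\<pi>, c0)" "valid a \<pi>" "c0 \<in> cB (Cm a \<pi>)" using c by (auto simp: CU_def)
    have ch: "u \<in> cvn a \<pi>" if "u \<in> chU a c ` A" for u using that c0(3) unfolding c0(1) by (auto intro: cov_nodeI)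
    show ?thesis
    proof (cases "\<exists>\<xi>. \<pi> = \<xi> @ ?\<nu>")
      case False
      then have gi: "gate a ?\<nu> u = Inl (cr (Cm a ?\<nu>))" if "u \<in> chU a c ` A" for u
        using not_ext[OF c0(2) ch[OF that]] by blast
      have "u = z" if "u \<in> chU a c ` A" "u \<in> cvn a ?\<nu>" for u
        by (rule gate_inj[OF nu that(2) zn trans[OF gi[OF that(1)] g2[OF z2, symmetric]]])
      then show ?thesis by blast
    next
      case True
      then obtain \<xi> where x: "\<pi> = \<xi> @ ?\<nu>" by blast
      show ?thesis
      proof (cases \<xi> rule: rev_cases)
        case Nil
        then have "\<pi> = ?\<nu>" using x by simp
        then show ?thesis using meet ch by blast
      next
        case (snoc ys t)
        then have pi: "\<pi> = ys @ t # ?\<nu>" using x by simp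
        then have "length \<pi> \<noteq> length ?\<nu>" by simp
        then have ne: "?\<nu> \<noteq> \<pi>" by metis
        have "gate a ?\<nu> u = Inr t" if "u \<in> chU a c ` A" for u
          using gate_ne[OF c0(2) ch[OF that] ne] pi gt_suffix[of a ?\<nu> ys t] by (simp only: gn_def)
        then have "u \<notin> cov (chU a) C2" if "u \<in> chU a c ` A" for u
          using that g2[of u] by (metis Inl_Inr_False)
        then show ?thesis by blast
      qed
    qed
  qed
  have sepJ: "(u, z) \<in> QU a j \<and> (z, v) \<in> QU a j"
    if "u \<in> cvn a ?\<nu> - {z}" "v \<in> cov (chU a) C2 - {z}" "(u, v) \<in> QU a j" for j u v
  proof -
    have "z \<in> pts a" "u \<in> pts a" "v \<in> pts a" "u \<noteq> z" "v \<noteq> z" using that zn pt by blast+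
    moreover have "gate a \<kappa> z = gate a \<kappa> v \<or> gate a \<kappa> z = gate a \<kappa> u" for \<kappa>
      by (rule gz) (use that in blast)+
    ultimately show ?thesis using QU_D[OF that(3)] by (metis QU_I)
  qed
  have sepJ': "(v, z) \<in> QU a j \<and> (z, u) \<in> QU a j"
    if "u \<in> cvn a ?\<nu> - {z}" "v \<in> cov (chU a) C2 - {z}" "(v, u) \<in> QU a j" for j u v
  proof -
    have "z \<in> pts a" "u \<in> pts a" "v \<in> pts a" "u \<noteq> z" "v \<noteq> z" using that zn pt by blast+
    moreover have "gate a \<kappa> z = gate a \<kappa> v \<or> gate a \<kappa> z = gate a \<kappa> u" for \<kappa>
      by (rule gz) (use that in blast)+
    ultimately show ?thesis using QU_D[OF that(3)] by (metis QU_I)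
  qed
  have muC: "(\<mu>, fst s) \<in> C2" using mu sA unfolding C2_def nodeC_def by auto
  have m: "cvn a ?\<nu> \<inter> cov (chU a) C2 \<subseteq> {z}" using meet by blast
  \<comment> \<open>The chart of the parent has \<open>snd s\<close> at \<open>z\<close>, the new
    node has the value of its root there; these may differ, but \<open>valid_eqv\<close> says that
    their types agree.\<close>
  have "locally_maps (CU a) (chU a) (QU a) (nodeC a ?\<nu> \<union> C2)"
    by (rule amalgam[OF locally_maps_node[OF nu] l[folded C2_def] sub1 sub2 m zc(3,2,1) muC sA(1) zm
          valid_eqv[OF nu] QU_trans QU_chart sepJ sepJ' sepI])
  then show ?thesis unfolding C2_def .
qed

lemma locally_maps_finite:
  assumes "finite V" "[] \<in> V" "\<And>\<pi>. \<pi> \<in> V \<Longrightarrow> valid a \<pi>" "\<And>s \<pi>. s # \<pi> \<in> V \<Longrightarrow> \<pi> \<in> V"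
  shows "locally_maps (CU a) (chU a) (QU a) (\<Union>\<pi>\<in>V. nodeC a \<pi>)"
  using assms
proof (induction "card V" arbitrary: V rule: less_induct)
  case less
  \<comment> \<open>A longest path is a leaf, so removing it keeps the set closed under
    ancestors.\<close>
  obtain \<nu> where nu: "\<nu> \<in> V" "\<And>\<pi>. \<pi> \<in> V \<Longrightarrow> length \<pi> \<le> length \<nu>"
  proof -
    have "Max (length ` V) \<in> length ` V" using less.prems(1,2) by (intro Max_in) auto
    then obtain \<nu> where "\<nu> \<in> V" "length \<nu> = Max (length ` V)" by auto
    then show ?thesis using that less.prems(1) by auto
  qed
  show ?case
  proof (cases \<nu>)
    case Nil
    then have "V = {[]}" using nu less.prems(2) by auto
    then show ?thesis using locally_maps_node less.prems(3) by simp
  next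
    case (Cons s \<mu>)
    let ?V = "V - {\<nu>}"
    have "card ?V < card V" using less.prems(1) nu(1) by (rule card_Diff1_less)
    moreover have "[] \<in> ?V" using less.prems(2) Cons by simp
    moreover have "\<pi> \<in> ?V" if "s' # \<pi> \<in> ?V" for s' \<pi>
    proof -
      have "s' # \<pi> \<in> V" using that by blast
      then have "\<pi> \<in> V" "length (s' # \<pi>) \<le> length \<nu>" using less.prems(4) nu(2) by blast+
      then show ?thesis by auto
    qed
    ultimately have l: "locally_maps (CU a) (chU a) (QU a) (\<Union>\<pi>\<in>?V. nodeC a \<pi>)"
      using less.hyps[of ?V] less.prems(1,3) by blast
    have "\<mu> \<in> V" using less.prems(4) nu(1) unfolding Cons by blast
    then have "\<mu> \<in> ?V" using Cons by auto
    moreover have "\<pi> \<noteq> \<xi> @ s # \<mu>" if "\<pi> \<in> ?V" for \<pi> \<xi>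
      using that nu(2)[of \<pi>] Cons by auto
    moreover have "valid a (s # \<mu>)" using less.prems(3)[OF nu(1)] unfolding Cons .
    ultimately have "locally_maps (CU a) (chU a) (QU a) (nodeC a (s # \<mu>) \<union> (\<Union>\<pi>\<in>?V. nodeC a \<pi>))"
      using locally_maps_attach[OF l] less.prems(3) by blast
    moreover have "nodeC a (s # \<mu>) \<union> (\<Union>\<pi>\<in>?V. nodeC a \<pi>) = (\<Union>\<pi>\<in>V. nodeC a \<pi>)" using nu(1) Cons by auto
    ultimately show ?thesis by simp
  qed
qed

text \<open>Each instance concerns finitely many points, hence finitely many nodes; with their
  ancestors these form a finite tree.\<close>

lemma locally_maps_tree: "locally_maps (CU a) (chU a) (QU a) (CU a)"
  unfolding locally_maps_def
proof (intro ballI allI impI)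
  fix b S assume b: "b \<in> CU a" and S: "S \<subseteq> cov (chU a) (CU a)" "finite S" "card S \<le> K"
  define V where "V = (\<Union>p\<in>insert (fst b) (node ` S). (\<lambda>n. drop n p) ` {..length p})"
  have Sp: "S \<subseteq> pts a" using S(1) unfolding pts_def .
  have vb: "valid a (fst b)" "snd b \<in> cB (Cm a (fst b))" using b by (auto simp: CU_def)
  have val: "valid a \<pi>" if piV: "\<pi> \<in> V" for \<pi>
  proof -
    obtain p n where "\<pi> = drop n p" "valid a p" using piV vb Sp node_local(1) unfolding V_def by blast
    then show ?thesis using valid_append[of a "take n p" "drop n p"] by simp
  qed
  have suf: "\<pi> \<in> V" if V1: "s # \<pi> \<in> V" for s \<pi>
  proof -
    obtain p n where p: "p \<in> insert (fst b) (node ` S)" "s # \<pi> = drop n p" "n \<le> length p" using V1 unfolding V_def by blast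
    then have "\<pi> = drop (Suc n) p" by (metis drop_Suc list.sel(3) tl_drop)
    moreover have "Suc n \<le> length p" using p(2,3) by (metis drop_all list.distinct(1) not_less_eq_eq)
    ultimately show ?thesis using p(1) unfolding V_def by auto
  qed
  have self: "p \<in> V" if "p \<in> insert (fst b) (node ` S)" for p
    unfolding V_def using that by (intro UN_I[of p]) (auto intro!: image_eqI[of _ _ 0])
  have "[] \<in> V" unfolding V_def by (auto intro!: image_eqI[of _ _ "length (fst b)"])
  moreover have "finite V" unfolding V_def using S(2) by auto
  ultimately have l: "locally_maps (CU a) (chU a) (QU a) (\<Union>\<pi>\<in>V. nodeC a \<pi>)" using locally_maps_finite val suf by blast
  have "b \<in> (\<Union>\<pi>\<in>V. nodeC a \<pi>)" using vb self by (cases b) (auto simp: nodeC_def)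
  moreover have "S \<subseteq> cov (chU a) (\<Union>\<pi>\<in>V. nodeC a \<pi>)"
  proof
    fix u assume "u \<in> S"
    then have "u \<in> cvn a (node u)" "node u \<in> V" using Sp node_local(2) self by blast+
    then show "u \<in> cov (chU a) (\<Union>\<pi>\<in>V. nodeC a \<pi>)" unfolding cov_def by blast
  qed
  ultimately show "\<exists>h. (\<forall>x\<in>A. h (chU a b x) = x) \<and> partial_hom (CU a) (chU a) (QU a) (S \<union> chU a b ` A) h"
    using l S(2,3) unfolding locally_maps_def by meson
qed

text \<open>While a relation waits in the queue its position decreases whenever the head changes, and
  \<open>Dn\<close> of the head shrinks whenever the head is kept.\<close>

definition Dn :: "'i \<Rightarrow> 'a \<Rightarrow> 'a set set" where
  "Dn j a = cls ` {x \<in> X. (a, x) \<in> r j \<and> (x, a) \<notin> r j}"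
definition pot :: "'i \<Rightarrow> 'a \<times> 'i list \<Rightarrow> nat" where
  "pot j st = idx j (snd st) * (M + 1) + card (Dn (hd (snd st)) (fst st))"
definition P :: nat where "P = card NT * (M + 1)"
text \<open>\<open>P\<close> stands for a relation that is not in the queue. The extra
  \<open>P + 1\<close> before depth \<open>D\<close> pays for the single reset at \<open>D\<close>,
  which empties the queue. As every step along \<open>j\<close> lowers \<open>Psi\<close>, a run has
  at most \<open>2 * P + 1\<close> steps.\<close>

definition Psi :: "'i \<Rightarrow> 'a \<Rightarrow> 'a path \<Rightarrow> nat" where
  "Psi j a \<pi> = (if j \<in> set (snd (sta a \<pi>)) then pot j (sta a \<pi>) else P) + (if length \<pi> < D then P + 1 else 0)"

lemma Dn_M: "finite (Dn j a)" "card (Dn j a) \<le> M"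
proof -
  have s: "Dn j a \<subseteq> cls ` A" using XA unfolding Dn_def by auto
  then show "finite (Dn j a)" using finA finite_subset by blast
  show "card (Dn j a) \<le> M" unfolding M_def by (rule card_mono[OF _ s]) (use finA in simp)
qed

lemma pot_P: assumes "okst st" "j \<in> set (snd st)" shows "pot j st < P"
proof -
  have "length (snd st) \<le> card NT"
    using assms(1) distinct_card[of "snd st"] card_mono[OF finNT, of "set (snd st)"] by (simp add: okst_def)
  then have "Suc (idx j (snd st)) \<le> card NT" using idx_less[OF assms(2)] by simp
  then have "Suc (idx j (snd st)) * (M + 1) \<le> P" unfolding P_def by (rule mult_le_mono1)
  moreover have "card (Dn (hd (snd st)) (fst st)) < M + 1" using Dn_M(2) by (simp add: less_Suc_eq_le)
  ultimately show ?thesis unfolding pot_def by simp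
qed

text \<open>Over a singleton the component is \<open>triv\<close> and \<open>c\<close> is the root.
  Over a larger clique \<open>h\<close> is total, so the edge from the root gives one from the
  center \<open>c\<close>, and charts reflect it. As \<open>w\<close> is outside the clique, there
  is no way back.\<close>

lemma head_below:
  assumes ok: "okst (a, h # q)" and c: "c \<in> cB (CP (a, h # q))" and w: "w \<in> X - Xs (a, h # q)"
    and run: "run (a, h # q) (c, w) h"
  shows "(a, w) \<in> r h" "(w, a) \<notin> r h"
proof -
  let ?C = "CP (a, h # q)" and ?X = "Xs (a, h # q)"
  note g = CPg[OF ok]
  have h: "h \<in> J" using ok NTJ by (auto simp: okst_def)
  have aX: "a \<in> X" using ok by (simp add: okst_def)
  have XsA: "?X \<subseteq> A" using Xs_X[OF ok] XA by auto
  have ios: "Inr (c, w) = io ?X ?C c w" using w by (simp add: io_def)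
  note tr = transD[OF trans_r[OF h]]
  have "(a, w) \<in> r h"
  proof (cases "?X = {a}")
    case True
    then have "?C = triv a" using CPt[OF ok] by simp
    then have "c = cr ?C" "cp ?C c = a" using c by (auto simp: triv_sel)
    then have "Inl (cr ?C) = io ?X ?C c a" using io_center[OF g XsA c] by simp
    then show ?thesis using io_refl[OF g c _ _ h] run w XA aX ios unfolding run_def by auto
  next
    case False
    then obtain x where "(a, x) \<in> r h" "(x, a) \<in> r h" unfolding Xs_def cl_def by auto
    then have aa: "(a, a) \<in> r h" using tr by blast
    have "tot ?X h" unfolding tot_def
    proof clarify
      fix x y assume "x \<in> ?X" "y \<in> ?X"
      then have "(x, a) \<in> r h" "(a, y) \<in> r h" using aa unfolding Xs_def cl_def by auto
      then show "(x, y) \<in> r h" using tr by blast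
    qed
    then have tt: "(Inl c, Inl (cr ?C)) \<in> cQ ?C h" using goodD(11)[OF g h _ c goodD(2)[OF g]] by blast
    have "(Inl c, Inr (c, w)) \<in> cQ ?C h"
      using tt run transD[OF goodD(8)[OF g h]] unfolding run_def by blast
    then have "(io ?X ?C c (cp ?C c), io ?X ?C c w) \<in> cQ ?C h" unfolding io_center[OF g XsA c] ios[symmetric] .
    moreover have "cp ?C c \<in> A" "w \<in> A" using goodD(4)[OF g c] XsA w XA by blast+
    ultimately have "(cp ?C c, w) \<in> r h" using io_refl[OF g c _ _ h] by blast
    moreover have "(a, cp ?C c) \<in> r h" using goodD(4)[OF g c] aa unfolding Xs_def cl_def by auto
    ultimately show ?thesis using tr by blast
  qed
  moreover have "(w, a) \<notin> r h" using calculation w unfolding Xs_def cl_def by auto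
  ultimately show "(a, w) \<in> r h" "(w, a) \<notin> r h" by auto
qed

text \<open>The new root lies strictly below \<open>a\<close>, so its type is counted for
  \<open>a\<close>; by minimality this type does not reappear strictly below the new root.\<close>

lemma Dn_less:
  assumes ok: "okst (a, h # q)" and c: "c \<in> cB (CP (a, h # q))" and w: "w \<in> X - Xs (a, h # q)"
    and run: "run (a, h # q) (c, w) h"
  shows "card (Dn h (minim h w)) < card (Dn h a)"
proof (rule psubset_card_mono[OF Dn_M(1)])
  note aw = head_below[OF assms]
  have h: "h \<in> J" using ok NTJ by (auto simp: okst_def)
  have wX: "w \<in> X" using w by simp
  note m = minim[OF wX h]
  note tr = transD[OF trans_r[OF h]]
  let ?b = "minim h w"
  have ab: "(a, ?b) \<in> r h" "(?b, a) \<notin> r h" using m(3) aw tr by (metis, metis)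
  have "Dn h ?b \<subseteq> Dn h a" unfolding Dn_def using tr ab by blast
  moreover have "cls ?b \<in> Dn h a" unfolding Dn_def using m(1) ab by auto
  moreover have "cls ?b \<notin> Dn h ?b"
  proof
    assume "cls ?b \<in> Dn h ?b"
    then obtain x where x: "x \<in> X" "(?b, x) \<in> r h" "(x, ?b) \<notin> r h" "cls x = cls ?b" unfolding Dn_def by auto
    then have "eqv x ?b" using cls_eq XA by blast
    then show False using m(4) x by blast
  qed
  ultimately show "Dn h ?b \<subset> Dn h a" by blast
qed

text \<open>If \<open>j\<close> joins the queue, \<open>P\<close> is replaced by a smaller
  \<open>pot\<close>. If the head stays, no survivor moves back and \<open>Dn\<close> of the head
  shrinks. If the head leaves, \<open>j\<close> moves forward, and one position is worth
  \<open>M + 1\<close>, more than \<open>Dn\<close> can grow. At the reset the extra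
  \<open>P + 1\<close> is spent.\<close>

lemma Psi_less:
  assumes v: "valid a (s # \<mu>)" and run: "run (sta a \<mu>) s j" and j: "j \<in> NT"
  shows "Psi j a (s # \<mu>) < Psi j a \<mu>"
proof -
  have vm: "valid a \<mu>" using v by simp
  note ok = valid_ok[OF vm] and ok' = valid_ok[OF v]
  obtain b q where st: "sta a \<mu> = (b, q)" by fastforce
  show ?thesis
  proof (cases "Suc (length \<mu>) = D")
    case True
    then have "snd (sta a (s # \<mu>)) = []" by (simp add: nxt_def)
    then show ?thesis unfolding Psi_def using True by simp
  next
    case False
    let ?q = "upd (sta a \<mu>) s"
    have q': "snd (sta a (s # \<mu>)) = ?q" using False by (simp add: nxt_def)
    have jq: "j \<in> set ?q" unfolding upd_def using run j jl by auto
    have f: "fst (sta a (s # \<mu>)) = minim (hd ?q) (snd s)" using False jq by (auto simp: nxt_def)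
    have len: "(length (s # \<mu>) < D) = (length \<mu> < D)" using False by auto
    show ?thesis
    proof (cases "j \<in> set q")
      case False
      then show ?thesis unfolding Psi_def len using pot_P[OF ok'] jq q' st by simp
    next
      case True
      have "pot j (sta a (s # \<mu>)) < pot j (sta a \<mu>)"
      proof (cases "run (sta a \<mu>) s (hd q)")
        case rh: True
        obtain h q0 where q: "q = h # q0" using True by (cases q) auto
        have hd: "hd ?q = h" unfolding upd_def using st q rh by simp
        have i: "idx j ?q \<le> idx j q" unfolding upd_def using idx_filter[of j q] st True run by simp
        have "card (Dn h (minim h (snd s))) < card (Dn h b)"
          using Dn_less[of b h q0 "fst s" "snd s"] ok st q v rh by auto
        moreover have "idx j ?q * (M + 1) \<le> idx j q * (M + 1)" using i by (rule mult_le_mono1)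
        ultimately show ?thesis unfolding pot_def q' f hd using st q by simp
      next
        case False
        then have "idx j ?q < idx j q" unfolding upd_def using idx_filter_less[of j q] st True run by simp
        then have "Suc (idx j ?q) * (M + 1) \<le> idx j q * (M + 1)" by (intro mult_le_mono1) simp
        moreover have "card (Dn (hd ?q) (fst (sta a (s # \<mu>)))) < M + 1" using Dn_M(2) by (simp add: less_Suc_eq_le)
        ultimately show ?thesis unfolding pot_def q' using st by simp
      qed
      then show ?thesis unfolding Psi_def len using True jq q' st by simp
    qed
  qed
qed

lemma run_bound:
  assumes "valid a \<pi>" "j \<in> NT" "\<And>\<xi> s \<mu>. \<pi> = \<xi> @ s # \<mu> \<Longrightarrow> n \<le> length \<mu> \<Longrightarrow> run (sta a \<mu>) s j" "n \<le> length \<pi>"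
  shows "length \<pi> - n + Psi j a \<pi> \<le> 2 * P + 1"
  using assms
proof (induction \<pi>)
  have bd: "Psi j a \<pi> \<le> 2 * P + 1" if "valid a \<pi>" for \<pi>
    unfolding Psi_def using pot_P[OF valid_ok[OF that], of j] by auto
  {
    case Nil then show ?case using bd[of "[]"] by simp
  next
    case (Cons s \<mu>)
    show ?case
    proof (cases "n \<le> length \<mu>")
      case True
      have "run (sta a \<mu>) s j" using Cons.prems(3)[of "[]"] True by simp
      then have "Psi j a (s # \<mu>) < Psi j a \<mu>" using Psi_less Cons.prems by blast
      moreover have "length \<mu> - n + Psi j a \<mu> \<le> 2 * P + 1"
      proof (rule Cons.IH)
        show "run (sta a \<mu>') s' j" if "\<mu> = \<xi> @ s' # \<mu>'" "n \<le> length \<mu>'" for \<xi> s' \<mu>'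
          using Cons.prems(3)[of "s # \<xi>"] that by simp
      qed (use Cons.prems True in auto)
      ultimately show ?thesis using True by simp
    next
      case False
      then have "length (s # \<mu>) = n" using Cons.prems(4) by simp
      then show ?thesis using bd[OF Cons.prems(1)] by simp
    qed
  }
qed

text \<open>At the nodes towards \<open>v\<close> that are deeper than the node of \<open>u\<close>,
  the gate of \<open>u\<close> is the root and that of \<open>v\<close> is the next step, so
  \<open>j\<close> runs along the branch. Counting starts one level below the node of
  \<open>u\<close>, whence \<open>2 * P + 2\<close> instead of \<open>2 * P + 1\<close>.\<close>

lemma QU_depth_down:
  assumes "(u, v) \<in> QU a j" "j \<in> NT"
  shows "length (node v) \<le> length (node u) + 2 * P + 2"
proof (cases "length (node u) < length (node v)")
  case True
  have pt: "u \<in> pts a" "v \<in> pts a" using assms(1) by (auto simp: QU_def)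
  have vv: "valid a (node v)" using node_local(1)[OF pt(2)] .
  have "run (sta a \<mu>) s j" if n: "node v = \<xi> @ s # \<mu>" "Suc (length (node u)) \<le> length \<mu>" for \<xi> s \<mu>
  proof -
    have "valid a (s # \<mu>)" using n vv valid_append by metis
    then have vm: "valid a \<mu>" by simp
    have "gate a \<mu> v = Inr s" unfolding gate_def n(1) by (rule gt_suffix)
    moreover have "gate a \<mu> u = Inl (cr (Cm a \<mu>))" unfolding gate_def by (rule gt_short) (use n in simp)
    ultimately show ?thesis using assms(1) vm unfolding QU_def run_def by fastforce
  qed
  from run_bound[OF vv assms(2) this] True show ?thesis by fastforce
qed simp

lemma QU_depth_up:
  assumes "(u, v) \<in> QU a j" "j \<in> NT"
  shows "length (node u) \<le> length (node v) + 2 * P + 2"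
proof -
  have j: "j \<in> J" "\<not> tot X j" using assms(2) by (auto simp: NT_def)
  have "\<not> tot X (iv j)" using j r_iv[OF j(1)] unfolding tot_def by auto
  then have "iv j \<in> NT" using iv_J[OF j(1)] by (simp add: NT_def)
  moreover have "(v, u) \<in> QU a (iv j)" using assms(1) QU_iv[OF j(1)] by simp
  ultimately show ?thesis using QU_depth_down by blast
qed

end

section \<open>Folding the tree\<close>

text \<open>\<open>Dbig\<close> makes room in one block for more than \<open>K + 1\<close> disjoint
  depth windows of radius \<open>2 * P + 4\<close>.\<close>

locale folded_tree = component_tree A r I J iv W K X D CP
  for A :: "'a set" and r :: "'i \<Rightarrow> 'a rel" and I J :: "'i set" and iv :: "'i \<Rightarrow> 'i"
    and W :: "'a \<Rightarrow> 'a set" and K :: nat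
    and X :: "'a set" and D :: nat and CP :: "'a \<times> 'i list \<Rightarrow> ('a, 'i) comp" +
  fixes a0 :: 'a
  assumes a0: "a0 \<in> X" and Dbig: "(2 * (2 * P + 4) + 1) * (K + 3) \<le> D"
begin

lemma Dpos: "0 < D" using Dbig by (cases D) auto

text \<open>The value at which the block after \<open>\<pi>'\<close> starts. It is a representative
  of a type or the given start, so the possible values in \<open>R\<close> are few.\<close>

definition ra :: "'a \<Rightarrow> 'a path \<Rightarrow> 'a" where "ra a \<pi> = (if \<pi> = [] then a else rep (snd (hd \<pi>)))"
definition R :: "'a set" where "R = insert a0 (rep ` X)"
definition okn :: "'a \<Rightarrow> 'a path \<Rightarrow> 'a path \<Rightarrow> bool" where
  "okn a \<pi>' \<pi> \<longleftrightarrow> a \<in> R \<and> valid a \<pi>' \<and> (\<pi>' = [] \<or> length \<pi>' = D) \<and> valid (ra a \<pi>') \<pi> \<and> length \<pi> < D"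
text \<open>Only the last two blocks of length \<open>D\<close> of a path are remembered, and the start of the first of
  them only up to its type.\<close>

definition BB :: "'a el set" where
  "BB = {N a \<pi>' \<pi> c | a \<pi>' \<pi> c. okn a \<pi>' \<pi> \<and> c \<in> cB (Cm (ra a \<pi>') \<pi>)}"

fun pB :: "'a el \<Rightarrow> 'a" where
  "pB (N a \<pi>' \<pi> c) = cp (Cm (ra a \<pi>') \<pi>) c"
| "pB L = a0"
text \<open>When the current block is full it takes the place of the preceding one, of which only
  the start \<open>ra a \<pi>'\<close> of its successor is kept. This step closes the tree up to a
  finite structure.\<close>

fun gB :: "'a el \<Rightarrow> 'a \<Rightarrow> 'a el" where
  "gB (N a \<pi>' \<pi> c) w = (if w \<in> XX (ra a \<pi>') \<pi> then N a \<pi>' \<pi> (cg (Cm (ra a \<pi>') \<pi>) c w)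
     else if Suc (length \<pi>) < D then N a \<pi>' ((c, w) # \<pi>) (cr (Cm (ra a \<pi>') ((c, w) # \<pi>)))
     else N (ra a \<pi>') ((c, w) # \<pi>) [] (cr (Cm (rep w) [])))"
| "gB L w = L"

definition chB :: "'a el \<Rightarrow> 'a \<Rightarrow> 'a el + 'a el \<times> 'a" where
  "chB b x = (if x \<in> W (pB b) \<inter> X then Inl (gB b x) else Inr (b, x))"
definition gen :: "'i \<Rightarrow> ('a el + 'a el \<times> 'a) rel" where
  "gen j = {(chB (N a \<pi>' \<pi> c) x, chB (N a \<pi>' \<pi> d) y) | a \<pi>' \<pi> c d x y.
     N a \<pi>' \<pi> c \<in> BB \<and> N a \<pi>' \<pi> d \<in> BB \<and> x \<in> A \<and> y \<in> A \<and>
     (io (XX (ra a \<pi>') \<pi>) (Cm (ra a \<pi>') \<pi>) c x, io (XX (ra a \<pi>') \<pi>) (Cm (ra a \<pi>') \<pi>) d y)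
       \<in> cQ (Cm (ra a \<pi>') \<pi>) j}"
text \<open>\<open>up j u\<close> says that \<open>u\<close> reaches a center along
  \<open>j\<close>, being one or inside one chart; \<open>up (iv j) v\<close> says that
  \<open>v\<close> is reached from one. For total \<open>j\<close> one center is as good as
  all.\<close>

definition up :: "'i \<Rightarrow> 'a el + 'a el \<times> 'a \<Rightarrow> bool" where
  "up j u = (case u of Inl b \<Rightarrow> b \<in> BB | Inr (b, x) \<Rightarrow> b \<in> BB \<and> (x, pB b) \<in> r j)"
text \<open>Total relations are declared total, as their paths are not bounded in depth.\<close>

definition QB :: "'i \<Rightarrow> ('a el + 'a el \<times> 'a) rel" where
  "QB j = (if tot X j then {(u, v). up j u \<and> up (iv j) v} \<union> {(chB b x, chB b y) | b x y. b \<in> BB \<and> (x, y) \<in> r j}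
     else (gen j)\<^sup>+)"
definition CB :: "('a, 'i) comp" where
  "CB = \<lparr>cB = BB, cr = N a0 [] [] (cr (Cm a0 [])), cp = pB, cg = gB, cQ = QB\<rparr>"

lemma CB_sel: "cB CB = BB" "cr CB = N a0 [] [] (cr (Cm a0 []))" "cp CB = pB" "cg CB = gB" "cQ CB = QB"
  unfolding CB_def by simp_all

lemma io_CB: "io X CB = chB" unfolding io_def chB_def CB_sel by (intro ext) simp

lemma RX: "R \<subseteq> X" using a0 rep unfolding R_def by auto

lemma valid_lab: "valid a \<pi> \<Longrightarrow> a \<in> X" using valid_append[of a \<pi> "[]"] by simp

lemma ra_R: "okn a \<pi>' \<pi> \<Longrightarrow> ra a \<pi>' \<in> R"
proof (cases \<pi>')
  case (Cons s \<mu>)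
  assume "okn a \<pi>' \<pi>"
  then have "snd s \<in> X" using Cons by (auto simp: okn_def)
  then show ?thesis using Cons by (simp add: ra_def R_def)
qed (simp add: ra_def okn_def)

lemma BB_iff: "N a \<pi>' \<pi> c \<in> BB \<longleftrightarrow> okn a \<pi>' \<pi> \<and> c \<in> cB (Cm (ra a \<pi>') \<pi>)"
  unfolding BB_def by auto

lemma BB_E:
  assumes "b \<in> BB"
  obtains a \<pi>' \<pi> c where "b = N a \<pi>' \<pi> c" "okn a \<pi>' \<pi>" "c \<in> cB (Cm (ra a \<pi>') \<pi>)" "valid (ra a \<pi>') \<pi>"
    "good (XX (ra a \<pi>') \<pi>) (fst (sta (ra a \<pi>') \<pi>)) (Cm (ra a \<pi>') \<pi>)"
  using assms valid_good unfolding BB_def okn_def by blast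

lemma sta_full:
  assumes "length \<pi> = D" shows "sta a \<pi> = (rep (snd (hd \<pi>)), [])"
  using assms Dpos by (cases \<pi>) (auto simp: nxt_def)

text \<open>The reset at depth \<open>D\<close> forgets all but the representative, so the states
  after a full block are those of a fresh tree. As \<open>\<pi>\<close> is shorter than
  \<open>D\<close>, neither side resets again.\<close>

lemma sta_append:
  assumes "\<pi>' = [] \<or> length \<pi>' = D" "length \<pi> < D"
  shows "sta a (\<pi> @ \<pi>') = sta (ra a \<pi>') \<pi>"
  using assms(2)
proof (induction \<pi>)
  case Nil
  show ?case using assms(1) sta_full[of \<pi>' a] by (cases "\<pi>' = []") (auto simp: ra_def)
next
  case (Cons s \<pi>)
  have "nxt (length (\<pi> @ \<pi>')) st s = nxt (length \<pi>) st s" for st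
    using Cons.prems assms(1) by (auto simp: nxt_def)
  then show ?case using Cons by simp
qed

lemma valid_join:
  assumes "valid a \<pi>'" "\<pi>' = [] \<or> length \<pi>' = D" "valid (ra a \<pi>') \<pi>" "length \<pi> < D"
  shows "valid a (\<pi> @ \<pi>')"
  using assms(3,4)
proof (induction \<pi>)
  case Nil then show ?case using assms(1) by simp
next
  case (Cons s \<pi>)
  have "sta a (\<pi> @ \<pi>') = sta (ra a \<pi>') \<pi>" using sta_append[OF assms(2)] Cons.prems by simp
  then show ?case using Cons by simp
qed

lemma pB_X: "b \<in> BB \<Longrightarrow> pB b \<in> X"
  by (erule BB_E) (use goodD(4) XX_X in fastforce)

lemma gB_BB:
  assumes "b \<in> BB" "w \<in> W (pB b)" "w \<in> X"
  shows "gB b w \<in> BB \<and> eqv (pB (gB b w)) w"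
proof -
  obtain a \<pi>' \<pi> c where b: "b = N a \<pi>' \<pi> c" "okn a \<pi>' \<pi>" "c \<in> cB (Cm (ra a \<pi>') \<pi>)" "valid (ra a \<pi>') \<pi>"
    "good (XX (ra a \<pi>') \<pi>) (fst (sta (ra a \<pi>') \<pi>)) (Cm (ra a \<pi>') \<pi>)"
    using BB_E[OF assms(1)] .
  let ?l = "ra a \<pi>'"
  have w: "w \<in> W (cp (Cm ?l \<pi>) c)" using assms(2) b(1) by simp
  show ?thesis
  proof (cases "w \<in> XX ?l \<pi>")
    case True
    then show ?thesis using b w goodD(5,6)[OF b(5,3) w True] by (simp add: BB_iff)
  next
    case False
    have v: "valid ?l ((c, w) # \<pi>)" by (rule valid_child[OF b(4,3) w assms(3) False])
    show ?thesis
    proof (cases "Suc (length \<pi>) < D")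
      case True
      have g: "gB b w = N a \<pi>' ((c, w) # \<pi>) (cr (Cm ?l ((c, w) # \<pi>)))" using True False b(1) by simp
      have "okn a \<pi>' ((c, w) # \<pi>)" using b(2) v True unfolding okn_def by simp
      moreover have "eqv (pB (gB b w)) w"
        using valid_eqv[OF v] goodD(3)[OF valid_good[OF v]] unfolding g pB.simps by simp
      ultimately show ?thesis using goodD(2)[OF valid_good[OF v]] unfolding g BB_iff by blast
    next
      case F: False
      then have D: "Suc (length \<pi>) = D" using b(2) by (simp add: okn_def)
      have g: "gB b w = N ?l ((c, w) # \<pi>) [] (cr (Cm (rep w) []))" using F False b(1) by simp
      have ra: "ra ?l ((c, w) # \<pi>) = rep w" by (simp add: ra_def)
      have vr: "valid (rep w) []" using rep(1)[OF assms(3)] by simp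
      have "okn ?l ((c, w) # \<pi>) []" using ra_R[OF b(2)] v D vr Dpos unfolding okn_def ra by simp
      moreover have "eqv (pB (gB b w)) w"
        using rep(2)[OF assms(3)] goodD(3)[OF valid_good[OF vr]] unfolding g pB.simps ra by simp
      ultimately show ?thesis using goodD(2)[OF valid_good[OF vr]] unfolding g BB_iff ra by blast
    qed
  qed
qed

lemma gB_self: "b \<in> BB \<Longrightarrow> gB b (pB b) = b"
  by (erule BB_E) (use goodD(4,7) in fastforce)

section \<open>The relations of the folded structure\<close>

lemma tot_iv: "j \<in> J \<Longrightarrow> tot X (iv j) = tot X j"
  using r_iv unfolding tot_def by auto

lemma up_iv: "j \<in> J \<Longrightarrow> up (iv (iv j)) u = up j u"
  using r_iv iv_J unfolding up_def by (auto split: sum.splits)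

lemma chart_up:
  assumes "j \<in> J" "tot X j" "b \<in> BB" "(x, y) \<in> r j" "up j (chB b y)"
  shows "up j (chB b x)"
proof -
  note tr = transD[OF trans_r[OF assms(1)]]
  have "(y, pB b) \<in> r j"
    using assms pB_X[OF assms(3)] unfolding up_def chB_def tot_def by (auto split: if_splits)
  then have "(x, pB b) \<in> r j" using tr assms(4) by blast
  then show ?thesis using assms(3) gB_BB unfolding up_def chB_def by auto
qed

lemma chB_Inr: "chB b x = Inr q \<Longrightarrow> q = (b, x) \<and> \<not> (x \<in> W (pB b) \<and> x \<in> X)"
  unfolding chB_def by (auto split: if_splits)

text \<open>Only total \<open>j\<close> needs an argument. Chart edges meeting in a private point
  belong to the same chart and compose there. If they meet in a center, this center links the outer
  points by \<open>up\<close>. The other edges absorb chart edges by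
  \<open>chart_up\<close>.\<close>

lemma QB_trans: assumes j: "j \<in> J" shows "trans (QB j)"
proof (cases "tot X j")
  case False then show ?thesis by (simp add: QB_def)
next
  case True
  note tr = transD[OF trans_r[OF j]]
  have ivj: "iv j \<in> J" "tot X (iv j)" using iv_J j tot_iv True by auto
  have Q: "QB j = {(u, v). up j u \<and> up (iv j) v} \<union> {(chB b x, chB b y) | b x y. b \<in> BB \<and> (x, y) \<in> r j}"
    using True by (simp add: QB_def)
  have bag_structure: "up j (chB b x) \<and> up (iv j) (chB b x)" if "b \<in> BB" "chB b x = Inl c" for b x c
    using that gB_BB unfolding up_def chB_def by (auto split: if_splits)
  show ?thesis
  proof (rule transI)
    fix u v w assume uv: "(u, v) \<in> QB j" and vw: "(v, w) \<in> QB j"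
    consider (1) "up j u" "up (iv j) v" | (2) b x y where "b \<in> BB" "(x, y) \<in> r j" "u = chB b x" "v = chB b y"
      using uv unfolding Q by blast
    then show "(u, w) \<in> QB j"
    proof cases
      case 1
      consider (a) "up (iv j) w" | (b) b x y where "b \<in> BB" "(x, y) \<in> r j" "v = chB b x" "w = chB b y"
        using vw unfolding Q by blast
      then show ?thesis
      proof cases
        case a then show ?thesis using 1 unfolding Q by blast
      next
        case b
        have "(y, x) \<in> r (iv j)" using b r_iv[OF j] by simp
        then have "up (iv j) w" using chart_up[OF ivj b(1)] 1 b by blast
        then show ?thesis using 1 unfolding Q by blast
      qed
    next
      case 2
      consider (a) "up j v" "up (iv j) w" | (b) b' x' y' where "b' \<in> BB" "(x', y') \<in> r j" "v = chB b' x'" "w = chB b' y'"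
        using vw unfolding Q by blast
      then show ?thesis
      proof cases
        case a
        then have "up j u" using chart_up[OF j True 2(1,2)] 2 by blast
        then show ?thesis using a unfolding Q by blast
      next
        case b
        show ?thesis
        proof (cases v)
          case (Inr q)
          then have "q = (b, y)" "q = (b', x')" using chB_Inr 2 b by metis+
          then have "w = chB b y'" "(x, y') \<in> r j" using 2 b tr by auto
          then show ?thesis using 2 unfolding Q by blast
        next
          case (Inl c)
          have "up j u" using chart_up[OF j True 2(1,2)] bag_structure[OF 2(1), of y c] 2 Inl by metis
          moreover have "(y', x') \<in> r (iv j)" using b r_iv[OF j] by simp
          then have "up (iv j) w" using chart_up[OF ivj b(1)] bag_structure[OF b(1), of x' c] b Inl by metis
          ultimately show ?thesis unfolding Q by blast
        qed
      qed
    qed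
  qed
qed

lemma gen_iv: assumes j: "j \<in> J" shows "gen (iv j) = (gen j)\<inverse>"
proof -
  have q: "(u, v) \<in> cQ (Cm (ra a \<pi>') \<pi>) (iv j) \<longleftrightarrow> (v, u) \<in> cQ (Cm (ra a \<pi>') \<pi>) j"
    if "N a \<pi>' \<pi> c \<in> BB" for a \<pi>' \<pi> c u v
  proof -
    have "valid (ra a \<pi>') \<pi>" using that by (simp add: BB_iff okn_def)
    then show ?thesis using goodD(9)[OF valid_good j] by simp
  qed
  show ?thesis
  proof (intro equalityI subrelI)
    fix u v assume "(u, v) \<in> gen (iv j)"
    then show "(u, v) \<in> (gen j)\<inverse>" unfolding gen_def using q by blast
  next
    fix u v assume "(u, v) \<in> (gen j)\<inverse>"
    then show "(u, v) \<in> gen (iv j)" unfolding gen_def using q by blast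
  qed
qed

lemma QB_iv: assumes j: "j \<in> J" shows "QB (iv j) = (QB j)\<inverse>"
proof (cases "tot X j")
  case False
  then show ?thesis using tot_iv[OF j] gen_iv[OF j] by (simp add: QB_def trancl_converse)
next
  case True
  have "(u, v) \<in> QB (iv j) \<longleftrightarrow> (v, u) \<in> QB j" for u v
    using True tot_iv[OF j] up_iv[OF j] r_iv[OF j] unfolding QB_def by auto
  then show ?thesis by auto
qed

lemma QB_chart:
  assumes j: "j \<in> J" and b: "b \<in> BB" and xy: "(x, y) \<in> r j" shows "(chB b x, chB b y) \<in> QB j"
proof (cases "tot X j")
  case True then show ?thesis using assms unfolding QB_def by auto
next
  case False
  obtain a \<pi>' \<pi> c where b': "b = N a \<pi>' \<pi> c" "c \<in> cB (Cm (ra a \<pi>') \<pi>)"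
    "good (XX (ra a \<pi>') \<pi>) (fst (sta (ra a \<pi>') \<pi>)) (Cm (ra a \<pi>') \<pi>)"
    using BB_E[OF b] by metis
  have "x \<in> A" "y \<in> A" using rA j JI xy by blast+
  then have "(chB b x, chB b y) \<in> gen j"
    using goodD(10)[OF b'(3) j b'(2) xy] b unfolding gen_def b'(1) by blast
  then show ?thesis using False unfolding QB_def by auto
qed

section \<open>Unfolding along a cut\<close>

fun dpe :: "'a el \<Rightarrow> nat" where "dpe (N a \<pi>' \<pi> c) = length \<pi>" | "dpe L = 0"
definition dep :: "'a el + 'a el \<times> 'a \<Rightarrow> nat" where "dep u = (case u of Inl b \<Rightarrow> dpe b | Inr q \<Rightarrow> dpe (fst q))"

text \<open>Cutting at depth \<open>g\<close> unfolds the structure into trees: below the cut the tree of the current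
  block starts, above it the current block is the continuation of the preceding one.\<close>

fun lab :: "nat \<Rightarrow> 'a el \<Rightarrow> 'a" where
  "lab g (N a \<pi>' \<pi> c) = (if length \<pi> > g then ra a \<pi>' else a)" | "lab g L = a0"
fun ph :: "nat \<Rightarrow> 'a el \<Rightarrow> 'a path \<times> 'a el" where
  "ph g (N a \<pi>' \<pi> c) = (if length \<pi> > g then \<pi> else \<pi> @ \<pi>', c)" | "ph g L = ([], L)"

definition plab :: "nat \<Rightarrow> 'a el + 'a el \<times> 'a \<Rightarrow> 'a" where
  "plab g u = (case u of Inl b \<Rightarrow> lab g b | Inr q \<Rightarrow> lab g (fst q))"
definition pph :: "nat \<Rightarrow> 'a el + 'a el \<times> 'a \<Rightarrow> 'a pt" where
  "pph g u = (case u of Inl b \<Rightarrow> Inl (ph g b) | Inr q \<Rightarrow> Inr (ph g (fst q), snd q))"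

lemma ph_state:
  assumes "okn a \<pi>' \<pi>"
  shows "sta (lab g (N a \<pi>' \<pi> c)) (fst (ph g (N a \<pi>' \<pi> c))) = sta (ra a \<pi>') \<pi>"
    "valid (lab g (N a \<pi>' \<pi> c)) (fst (ph g (N a \<pi>' \<pi> c)))"
  using assms sta_append[of \<pi>' \<pi> a] valid_join[of a \<pi>' \<pi>] unfolding okn_def by auto

lemma ph_CU:
  assumes "b \<in> BB" shows "ph g b \<in> CU (lab g b)"
proof -
  obtain a \<pi>' \<pi> c where b: "b = N a \<pi>' \<pi> c" "okn a \<pi>' \<pi>" "c \<in> cB (Cm (ra a \<pi>') \<pi>)" using BB_E[OF assms] by metis
  have "snd (ph g b) = c" using b(1) by simp
  then show ?thesis using ph_state[OF b(2), of g c] b(3) unfolding b(1)[symmetric] CU_def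
    by (metis (mono_tags, lifting) case_prodI mem_Collect_eq prod.collapse)
qed

text \<open>The cut lies between \<open>g\<close> and \<open>Suc g\<close>, so a chart is torn only
  if its center has depth \<open>g\<close>. When a chart wraps from the end of a block to depth
  \<open>0\<close>, the current block becomes the preceding one, and both descriptions name the same
  point of the unfolded tree.\<close>

lemma ph_chart:
  assumes b: "b \<in> BB" and ne: "dpe b \<noteq> g" and g: "Suc g < D"
  shows "plab g (chB b x) = lab g b \<and> pph g (chB b x) = chU (lab g b) (ph g b) x"
proof -
  obtain a \<pi>' \<pi> c where b': "b = N a \<pi>' \<pi> c" and ok: "okn a \<pi>' \<pi>" and c: "c \<in> cB (Cm (ra a \<pi>') \<pi>)"
    using BB_E[OF b] by metis
  define l where "l = lab g b"
  define p where "p = fst (ph g b)"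
  have php: "ph g b = (p, c)" using b' by (simp add: p_def)
  have st: "sta l p = sta (ra a \<pi>') \<pi>" using ph_state(1)[OF ok, of g c] b' unfolding l_def p_def by simp
  have len: "length \<pi> \<noteq> g" "length \<pi> < D" using ne b' ok by (auto simp: okn_def)
  have pp: "\<pi>' = [] \<or> length \<pi>' = D" using ok by (simp add: okn_def)
  have ch: "chU l (p, c) x = (if x \<in> W (pB b) \<inter> X then if x \<in> XX (ra a \<pi>') \<pi> then Inl (p, cg (Cm (ra a \<pi>') \<pi>) c x)
      else Inl ((c, x) # p, cr (Cm l ((c, x) # p))) else Inr ((p, c), x))"
    unfolding chU_def Let_def fst_conv snd_conv st b' pB.simps ..
  consider (1) "x \<notin> W (pB b) \<inter> X" | (2) "x \<in> W (pB b) \<inter> X" "x \<in> XX (ra a \<pi>') \<pi>"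
    | (3) "x \<in> W (pB b) \<inter> X" "x \<notin> XX (ra a \<pi>') \<pi>" "Suc (length \<pi>) < D"
    | (4) "x \<in> W (pB b) \<inter> X" "x \<notin> XX (ra a \<pi>') \<pi>" "Suc (length \<pi>) = D" using len by linarith
  then have "plab g (chB b x) = l \<and> pph g (chB b x) = chU l (p, c) x"
  proof cases
    case 1
    then have "chB b x = Inr (b, x)" by (simp add: chB_def)
    then show ?thesis using 1 ch php by (simp add: plab_def pph_def l_def)
  next
    case 2
    then have "chB b x = Inl (N a \<pi>' \<pi> (cg (Cm (ra a \<pi>') \<pi>) c x))" unfolding chB_def b' by simp
    then show ?thesis using 2 ch by (simp add: plab_def pph_def l_def p_def b')
  next
    case 3
    then have cb: "chB b x = Inl (N a \<pi>' ((c, x) # \<pi>) (cr (Cm (ra a \<pi>') ((c, x) # \<pi>))))" unfolding chB_def b' by simp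
    have lg: "length ((c, x) # \<pi>) > g \<longleftrightarrow> length \<pi> > g" using len by auto
    have l': "lab g (N a \<pi>' ((c, x) # \<pi>) d) = l" for d using lg unfolding l_def b' lab.simps by simp
    have p': "ph g (N a \<pi>' ((c, x) # \<pi>) d) = ((c, x) # p, d)" for d using lg unfolding p_def b' ph.simps by auto
    have "sta l ((c, x) # p) = sta (ra a \<pi>') ((c, x) # \<pi>)"
    proof (cases "length \<pi> > g")
      case True then show ?thesis unfolding l_def p_def b' by simp
    next
      case False
      then have "l = a" "p = \<pi> @ \<pi>'" unfolding l_def p_def b' by auto
      then show ?thesis using sta_append[OF pp, of "(c, x) # \<pi>" a] 3 by simp
    qed
    then show ?thesis using 3 ch cb l' p' by (simp only: plab_def pph_def sum.case if_True if_False)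
  next
    case 4
    then have cb: "chB b x = Inl (N (ra a \<pi>') ((c, x) # \<pi>) [] (cr (Cm (rep x) [])))" unfolding chB_def b' by simp
    have "length \<pi> > g" using 4 g by simp
    then have lp: "l = ra a \<pi>'" "p = \<pi>" unfolding l_def p_def b' by auto
    have "sta l ((c, x) # p) = sta (rep x) []" using sta_full[of "(c, x) # p" l] 4 lp by simp
    then show ?thesis using 4 ch cb lp by (simp add: plab_def pph_def)
  qed
  then show ?thesis using php l_def by simp
qed

lemma dep_chart:
  assumes "b \<in> BB" shows "dep (chB b x) = dpe b \<or> dep (chB b x) = Suc (dpe b) \<or> dep (chB b x) = 0 \<and> Suc (dpe b) = D"
  using assms by (rule BB_E) (auto simp: chB_def dep_def okn_def)

lemma node_ph:
  assumes "u \<in> cov chB BB"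
  shows "if dep u > g then length (node (pph g u)) = dep u
     else length (node (pph g u)) = dep u \<or> length (node (pph g u)) = dep u + D"
proof -
  obtain b x where u: "b \<in> BB" "x \<in> A" "u = chB b x" using assms unfolding cov_def by auto
  obtain b' where b': "b' \<in> BB" "u = Inl b' \<or> (\<exists>x. u = Inr (b', x))"
    using u gB_BB unfolding chB_def by (auto split: if_splits)
  obtain a \<pi>' \<pi> c where "b' = N a \<pi>' \<pi> c" "okn a \<pi>' \<pi>" using BB_E[OF b'(1)] by metis
  then show ?thesis using b'(2) by (auto simp: dep_def node_def pph_def okn_def)
qed

end

section \<open>Local maps on the folded structure\<close>

context folded_tree
begin

text \<open>The margin exceeds the depth that one edge of \<open>QU\<close> can span. It is measured
  from \<open>g\<close> for smaller depths and from \<open>Suc g\<close> for larger ones.\<close>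

definition far :: "nat \<Rightarrow> 'a el + 'a el \<times> 'a \<Rightarrow> bool" where
  "far g u \<longleftrightarrow> dep u + 2 * P + 2 < g \<or> g + 2 * P + 3 < dep u"

text \<open>Depth \<open>Suc g\<close> is excluded as well because charts of depth \<open>g\<close>,
  which are torn by the cut, have points there.\<close>

lemma gen_fold:
  assumes "(u, v) \<in> gen j" "dep u \<noteq> g" "dep u \<noteq> Suc g" "Suc g < D" "j \<in> J"
  shows "plab g u = plab g v \<and> (pph g u, pph g v) \<in> QU (plab g u) j"
proof -
  obtain a \<pi>' \<pi> c d x y where uv: "u = chB (N a \<pi>' \<pi> c) x" "v = chB (N a \<pi>' \<pi> d) y"
      "N a \<pi>' \<pi> c \<in> BB" "N a \<pi>' \<pi> d \<in> BB" "x \<in> A" "y \<in> A"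
    and q: "(io (XX (ra a \<pi>') \<pi>) (Cm (ra a \<pi>') \<pi>) c x, io (XX (ra a \<pi>') \<pi>) (Cm (ra a \<pi>') \<pi>) d y)
       \<in> cQ (Cm (ra a \<pi>') \<pi>) j"
    using assms(1) unfolding gen_def by blast
  have ok: "okn a \<pi>' \<pi>" "c \<in> cB (Cm (ra a \<pi>') \<pi>)" "d \<in> cB (Cm (ra a \<pi>') \<pi>)" using uv(3,4) by (auto simp: BB_iff)
  have len: "length \<pi> \<noteq> g"
    using dep_chart[OF uv(3), of x] assms(2-4) unfolding uv(1)[symmetric] by auto
  define l where "l = lab g (N a \<pi>' \<pi> c)"
  define p where "p = fst (ph g (N a \<pi>' \<pi> c))"
  have l: "lab g (N a \<pi>' \<pi> c) = l" "lab g (N a \<pi>' \<pi> d) = l" "ph g (N a \<pi>' \<pi> c) = (p, c)" "ph g (N a \<pi>' \<pi> d) = (p, d)"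
    unfolding l_def p_def by auto
  have st: "sta l p = sta (ra a \<pi>') \<pi>" "valid l p" using ph_state[OF ok(1), of g c] unfolding l_def p_def by auto
  have u: "plab g u = l" "pph g u = chU l (p, c) x"
    using ph_chart[OF uv(3) _ assms(4), of x] len unfolding uv(1) l by auto
  have v: "plab g v = l" "pph g v = chU l (p, d) y"
    using ph_chart[OF uv(4) _ assms(4), of y] len unfolding uv(2) l by auto
  have "(chU l (p, c) x, chU l (p, d) y) \<in> QU l j"
    by (rule QU_nodeI[OF st(2)]) (use ok uv q assms(5) in \<open>simp_all add: st(1)\<close>)
  then show ?thesis unfolding u v by simp
qed

lemma gen_cov: "(u, v) \<in> gen j \<Longrightarrow> u \<in> cov chB BB \<and> v \<in> cov chB BB"
  unfolding gen_def cov_def by blast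

text \<open>As long as a path avoids the cut it amounts to a single edge of \<open>QU\<close>, by
  transitivity, so its end stays within \<open>2 * P + 2\<close> of the depth of \<open>u\<close>.
  Hence it never comes to the cut, however long it is.\<close>

lemma path_fold:
  assumes "(u, v) \<in> (gen j)\<^sup>+" "far g u" "2 * P + 4 \<le> g" "g + 2 * P + 4 < D" "j \<in> NT"
  shows "plab g u = plab g v \<and> (pph g u, pph g v) \<in> QU (plab g u) j"
  using assms(1)
proof induction
  case (base v)
  show ?case by (rule gen_fold[OF base]) (use assms NTJ in \<open>auto simp: far_def\<close>)
next
  case (step v w)
  have uc: "u \<in> cov chB BB" using step(1) gen_cov by (meson tranclD)
  have vc: "v \<in> cov chB BB" using step(2) gen_cov by blast
  let ?fu = "length (node (pph g u))" and ?fv = "length (node (pph g v))"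
  have covers: "?fv \<le> ?fu + 2 * P + 2" "?fu \<le> ?fv + 2 * P + 2"
    using QU_depth_down QU_depth_up step(3) assms(5) by blast+
  have fu: "if dep u > g then ?fu = dep u else ?fu = dep u \<or> ?fu = dep u + D" by (rule node_ph[OF uc])
  have fv: "if dep v > g then ?fv = dep v else ?fv = dep v \<or> ?fv = dep v + D" by (rule node_ph[OF vc])
  have du: "dep u < D"
  proof -
    obtain b x where b: "b \<in> BB" "u = chB b x" using uc unfolding cov_def by blast
    obtain b' where b': "b' \<in> BB" "u = Inl b' \<or> (\<exists>x. u = Inr (b', x))"
      using b gB_BB unfolding chB_def by (auto split: if_splits)
    obtain a \<pi>' \<pi> c where "b' = N a \<pi>' \<pi> c" "okn a \<pi>' \<pi>" using BB_E[OF b'(1)] by metis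
    then show ?thesis using b'(2) by (auto simp: dep_def okn_def)
  qed
  \<comment> \<open>In the unfolded trees the cut appears at the depths \<open>g\<close>,
    \<open>g + D\<close> and \<open>Suc g\<close>. All of them are too far from
    \<open>u\<close>.\<close>
  have "dep v \<noteq> g \<and> dep v \<noteq> Suc g"
  proof (rule ccontr)
    assume "\<not> ?thesis"
    then consider "?fv = g" | "?fv = g + D" | "?fv = Suc g" using fv by (auto split: if_splits)
    then show False using fu covers assms(2-4) du unfolding far_def by cases (auto split: if_splits)
  qed
  then have vw: "plab g v = plab g w \<and> (pph g v, pph g w) \<in> QU (plab g v) j"
  proof -
    assume "dep v \<noteq> g \<and> dep v \<noteq> Suc g"
    moreover have "Suc g < D" "j \<in> J" using assms(4,5) NTJ by auto
    ultimately show ?thesis using gen_fold[OF step(2)] by blast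
  qed
  have "j \<in> J" using assms(5) NTJ by auto
  note tr = transD[OF QU_trans[OF this]]
  have e: "plab g u = plab g v" and uv: "(pph g u, pph g v) \<in> QU (plab g v) j"
    and vw': "(pph g v, pph g w) \<in> QU (plab g v) j" using step.IH vw by auto
  have "(pph g u, pph g w) \<in> QU (plab g u) j" unfolding e by (rule tr[OF uv vw'])
  then show ?case using step.IH vw by simp
qed

text \<open>There are \<open>K + 2\<close> windows of length \<open>2 * (2 * P + 4) + 1\<close> but
  at most \<open>K + 1\<close> points: some window is free, and \<open>g\<close> is its
  middle.\<close>

lemma depth_gap:
  assumes "finite S" "card S \<le> K + 1"
  shows "\<exists>g. 2 * P + 4 \<le> g \<and> g + 2 * P + 4 < D \<and> (\<forall>u\<in>S. dep u + 2 * P + 3 < g \<or> g + 2 * P + 3 < dep u)"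
proof -
  define w where "w = 2 * P + 4"
  define m where "m = 2 * w + 1"
  have Dm: "m * (K + 3) \<le> D" using Dbig unfolding m_def w_def by simp
  have "card ((\<lambda>u. dep u div m) ` S) < card {..K + 1}"
    using card_image_le[OF assms(1), of "\<lambda>u. dep u div m"] assms(2) by simp
  then have "\<not> {..K + 1} \<subseteq> (\<lambda>u. dep u div m) ` S"
    using card_mono[of "(\<lambda>u. dep u div m) ` S" "{..K + 1}"] assms(1) by auto
  then obtain k where k: "k \<le> K + 1" "\<And>u. u \<in> S \<Longrightarrow> dep u div m \<noteq> k" by auto
  define g where "g = m * k + w"
  have "m * k + m + m \<le> m * (K + 3)"
  proof -
    have "m * (k + 2) \<le> m * (K + 3)" using k(1) by (intro mult_le_mono2) simp
    then show ?thesis by (simp add: algebra_simps)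
  qed
  then have "g + w < D" using Dm unfolding g_def m_def by linarith
  moreover have "dep u + 2 * P + 3 < g \<or> g + 2 * P + 3 < dep u" if "u \<in> S" for u
  proof -
    have "dep u div m < k \<or> k < dep u div m" using k(2)[OF that] by linarith
    then show ?thesis
    proof
      assume "dep u div m < k"
      then have "dep u < m * k" using m_def by (metis add_gr_0 div_less_iff_less_mult mult.commute zero_less_one)
      then show ?thesis unfolding g_def w_def by linarith
    next
      assume "k < dep u div m"
      then have "Suc k * m \<le> dep u" using less_eq_div_iff_mult_less_eq[of m "Suc k" "dep u"] m_def by simp
      then show ?thesis unfolding g_def m_def w_def by (simp add: algebra_simps)
    qed
  qed
  ultimately show ?thesis unfolding w_def g_def by (intro exI[of _ g]) (auto simp: g_def w_def)
qed

text \<open>With the cut in a depth range avoided by \<open>b\<close> and \<open>S\<close>, the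
  points fall apart into trees, each of which is mapped by \<open>locally_maps_tree\<close>. Points
  with different labels are joined by total relations only, and these are respected because the
  anchors go to \<open>X\<close>.\<close>

lemma locally_maps_folded: "locally_maps BB chB QB BB"
  unfolding locally_maps_def
proof (intro ballI allI impI)
  fix b S assume b: "b \<in> BB" and S: "S \<subseteq> cov chB BB" "finite S" "card S \<le> K"
  have "card (insert (Inl b) S) \<le> K + 1" using S(2,3) by (simp add: card_insert_if)
  then obtain g where g: "2 * P + 4 \<le> g" "g + 2 * P + 4 < D"
      "\<And>u. u \<in> insert (Inl b) S \<Longrightarrow> dep u + 2 * P + 3 < g \<or> g + 2 * P + 3 < dep u"
    using depth_gap[of "insert (Inl b) S"] S(2) by auto
  have gD: "Suc g < D" using g by simp
  let ?D = "S \<union> chB b ` A"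
  have D: "?D \<subseteq> cov chB BB" using S(1) b unfolding cov_def by auto
  have far: "far g u" if uD: "u \<in> ?D" for u
  proof (cases "u \<in> S")
    case True then show ?thesis using g(3)[of u] unfolding far_def by auto
  next
    case False
    then obtain x where "u = chB b x" using uD by auto
    moreover have "dpe b + 2 * P + 3 < g \<or> g + 2 * P + 3 < dpe b" using g(3)[of "Inl b"] by (simp add: dep_def)
    ultimately show ?thesis using dep_chart[OF b, of x] g(1) unfolding far_def by auto
  qed
  have fold: "plab g (chB c x) = lab g c \<and> pph g (chB c x) = chU (lab g c) (ph g c) x"
    if "c \<in> BB" "chB c x \<in> ?D" for c x
  proof -
    have "dpe c \<noteq> g" using far[OF that(2)] dep_chart[OF that(1), of x] gD unfolding far_def by auto
    then show ?thesis using ph_chart[OF that(1) _ gD] by blast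
  qed
  \<comment> \<open>The tree of \<open>b\<close> is anchored at the chart of \<open>b\<close>, where
    the map has to be the identity; the other trees are anchored at their roots.\<close>
  define an where "an a = (if a = lab g b then ph g b else ([], cr (Cm a [])))" for a
  define Sa where "Sa a = pph g ` {u \<in> S. plab g u = a}" for a
  have an: "an a \<in> CU a" if "a \<in> X" for a
  proof -
    have v: "valid a []" using that by simp
    then have "([], cr (Cm a [])) \<in> CU a" using goodD(2)[OF valid_good[OF v]] unfolding CU_def by blast
    then show ?thesis using ph_CU[OF b] unfolding an_def by auto
  qed
  have labX: "lab g c \<in> X" if "c \<in> BB" for c using ph_CU[OF that, of g] valid_lab unfolding CU_def by blast
  have ex: "\<exists>h. (\<forall>x\<in>A. h (chU a (an a) x) = x) \<and> partial_hom (CU a) (chU a) (QU a) (Sa a \<union> chU a (an a) ` A) h"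
    if aX: "a \<in> X" for a
  proof -
    have "Sa a \<subseteq> cov (chU a) (CU a)"
    proof
      fix s assume "s \<in> Sa a"
      then obtain u where u: "u \<in> S" "plab g u = a" "s = pph g u" unfolding Sa_def by auto
      then obtain c x where c: "c \<in> BB" "x \<in> A" "u = chB c x" using S(1) unfolding cov_def by auto
      have "chB c x \<in> ?D" using u(1) c(3) by simp
      from fold[OF c(1) this] have "lab g c = a" "s = chU a (ph g c) x" using u c(3) by auto
      then show "s \<in> cov (chU a) (CU a)" using ph_CU[OF c(1), of g] c(2) unfolding cov_def by blast
    qed
    moreover have "finite (Sa a)" unfolding Sa_def using S(2) by simp
    moreover have "card (Sa a) \<le> K"
    proof -
      have "card (Sa a) \<le> card {u \<in> S. plab g u = a}" unfolding Sa_def using S(2) by (intro card_image_le) simp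
      also have "\<dots> \<le> card S" using S(2) by (intro card_mono) auto
      finally show ?thesis using S(3) by simp
    qed
    ultimately show ?thesis using locally_maps_tree[of a] an[OF aX] unfolding locally_maps_def by blast
  qed
  define hh where "hh a = (SOME h. (\<forall>x\<in>A. h (chU a (an a) x) = x) \<and>
    partial_hom (CU a) (chU a) (QU a) (Sa a \<union> chU a (an a) ` A) h)" for a
  have hh: "\<forall>x\<in>A. hh a (chU a (an a) x) = x" "partial_hom (CU a) (chU a) (QU a) (Sa a \<union> chU a (an a) ` A) (hh a)"
    if "a \<in> X" for a using someI_ex[OF ex[OF that]] unfolding hh_def by blast+
  define h where "h u = hh (plab g u) (pph g u)" for u
  have bx: "plab g (chB b x) = lab g b" "pph g (chB b x) = chU (lab g b) (an (lab g b)) x" if "x \<in> A" for x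
    using fold[OF b, of x] that unfolding an_def by auto
  have anch: "\<forall>x\<in>A. h (chB b x) = x"
    using bx hh(1)[OF labX[OF b]] unfolding h_def by simp
  have inD: "pph g u \<in> Sa (plab g u) \<union> chU (plab g u) (an (plab g u)) ` A" if uD: "u \<in> ?D" for u
  proof (cases "u \<in> S")
    case True then show ?thesis unfolding Sa_def by blast
  next
    case False
    then obtain x where x: "x \<in> A" "u = chB b x" using uD by auto
    show ?thesis unfolding x(2) bx[OF x(1)] using x(1) by blast
  qed
  have plX: "plab g u \<in> X" if uD: "u \<in> ?D" for u
  proof -
    obtain c x where c: "c \<in> BB" "u = chB c x" using uD D unfolding cov_def by blast
    then show ?thesis using fold[OF c(1), of x] uD labX by simp
  qed
  have chart: "(h (chB c x), h (chB c y)) \<in> r i"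
    if i: "i \<in> I" and c: "c \<in> BB" and xy: "(x, y) \<in> r i" and cD: "chB c x \<in> ?D" "chB c y \<in> ?D" for i c x y
  proof -
    note f = fold[OF c cD(1)] fold[OF c cD(2)]
    have "(hh (lab g c) (chU (lab g c) (ph g c) x), hh (lab g c) (chU (lab g c) (ph g c) y)) \<in> r i"
      by (rule partial_homD(2)[OF hh(2)[OF labX[OF c]] i ph_CU[OF c] xy]) (use inD[OF cD(1)] inD[OF cD(2)] f in auto)
    then show ?thesis using f unfolding h_def by simp
  qed
  \<comment> \<open>\<open>pa a\<close> is the value of the anchor. A point with \<open>up\<close>
    is linked to a center and, by totality, to the anchor; so its image is linked to
    \<open>pa a\<close>, and any two such values are related since both lie in
    \<open>X\<close>.\<close>
  define pa where "pa a = cp (Cm a (fst (an a))) (snd (an a))" for a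
  have pa: "pa a \<in> X" "chU a (an a) (pa a) = Inl (an a)" if "a \<in> X" for a
    using center_chart(1,2)[of "fst (an a)" "snd (an a)" a] an[OF that] unfolding pa_def by auto
  have up: "(h u, pa (plab g u)) \<in> r j" if j: "j \<in> J" "tot X j" and u: "u \<in> ?D" "up j u" for j u
  proof -
    let ?a = "plab g u"
    note aX = plX[OF u(1)]
    have "(pph g u, Inl (an ?a)) \<in> QU ?a j"
    proof (cases u)
      case (Inl c)
      then have c: "c \<in> BB" "?a = lab g c" "pph g u = Inl (ph g c)" using u by (auto simp: up_def plab_def pph_def)
      have "ph g c \<in> CU ?a" unfolding c(2) by (rule ph_CU[OF c(1)])
      from QU_tot[OF j this an[OF aX]] show ?thesis unfolding c(3) .
    next
      case (Inr q)
      then obtain c x where q: "u = Inr (c, x)" "c \<in> BB" "(x, pB c) \<in> r j" using u by (auto simp: up_def)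
      obtain c' x' where "c' \<in> BB" "u = chB c' x'" using u D unfolding cov_def by blast
      then have ux: "u = chB c x" using chB_Inr q(1) by fastforce
      have f: "?a = lab g c" "pph g u = chU (lab g c) (ph g c) x" using fold[OF q(2), of x] u(1) unfolding ux by auto
      have phc: "ph g c \<in> CU (lab g c)" by (rule ph_CU[OF q(2)])
      have "chU (lab g c) (ph g c) (pB c) = Inl (ph g c)"
      proof -
        obtain a \<pi>' \<pi> d where c: "c = N a \<pi>' \<pi> d" "okn a \<pi>' \<pi>" using BB_E[OF q(2)] by metis
        have "cp (Cm (lab g c) (fst (ph g c))) (snd (ph g c)) = pB c"
          using ph_state(1)[OF c(2), of g d] unfolding c(1)[symmetric] by (simp add: c(1))
        then show ?thesis using center_chart(1)[of "fst (ph g c)" "snd (ph g c)" "lab g c"] phc by simp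
      qed
      then have "(pph g u, Inl (ph g c)) \<in> QU ?a j" using QU_chart[OF j(1) phc q(3)] f by simp
      moreover have "(Inl (ph g c), Inl (an ?a)) \<in> QU ?a j" using QU_tot[OF j phc] an[OF aX] f by simp
      ultimately show ?thesis using QU_trans[OF j(1)] by (meson transD)
    qed
    moreover have paA: "pa ?a \<in> A" using pa(1)[OF aX] XA by blast
    ultimately have "(hh ?a (pph g u), hh ?a (Inl (an ?a))) \<in> r j"
      using partial_homD(3)[OF hh(2)[OF aX] j(1)] inD[OF u(1)] pa(2)[OF aX] by (metis UnI2 imageI)
    moreover have "hh ?a (Inl (an ?a)) = pa ?a" using hh(1)[OF aX] paA pa(2)[OF aX] by metis
    ultimately show ?thesis unfolding h_def by simp
  qed
  have "partial_hom BB chB QB ?D h"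
  proof (rule partial_homI)
    fix u assume u: "u \<in> ?D"
    show "h u \<in> A" unfolding h_def using partial_homD(1)[OF hh(2)[OF plX[OF u]]] inD[OF u] by blast
  next
    fix i c x y assume "i \<in> I" "c \<in> BB" "(x, y) \<in> r i" "chB c x \<in> ?D" "chB c y \<in> ?D"
    then show "(h (chB c x), h (chB c y)) \<in> r i" by (rule chart)
  next
    fix j u v assume j: "j \<in> J" and uv: "u \<in> ?D" "v \<in> ?D" "(u, v) \<in> QB j"
    show "(h u, h v) \<in> r j"
    proof (cases "tot X j")
      case False
      then have "(u, v) \<in> (gen j)\<^sup>+" "j \<in> NT" using uv(3) j by (auto simp: QB_def NT_def)
      from path_fold[OF this(1) far[OF uv(1)] g(1,2) this(2)]
      have f: "plab g u = plab g v" "(pph g u, pph g v) \<in> QU (plab g u) j" by auto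
      then show ?thesis unfolding h_def
        using partial_homD(3)[OF hh(2)[OF plX[OF uv(1)]] j] inD[OF uv(1)] inD[OF uv(2)] by metis
    next
      case True
      note tr = transD[OF trans_r[OF j]]
      consider "up j u" "up (iv j) v" | b x y where "b \<in> BB" "(x, y) \<in> r j" "u = chB b x" "v = chB b y"
        using uv(3) True unfolding QB_def by auto
      then show ?thesis
      proof cases
        case 1
        have "(h u, pa (plab g u)) \<in> r j" by (rule up[OF j True uv(1) 1(1)])
        moreover have "(pa (plab g v), h v) \<in> r j"
          using up[OF iv_J[OF j] _ uv(2) 1(2)] tot_iv[OF j] True r_iv[OF j] by simp
        moreover have "(pa (plab g u), pa (plab g v)) \<in> r j"
          using True pa(1)[OF plX[OF uv(1)]] pa(1)[OF plX[OF uv(2)]] unfolding tot_def by blast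
        ultimately show ?thesis using tr by blast
      next
        case 2
        then show ?thesis using chart[of j] j JI uv by blast
      qed
    qed
  qed
  then show "\<exists>h. (\<forall>x\<in>A. h (chB b x) = x) \<and> partial_hom BB chB QB ?D h" using anch by blast
qed

section \<open>Counting the elements of the folded structure\<close>

definition VP :: "'a \<Rightarrow> nat \<Rightarrow> 'a path set" where "VP a n = {\<pi>. valid a \<pi> \<and> length \<pi> = n}"

lemma VP_card:
  assumes s: "\<And>st. okst st \<Longrightarrow> card (cB (CP st)) \<le> s" and m: "\<And>a. a \<in> A \<Longrightarrow> card (W a) \<le> m"
  shows "finite (VP a n) \<and> card (VP a n) \<le> (s * m) ^ n"
proof (induction n)
  case 0
  have "VP a 0 \<subseteq> {[]}" unfolding VP_def by auto
  then show ?case using card_mono[of "{[]}" "VP a 0"] finite_subset[of "VP a 0" "{[]}"] by simp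
next
  case (Suc n)
  let ?S = "\<lambda>\<pi>. SIGMA c:cB (Cm a \<pi>). W (cp (Cm a \<pi>) c)"
  have sub: "VP a (Suc n) \<subseteq> (\<Union>\<pi>\<in>VP a n. (\<lambda>s. s # \<pi>) ` ?S \<pi>)"
  proof
    fix p assume "p \<in> VP a (Suc n)"
    then obtain s \<pi> where "p = s # \<pi>" "valid a (s # \<pi>)" "length \<pi> = n" unfolding VP_def by (cases p) auto
    then show "p \<in> (\<Union>\<pi>\<in>VP a n. (\<lambda>s. s # \<pi>) ` ?S \<pi>)"
      by (intro UN_I[of \<pi>]) (auto simp: VP_def intro!: image_eqI[of _ _ s] mem_Sigma_iff[THEN iffD2] split: prod.splits, cases s, auto)
  qed
  have fS: "finite (?S \<pi>) \<and> card (?S \<pi>) \<le> s * m" if "\<pi> \<in> VP a n" for \<pi>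
  proof -
    have v: "valid a \<pi>" using that by (simp add: VP_def)
    note g = valid_good[OF v]
    have cA: "cp (Cm a \<pi>) c \<in> A" if "c \<in> cB (Cm a \<pi>)" for c using goodD(4)[OF g that] XX_A[OF v] by blast
    have fw: "finite (W (cp (Cm a \<pi>) c))" if "c \<in> cB (Cm a \<pi>)" for c
      using W_A[OF cA[OF that]] finA finite_subset by blast
    have "card (?S \<pi>) = (\<Sum>c\<in>cB (Cm a \<pi>). card (W (cp (Cm a \<pi>) c)))"
      using goodD(1)[OF g] fw by (intro card_SigmaI) auto
    also have "\<dots> \<le> card (cB (Cm a \<pi>)) * m" using sum_bounded_above[of "cB (Cm a \<pi>)" _ m] m cA by simp
    also have "\<dots> \<le> s * m" using s[OF valid_ok[OF v]] by (rule mult_le_mono1)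
    finally show ?thesis using goodD(1)[OF g] fw by auto
  qed
  have fin: "finite (\<Union>\<pi>\<in>VP a n. (\<lambda>s. s # \<pi>) ` ?S \<pi>)" using Suc fS by auto
  have "card (VP a (Suc n)) \<le> card (\<Union>\<pi>\<in>VP a n. (\<lambda>s. s # \<pi>) ` ?S \<pi>)" by (rule card_mono[OF fin sub])
  also have "\<dots> \<le> (\<Sum>\<pi>\<in>VP a n. card ((\<lambda>s. s # \<pi>) ` ?S \<pi>))" using Suc by (intro card_UN_le) auto
  also have "\<dots> \<le> card (VP a n) * (s * m)"
  proof -
    have "card ((\<lambda>s. s # \<pi>) ` ?S \<pi>) \<le> s * m" if "\<pi> \<in> VP a n" for \<pi>
      using card_image_le[of "?S \<pi>" "\<lambda>s. s # \<pi>"] fS[OF that] by (meson order_trans)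
    then show ?thesis using sum_bounded_above[of "VP a n" "\<lambda>\<pi>. card ((\<lambda>s. s # \<pi>) ` ?S \<pi>)" "s * m"] by simp
  qed
  also have "\<dots> \<le> (s * m) ^ n * (s * m)" using Suc by (intro mult_le_mono1) auto
  finally show ?case using fin sub finite_subset by (auto simp: mult.commute)
qed

text \<open>The factors count the start \<open>a\<close>, the preceding block (empty or full), the
  length of the current path, the path itself and the center in its component.\<close>

lemma BB_card:
  assumes s: "\<And>st. okst st \<Longrightarrow> card (cB (CP st)) \<le> s" and m: "\<And>a. a \<in> A \<Longrightarrow> card (W a) \<le> m" and q: "1 \<le> s * m"
  shows "finite BB \<and> card BB \<le> (M + 1) * ((1 + (s * m) ^ D) * (D * ((s * m) ^ D * s)))"
proof -
  let ?q = "(s * m) ^ D"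
  note V = VP_card[OF s m]
  let ?F = "\<lambda>a \<pi>' n. \<Union>\<pi>\<in>VP (ra a \<pi>') n. N a \<pi>' \<pi> ` cB (Cm (ra a \<pi>') \<pi>)"
  let ?G = "\<lambda>a \<pi>'. \<Union>n\<in>{..<D}. ?F a \<pi>' n"
  let ?H = "\<lambda>a. \<Union>\<pi>'\<in>VP a 0 \<union> VP a D. ?G a \<pi>'"
  have sub: "BB \<subseteq> (\<Union>a\<in>R. ?H a)"
  proof
    fix b assume bB: "b \<in> BB"
    obtain a \<pi>' \<pi> c where b: "b = N a \<pi>' \<pi> c" "okn a \<pi>' \<pi>" "c \<in> cB (Cm (ra a \<pi>') \<pi>)"
      using BB_E[OF bB] .
    have "\<pi>' \<in> VP a 0 \<union> VP a D" "\<pi> \<in> VP (ra a \<pi>') (length \<pi>)" "length \<pi> \<in> {..<D}" "a \<in> R"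
      using b(2) unfolding okn_def VP_def by auto
    then show "b \<in> (\<Union>a\<in>R. ?H a)" unfolding b(1) by (intro UN_I) (use b(3) in auto)
  qed
  have F: "finite (?F a \<pi>' n) \<and> card (?F a \<pi>' n) \<le> ?q * s" if "n < D" for a \<pi>' n
  proof
    have c: "finite (cB (Cm l \<pi>)) \<and> card (cB (Cm l \<pi>)) \<le> s" if "\<pi> \<in> VP l n" for l \<pi>
      using that goodD(1)[OF valid_good] s[OF valid_ok] by (simp add: VP_def)
    show "finite (?F a \<pi>' n)" using V c by auto
    have "card (?F a \<pi>' n) \<le> (\<Sum>\<pi>\<in>VP (ra a \<pi>') n. card (N a \<pi>' \<pi> ` cB (Cm (ra a \<pi>') \<pi>)))"
      using V by (intro card_UN_le) auto
    also have "\<dots> \<le> card (VP (ra a \<pi>') n) * s"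
    proof -
      have "card (N a \<pi>' \<pi> ` cB (Cm (ra a \<pi>') \<pi>)) \<le> s" if "\<pi> \<in> VP (ra a \<pi>') n" for \<pi>
        using card_image_le c[OF that] by (meson order_trans)
      then show ?thesis using sum_bounded_above[of "VP (ra a \<pi>') n" _ s] by simp
    qed
    also have "\<dots> \<le> (s * m) ^ n * s" using V by (intro mult_le_mono1) auto
    also have "\<dots> \<le> ?q * s" using power_increasing[of n D "s * m"] that q by (intro mult_le_mono1) auto
    finally show "card (?F a \<pi>' n) \<le> ?q * s" .
  qed
  have G: "finite (?G a \<pi>') \<and> card (?G a \<pi>') \<le> D * (?q * s)" for a \<pi>'
  proof
    show "finite (?G a \<pi>')" using F by auto
    have "card (?G a \<pi>') \<le> (\<Sum>n\<in>{..<D}. card (?F a \<pi>' n))" by (intro card_UN_le) auto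
    also have "\<dots> \<le> D * (?q * s)" using sum_bounded_above[of "{..<D}" "\<lambda>n. card (?F a \<pi>' n)" "?q * s"] F by simp
    finally show "card (?G a \<pi>') \<le> D * (?q * s)" .
  qed
  have H: "finite (?H a) \<and> card (?H a) \<le> (1 + ?q) * (D * (?q * s))" for a
  proof
    show "finite (?H a)" using V G by auto
    have "card (?H a) \<le> (\<Sum>\<pi>'\<in>VP a 0 \<union> VP a D. card (?G a \<pi>'))" using V by (intro card_UN_le) auto
    also have "\<dots> \<le> card (VP a 0 \<union> VP a D) * (D * (?q * s))"
      using sum_bounded_above[of "VP a 0 \<union> VP a D" "\<lambda>\<pi>'. card (?G a \<pi>')" "D * (?q * s)"] G by simp
    also have "\<dots> \<le> (1 + ?q) * (D * (?q * s))"
    proof (rule mult_le_mono1)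
      have "card (VP a 0 \<union> VP a D) \<le> card (VP a 0) + card (VP a D)" by (rule card_Un_le)
      then show "card (VP a 0 \<union> VP a D) \<le> 1 + ?q" using V[of a 0] V[of a D] by simp
    qed
    finally show "card (?H a) \<le> (1 + ?q) * (D * (?q * s))" .
  qed
  have finX: "finite X" by (rule finite_subset[OF XA finA])
  have finR: "finite R" by (rule finite_subset[OF RX finX])
  \<comment> \<open>\<open>rep w\<close> depends on the type of \<open>w\<close> only, which leaves
    at most \<open>M\<close> values; one more is \<open>a0\<close>.\<close>
  have R: "card R \<le> M + 1"
  proof -
    have "rep ` X \<subseteq> (\<lambda>C. SOME x. x \<in> X \<and> x \<in> C) ` (cls ` X)"
    proof
      fix y assume "y \<in> rep ` X"
      then obtain w where w: "w \<in> X" "y = rep w" by auto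
      have "(\<lambda>x. x \<in> X \<and> eqv x w) = (\<lambda>x. x \<in> X \<and> x \<in> cls w)" unfolding cls_def using eqv_sym by auto
      then have "y = (SOME x. x \<in> X \<and> x \<in> cls w)" unfolding w(2) rep_def by simp
      then show "y \<in> (\<lambda>C. SOME x. x \<in> X \<and> x \<in> C) ` (cls ` X)" using w(1) by auto
    qed
    then have "card (rep ` X) \<le> card (cls ` X)"
      using surj_card_le[of "cls ` X" "rep ` X"] finX by simp
    also have "\<dots> \<le> M" unfolding M_def using finA XA by (intro card_mono) auto
    finally show ?thesis unfolding R_def using finX by (simp add: card_insert_if)
  qed
  have fin: "finite (\<Union>a\<in>R. ?H a)" using finR H by auto
  have "card BB \<le> card (\<Union>a\<in>R. ?H a)" by (rule card_mono[OF fin sub])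
  also have "\<dots> \<le> (\<Sum>a\<in>R. card (?H a))" by (rule card_UN_le[OF finR])
  also have "\<dots> \<le> card R * ((1 + ?q) * (D * (?q * s)))"
    using sum_bounded_above[of R "\<lambda>a. card (?H a)" "(1 + ?q) * (D * (?q * s))"] H by simp
  also have "\<dots> \<le> (M + 1) * ((1 + ?q) * (D * (?q * s)))" using R by (rule mult_le_mono1)
  finally show ?thesis using finite_subset[OF sub fin] by simp
qed

lemma good_CB:
  assumes "finite BB"
  shows "good X a0 CB"
proof -
  have v: "valid a0 []" using a0 by simp
  note g = valid_good[OF v]
  have ra: "ra a0 [] = a0" by (simp add: ra_def)
  have ok: "okn a0 [] []" using v Dpos unfolding okn_def ra by (simp add: R_def)
  have root: "N a0 [] [] (cr (Cm a0 [])) \<in> BB" using ok goodD(2)[OF g] unfolding BB_iff ra by blast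
  have "pB (N a0 [] [] (cr (Cm a0 []))) = a0" using goodD(3)[OF g] unfolding pB.simps ra by simp
  moreover have "(Inl c, Inl d) \<in> QB j" if "j \<in> J" "tot X j" "c \<in> BB" "d \<in> BB" for j c d
    using that unfolding QB_def up_def by simp
  ultimately show ?thesis
    unfolding good_def CB_sel io_CB using assms root pB_X gB_BB gB_self QB_trans QB_iv QB_chart locally_maps_folded
    by blast
qed

end

section \<open>Recursion on the number of non-total relations\<close>

context bag_structure
begin

fun comp_bound :: "nat \<Rightarrow> nat \<Rightarrow> nat \<Rightarrow> nat" where
  "comp_bound m D 0 = 1"
| "comp_bound m D (Suc n) = (M + 1) * ((1 + (comp_bound m D n * m) ^ D) * (D * ((comp_bound m D n * m) ^ D * comp_bound m D n)))"

lemma comp_bound_pos: "1 \<le> m \<Longrightarrow> 1 \<le> D \<Longrightarrow> 1 \<le> comp_bound m D n"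
  unfolding One_nat_def Suc_le_eq by (induction n) auto

text \<open>On a clique with a loop the head relation is total, so the components needed there have
  fewer non-total relations and exist by induction. With no such relation left, queues stay empty
  and all components are trivial.\<close>

lemma exists_good:
  assumes m: "\<And>a. a \<in> A \<Longrightarrow> card (W a) \<le> m" and m1: "1 \<le> m"
    and D: "(2 * (2 * (card J * (M + 1)) + 4) + 1) * (K + 3) \<le> D"
  shows "X \<subseteq> A \<Longrightarrow> a \<in> X \<Longrightarrow> card {j \<in> J. \<not> tot X j} \<le> n \<Longrightarrow>
    \<exists>C. good X a C \<and> card (cB C) \<le> comp_bound m D (Suc n)"
proof (induction n arbitrary: X a)
  have D1: "1 \<le> D" using D by (cases D) auto
  have finJ: "finite J" using finI JI finite_subset by blast
  have main: "\<exists>C. good X a C \<and> card (cB C) \<le> comp_bound m D (Suc n)"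
    if X: "X \<subseteq> A" and a: "a \<in> X"
      and IH: "\<And>Y b. Y \<subseteq> X \<Longrightarrow> b \<in> Y \<Longrightarrow> {j \<in> J. \<not> tot Y j} \<subset> {j \<in> J. \<not> tot X j} \<Longrightarrow>
        \<exists>C. good Y b C \<and> card (cB C) \<le> comp_bound m D n" for X a n
  proof -
    \<comment> \<open>\<open>Xs\<close> and \<open>okst\<close> do not depend on the choice of
      components, so they can be used to make this choice before the tree is available.\<close>
    define Xs where "Xs = tree_frame.Xs r X"
    define okst where "okst = tree_frame.okst r J X"
    define CP where "CP st = (if Xs st = {fst st} then triv (fst st)
      else (SOME C. good (Xs st) (fst st) C \<and> card (cB C) \<le> comp_bound m D n))" for st
    interpret L: tree_frame A r I J iv W K X D CP by unfold_locales (rule X)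
    have XsL: "Xs = L.Xs" and okL: "okst = L.okst" unfolding Xs_def okst_def by simp_all
    have s1: "1 \<le> comp_bound m D n" by (rule comp_bound_pos[OF m1 D1])
    have CP: "good (L.Xs st) (fst st) (CP st) \<and> card (cB (CP st)) \<le> comp_bound m D n" if ok: "L.okst st" for st
    proof (cases "L.Xs st = {fst st}")
      case True
      have "fst st \<in> A" using ok X by (auto simp: L.okst_def)
      then show ?thesis using good_trivial True s1 by (simp add: CP_def XsL triv_sel)
    next
      case False
      obtain b q where st: "st = (b, q)" by fastforce
      have bX: "b \<in> X" using ok st by (simp add: L.okst_def)
      obtain h q' where q: "q = h # q'" using False st by (cases q) (auto simp: L.Xs_def)
      have h: "h \<in> J" "\<not> tot X h" using ok st q by (auto simp: L.okst_def L.NT_def)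
      note tr = transD[OF trans_r[OF h(1)]]
      have Xst: "L.Xs st = insert b {x \<in> X. (b, x) \<in> r h \<and> (x, b) \<in> r h}"
        using st q by (simp add: L.Xs_def L.cl_def)
      then obtain x where "(b, x) \<in> r h" "(x, b) \<in> r h" using False st by auto
      then have bb: "(b, b) \<in> r h" using tr by blast
      have "tot (L.Xs st) h" unfolding tot_def Xst using bb tr by blast
      moreover have sub: "L.Xs st \<subseteq> X" unfolding Xst using bX by auto
      moreover have "tot (L.Xs st) j" if "tot X j" for j using that sub unfolding tot_def by blast
      ultimately have "{j \<in> J. \<not> tot (L.Xs st) j} \<subset> {j \<in> J. \<not> tot X j}" using h by blast
      moreover have "fst st \<in> L.Xs st" using Xst st by simp
      ultimately have "\<exists>C. good (L.Xs st) (fst st) C \<and> card (cB C) \<le> comp_bound m D n" using IH sub by blast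
      from someI_ex[OF this] show ?thesis using False by (simp add: CP_def XsL)
    qed
    interpret L': component_tree A r I J iv W K X D CP
    proof unfold_locales
      show "good (L.Xs st) (fst st) (CP st)" if "L.okst st" for st using CP[OF that] by blast
      show "CP st = triv (fst st)" if "L.Xs st = {fst st}" for st using that by (simp add: CP_def XsL)
    qed
    have "L'.P \<le> card J * (M + 1)"
      unfolding L'.P_def using card_mono[OF finJ L'.NTJ] by (rule mult_le_mono1)
    then have "(2 * (2 * L'.P + 4) + 1) * (K + 3) \<le> (2 * (2 * (card J * (M + 1)) + 4) + 1) * (K + 3)"
      by (intro mult_le_mono1) simp
    then have big: "(2 * (2 * L'.P + 4) + 1) * (K + 3) \<le> D" using D by (rule order_trans)
    interpret L2: folded_tree A r I J iv W K X D CP a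
      by unfold_locales (rule a, rule big)
    have "1 \<le> comp_bound m D n * m" using s1 m1 by (metis mult_le_mono nat_mult_1)
    from L2.BB_card[OF _ m this] CP
    have "finite L2.BB \<and> card L2.BB \<le> comp_bound m D (Suc n)" by simp
    then show ?thesis using L2.good_CB L2.CB_sel by auto
  qed
  {
    case 0
    have e: "{j \<in> J. \<not> tot X j} = {}" using 0 finJ by simp
    show ?case by (rule main[OF 0(1,2)]) (simp only: e not_psubset_empty)
  next
    case (Suc n)
    show ?case
    proof (rule main[OF Suc.prems(1,2)])
      fix Y b assume Y: "Y \<subseteq> X" "b \<in> Y" "{j \<in> J. \<not> tot Y j} \<subset> {j \<in> J. \<not> tot X j}"
      have "card {j \<in> J. \<not> tot Y j} < card {j \<in> J. \<not> tot X j}"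
        using finJ by (intro psubset_card_mono[OF _ Y(3)]) simp
      then show "\<exists>C. good Y b C \<and> card (cB C) \<le> comp_bound m D (Suc n)"
        using Suc.IH[of Y b] Y Suc.prems by auto
    qed
  }
qed

end

section \<open>Size bounds\<close>

context bag_structure
begin

definition pat :: "(nat \<Rightarrow> 'a) \<Rightarrow> ('i \<times> nat \<times> nat) set" where
  "pat f = {(i, x, y). i \<in> I \<and> x \<le> K \<and> y \<le> K \<and> (f x, f y) \<in> r i}"
definition Pat :: "'a \<Rightarrow> ('i \<times> nat \<times> nat) set set" where
  "Pat s = {pat f | f. f 0 = s \<and> f ` {..K} \<subseteq> A}"

text \<open>Enumerating \<open>Y\<close> with \<open>t\<close> at position \<open>0\<close>, and
  repeating \<open>t\<close> at spare positions, turns \<open>Y\<close> into a tuple. A tuple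
  starting at \<open>s\<close> with the same pattern provides the map.\<close>

lemma Pat_covers:
  assumes "Pat t \<subseteq> Pat s" shows "covers s t"
  unfolding covers_def
proof (intro allI impI)
  fix Y assume Y: "Y \<subseteq> A" "card Y \<le> K + 1" "t \<in> Y"
  have finY: "finite Y" using Y(1) finA finite_subset by blast
  let ?Z = "Y - {t}"
  have cZ: "card ?Z \<le> K" using Y finY by simp
  obtain b where b: "bij_betw b {0..<card ?Z} ?Z" using ex_bij_betw_nat_finite[of ?Z] finY by auto
  define f where "f n = (if n = 0 then t else if n \<le> card ?Z then b (n - 1) else t)" for n
  have f0: "f 0 = t" by (simp add: f_def)
  have fY: "f ` {..K} \<subseteq> Y"
  proof
    fix y assume "y \<in> f ` {..K}"
    then obtain n where "y = f n" by auto
    moreover have "b (n - 1) \<in> ?Z" if "n \<noteq> 0" "n \<le> card ?Z"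
      using bij_betwE[OF b] that by auto
    ultimately show "y \<in> Y" using Y(3) unfolding f_def by auto
  qed
  have ex: "\<exists>n\<le>K. f n = y" if "y \<in> Y" "y \<noteq> t" for y
  proof -
    have "y \<in> b ` {0..<card ?Z}" using b that unfolding bij_betw_def by blast
    then obtain k where "k < card ?Z" "y = b k" by auto
    then show ?thesis using cZ by (intro exI[of _ "Suc k"]) (auto simp: f_def)
  qed
  define ix where "ix y = (if y = t then 0 else (SOME n. n \<le> K \<and> f n = y))" for y
  have ix: "ix y \<le> K \<and> f (ix y) = y" if "y \<in> Y" for y
    using someI_ex[OF ex[OF that]] f0 unfolding ix_def by auto
  have "pat f \<in> Pat t" unfolding Pat_def mem_Collect_eq using f0 fY Y(1) by (intro exI[of _ f]) auto
  then have "pat f \<in> Pat s" using assms by (rule subsetD[rotated])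
  then obtain f' where f': "f' 0 = s" "f' ` {..K} \<subseteq> A" "pat f' = pat f" unfolding Pat_def by auto
  have "(f' (ix x), f' (ix y)) \<in> r i" if "i \<in> I" "x \<in> Y" "y \<in> Y" "(x, y) \<in> r i" for i x y
  proof -
    have "(i, ix x, ix y) \<in> pat f" using that ix[of x] ix[of y] unfolding pat_def by auto
    then have "(i, ix x, ix y) \<in> pat f'" unfolding f'(3) .
    then show ?thesis unfolding pat_def by auto
  qed
  moreover have "(f' \<circ> ix) ` Y \<subseteq> A" using f'(2) ix by auto
  moreover have "ix t = 0" by (simp add: ix_def)
  ultimately show "\<exists>e. e ` Y \<subseteq> A \<and> e t = s \<and> (\<forall>i\<in>I. \<forall>x\<in>Y. \<forall>y\<in>Y. (x, y) \<in> r i \<longrightarrow> (e x, e y) \<in> r i)"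
    using f'(1) by (intro exI[of _ "f' \<circ> ix"]) auto
qed

text \<open>The type of \<open>s\<close> is determined by \<open>Pat s\<close>, a set of subsets of
  \<open>I \<times> {..K} \<times> {..K}\<close>; this accounts for two exponentials.\<close>

lemma number_of_types_le: "M \<le> 2 ^ (2 ^ (card I * ((K + 1) * (K + 1))))"
proof -
  let ?T = "I \<times> {..K} \<times> {..K}"
  have finT: "finite ?T" using finI by simp
  have sub: "Pat ` A \<subseteq> Pow (Pow ?T)" unfolding Pat_def pat_def by auto
  have eq: "cls s = cls t" if "s \<in> A" "t \<in> A" "Pat s = Pat t" for s t
    using that Pat_covers[of t s] Pat_covers[of s t] cls_eq[OF that(1)] by (simp add: eqv_def)
  define g where "g p = cls (SOME s. s \<in> A \<and> Pat s = p)" for p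
  have "cls ` A \<subseteq> g ` (Pat ` A)"
  proof
    fix c assume "c \<in> cls ` A"
    then obtain s where s: "s \<in> A" "c = cls s" by auto
    let ?t = "SOME t. t \<in> A \<and> Pat t = Pat s"
    have "?t \<in> A \<and> Pat ?t = Pat s" using someI_ex[of "\<lambda>t. t \<in> A \<and> Pat t = Pat s"] s(1) by blast
    then have "c = g (Pat s)" unfolding g_def using eq s by metis
    then show "c \<in> g ` (Pat ` A)" using s(1) by blast
  qed
  then have "M \<le> card (Pat ` A)" unfolding M_def
    by (rule surj_card_le[rotated]) (use finA in simp)
  also have "\<dots> \<le> card (Pow (Pow ?T))" using finT by (intro card_mono[OF _ sub]) simp
  also have "\<dots> = 2 ^ (2 ^ (card I * ((K + 1) * (K + 1))))"
    using finT by (simp add: card_Pow card_cartesian_product)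
  finally show ?thesis .
qed

text \<open>One level multiplies the exponent by at most \<open>2 ^ d * (2 * \<mu> + 6)\<close>: two
  \<open>D\<close>-th powers come from the two remembered blocks, the remaining factors contribute
  summands only.\<close>

lemma comp_bound_le:
  assumes M: "M + 1 \<le> 2 ^ E" and D: "D \<le> 2 ^ d" "D \<ge> 1" and m: "m \<le> 2 ^ \<mu>" "m \<ge> 1" and Ed: "E \<le> d"
  shows "comp_bound m D k \<le> 2 ^ (((2 ^ d) * (2 * \<mu> + 6)) ^ k)"
proof -
  define T where "T = (2 :: nat) ^ d"
  define G where "G = T * (2 * \<mu> + 6)"
  have Td: "d \<le> T" "1 \<le> T" unfolding T_def by (auto simp: less_imp_le)
  \<comment> \<open>The bound on \<open>e + 1\<close> instead of \<open>e\<close> lets the factor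
    \<open>G\<close> absorb all summands.\<close>
  have "\<exists>e. comp_bound m D k \<le> 2 ^ e \<and> e + 1 \<le> G ^ k"
  proof (induction k)
    case 0
    show ?case by (intro exI[of _ 0]) simp
  next
    case (Suc k)
    then obtain e where e: "comp_bound m D k \<le> 2 ^ e" "e + 1 \<le> G ^ k" by blast
    let ?s = "comp_bound m D k"
    have "?s * m \<le> 2 ^ (e + \<mu>)" using mult_le_mono[OF e(1) m(1)] by (simp add: power_add)
    then have "(?s * m) ^ D \<le> (2 ^ (e + \<mu>)) ^ D" by (rule power_mono) simp
    then have q: "(?s * m) ^ D \<le> 2 ^ ((e + \<mu>) * D)" by (simp add: power_mult)
    have q1: "1 + (?s * m) ^ D \<le> 2 ^ ((e + \<mu>) * D + 1)"
    proof -
      have "(1::nat) \<le> 2 ^ ((e + \<mu>) * D)" by simp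
      from add_le_mono[OF this q] show ?thesis by (simp only: power_add power_one_right mult_2_right)
    qed
    have "comp_bound m D (Suc k) \<le> 2 ^ E * (2 ^ ((e + \<mu>) * D + 1) * (2 ^ d * (2 ^ ((e + \<mu>) * D) * 2 ^ e)))"
      unfolding comp_bound.simps by (intro mult_le_mono M q1 D q e)
    also have "\<dots> = 2 ^ (E + (((e + \<mu>) * D + 1) + (d + ((e + \<mu>) * D + e))))"
      by (simp only: power_add)
    finally have A: "comp_bound m D (Suc k) \<le> 2 ^ (E + (((e + \<mu>) * D + 1) + (d + ((e + \<mu>) * D + e))))" .
    have "(e + \<mu>) * D \<le> (e + \<mu>) * T" using D(1) unfolding T_def by (rule mult_le_mono2)
    moreover have "e \<le> e * T" using Td(2) by simp
    ultimately have "E + (((e + \<mu>) * D + 1) + (d + ((e + \<mu>) * D + e))) + 1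
        \<le> T + (((e + \<mu>) * T + T) + (T + ((e + \<mu>) * T + e * T))) + T"
      using Ed Td by linarith
    also have "\<dots> = T * (3 * e + 2 * \<mu> + 4)" by (simp add: algebra_simps)
    also have "\<dots> \<le> T * ((2 * \<mu> + 6) * (e + 1))" by (intro mult_le_mono2) (simp add: algebra_simps)
    also have "\<dots> = G * (e + 1)" unfolding G_def by (simp only: mult.assoc)
    also have "\<dots> \<le> G ^ Suc k" unfolding power_Suc using e(2) by (rule mult_le_mono2)
    finally show ?case using A by blast
  qed
  then obtain e where e: "comp_bound m D k \<le> 2 ^ e" "e + 1 \<le> G ^ k" by blast
  have "(2::nat) ^ e \<le> 2 ^ (G ^ k)" using e(2) by (intro power_increasing) auto
  then show ?thesis using e(1) unfolding G_def T_def by linarith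
qed

end

section \<open>From formulas to structures and back\<close>

primrec subs :: "form \<Rightarrow> form set" where
  "subs (Atom B xs) = {Atom B xs}"
| "subs (Eq x y) = {Eq x y}"
| "subs (Conj \<phi> \<psi>) = insert (Conj \<phi> \<psi>) (subs \<phi> \<union> subs \<psi>)"
| "subs (Disj \<phi> \<psi>) = insert (Disj \<phi> \<psi>) (subs \<phi> \<union> subs \<psi>)"
| "subs (Ex x \<phi>) = insert (Ex x \<phi>) (subs \<phi>)"
| "subs (Neg \<phi>) = insert (Neg \<phi>) (subs \<phi>)"

primrec syms :: "form \<Rightarrow> rel_symbol set" where
  "syms (Atom B xs) = {B}"
| "syms (Eq x y) = {}"
| "syms (Conj \<phi> \<psi>) = syms \<phi> \<union> syms \<psi>"
| "syms (Disj \<phi> \<psi>) = syms \<phi> \<union> syms \<psi>"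
| "syms (Ex x \<phi>) = syms \<phi>"
| "syms (Neg \<phi>) = syms \<phi>"

lemma subs_self: "\<phi> \<in> subs \<phi>" by (cases \<phi>) auto
lemma subs_finite: "finite (subs \<phi>)" by (induction \<phi>) auto
lemma subs_card: "card (subs \<phi>) \<le> form_length \<phi>"
proof (induction \<phi>)
  case (Conj \<phi> \<psi>)
  have "card (insert (Conj \<phi> \<psi>) (subs \<phi> \<union> subs \<psi>)) \<le> Suc (card (subs \<phi> \<union> subs \<psi>))" by (rule card_insert_le_m1) auto
  then show ?case using Conj card_Un_le[of "subs \<phi>" "subs \<psi>"] by simp
next
  case (Disj \<phi> \<psi>)
  have "card (insert (Disj \<phi> \<psi>) (subs \<phi> \<union> subs \<psi>)) \<le> Suc (card (subs \<phi> \<union> subs \<psi>))" by (rule card_insert_le_m1) auto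
  then show ?case using Disj card_Un_le[of "subs \<phi>" "subs \<psi>"] by simp
qed (auto simp: card_insert_if subs_finite)
lemma subs_trans: "\<psi> \<in> subs \<phi> \<Longrightarrow> subs \<psi> \<subseteq> subs \<phi>" by (induction \<phi>) auto
lemma subs_length: "\<psi> \<in> subs \<phi> \<Longrightarrow> form_length \<psi> \<le> form_length \<phi>" by (induction \<phi>) auto
lemma subs_unfo: "\<psi> \<in> subs \<phi> \<Longrightarrow> unfo \<sigma> \<phi> \<Longrightarrow> unfo \<sigma> \<psi>"
proof (induction \<phi>)
  case (Neg \<phi>) then show ?case by (cases "\<psi> = Neg \<phi>") simp_all
qed auto
lemma subs_syms: "\<psi> \<in> subs \<phi> \<Longrightarrow> syms \<psi> \<subseteq> syms \<phi>" by (induction \<phi>) auto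
lemma syms_finite: "finite (syms \<phi>)" by (induction \<phi>) auto
lemma syms_card: "card (syms \<phi>) \<le> form_length \<phi>"
proof (induction \<phi>)
  case (Conj \<phi> \<psi>) then show ?case using card_Un_le[of "syms \<phi>" "syms \<psi>"] by simp
next
  case (Disj \<phi> \<psi>) then show ?case using card_Un_le[of "syms \<phi>" "syms \<psi>"] by simp
qed auto
lemma syms_arity: "B \<in> syms \<phi> \<Longrightarrow> unfo \<sigma> \<phi> \<Longrightarrow> \<exists>k. arity \<sigma> B = Some k \<and> k < form_length \<phi>"
  by (induction \<phi>) fastforce+
lemma fv_finite: "finite (fv \<phi>)" by (induction \<phi>) auto
lemma fv_card: "card (fv \<phi>) \<le> form_length \<phi>"
proof (induction \<phi>)
  case (Atom B xs) then show ?case using card_length[of xs] by simp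
next
  case (Eq x y) then show ?case by (simp add: card_insert_if)
next
  case (Conj \<phi> \<psi>) then show ?case using card_Un_le[of "fv \<phi>" "fv \<psi>"] by simp
next
  case (Disj \<phi> \<psi>) then show ?case using card_Un_le[of "fv \<phi>" "fv \<psi>"] by simp
next
  case (Ex x \<phi>) then show ?case using card_Diff1_le[of "fv \<phi>" x] by simp
qed auto
lemma form_length_pos: "1 \<le> form_length \<phi>" by (cases \<phi>) auto

lemma sat_cong: "(\<And>x. x \<in> fv \<phi> \<Longrightarrow> v x = v' x) \<Longrightarrow> sat M v \<phi> = sat M v' \<phi>"
proof (induction \<phi> arbitrary: v v')
  case (Atom B xs)
  then have "map v xs = map v' xs" by simp
  then show ?case unfolding sat.simps by (simp only:)
next
  case (Conj \<phi> \<psi>)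
  then show ?case by (metis UnI1 UnI2 fv.simps(3) sat.simps(3))
next
  case (Disj \<phi> \<psi>)
  then show ?case by (metis UnI1 UnI2 fv.simps(4) sat.simps(4))
next
  case (Ex x \<phi>)
  have "sat M (v(x := a)) \<phi> = sat M (v'(x := a)) \<phi>" for a
    by (rule Ex.IH) (use Ex.prems in auto)
  then show ?case by simp
next
  case (Neg \<phi>)
  then show ?case by (metis fv.simps(6) sat.simps(6))
qed auto

section \<open>Certificates for the truth of a formula\<close>

definition certifies :: "'b struct \<Rightarrow> (nat \<Rightarrow> 'b) \<Rightarrow> form \<Rightarrow> 'b set \<Rightarrow> (rel_symbol \<times> 'b list) set \<Rightarrow> 'c struct \<Rightarrow> bool" where
  "certifies M v \<psi> D F M' \<longleftrightarrow> (\<forall>h v'. h ` D \<subseteq> universe M' \<longrightarrow> (\<forall>x\<in>fv \<psi>. v' x = h (v x)) \<longrightarrow>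
     (\<forall>B as. (B, as) \<in> F \<longrightarrow> map h as \<in> interp M' B) \<longrightarrow>
     (\<forall>\<chi> d. Neg \<chi> \<in> subs \<psi> \<longrightarrow> d \<in> D \<longrightarrow> \<not> sat M (\<lambda>_. d) \<chi> \<longrightarrow> \<not> sat M' (\<lambda>_. h d) \<chi>) \<longrightarrow> sat M' v' \<psi>)"

definition cert :: "'b struct \<Rightarrow> (nat \<Rightarrow> 'b) \<Rightarrow> form \<Rightarrow> 'b set \<Rightarrow> (rel_symbol \<times> 'b list) set \<Rightarrow> bool" where
  "cert M v \<psi> D F \<longleftrightarrow> finite D \<and> D \<subseteq> universe M \<and> card D \<le> form_length \<psi> \<and> finite F \<and> card F \<le> form_length \<psi> \<and>
     (\<forall>B as. (B, as) \<in> F \<longrightarrow> as \<in> interp M B \<and> set as \<subseteq> D \<and> B \<in> syms \<psi>)"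

text \<open>Existential quantifiers contribute elements, atoms contribute facts, and a negation
  contributes a single point because it has at most one free variable. The target type
  \<open>'c\<close> is left open since certificates are transferred in both directions.\<close>

lemma cert_ex:
  assumes "sat M v \<psi>" "range v \<subseteq> universe M" "unfo \<sigma> \<psi>"
  shows "\<exists>D F. cert M v \<psi> D F \<and> (\<forall>M' :: 'c struct. certifies M v \<psi> D F M')"
  using assms
proof (induction \<psi> arbitrary: v)
  case (Atom B xs)
  let ?D = "set (map v xs)" and ?F = "{(B, map v xs)}"
  have "card ?D \<le> length xs" using card_length[of "map v xs"] by simp
  then have "cert M v (Atom B xs) ?D ?F" using Atom unfolding cert_def by auto
  moreover have "certifies M v (Atom B xs) ?D ?F M'" for M' :: "'c struct"
    unfolding certifies_def
  proof (intro allI impI)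
    fix h v' assume v': "\<forall>x\<in>fv (Atom B xs). v' x = h (v x)"
      and F: "\<forall>B' as. (B', as) \<in> ?F \<longrightarrow> map h as \<in> interp M' B'"
    have "map h (map v xs) = map v' xs" using v' by simp
    then show "sat M' v' (Atom B xs)" using F by (metis insertI1 sat.simps(1))
  qed
  ultimately show ?case by blast
next
  case (Eq x y)
  have "card {v x, v y} \<le> 3" by (simp add: card_insert_if)
  then have "cert M v (Eq x y) {v x, v y} {}" using Eq unfolding cert_def by auto
  moreover have "certifies M v (Eq x y) {v x, v y} {} M'" for M' :: "'c struct"
    using Eq unfolding certifies_def by auto
  ultimately show ?case by blast
next
  case (Conj \<phi> \<psi>)
  obtain D F where 1: "cert M v \<phi> D F" "\<And>M' :: 'c struct. certifies M v \<phi> D F M'" using Conj.IH(1)[of v] Conj.prems by fastforce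
  obtain D' F' where 2: "cert M v \<psi> D' F'" "\<And>M' :: 'c struct. certifies M v \<psi> D' F' M'" using Conj.IH(2)[of v] Conj.prems by fastforce
  have "cert M v (Conj \<phi> \<psi>) (D \<union> D') (F \<union> F')"
    using 1(1) 2(1) card_Un_le[of D D'] card_Un_le[of F F'] unfolding cert_def by fastforce
  moreover have "certifies M v (Conj \<phi> \<psi>) (D \<union> D') (F \<union> F') M'" for M' :: "'c struct"
    unfolding certifies_def
  proof (intro allI impI)
    fix h v' assume a: "h ` (D \<union> D') \<subseteq> universe M'" "\<forall>x\<in>fv (Conj \<phi> \<psi>). v' x = h (v x)"
      "\<forall>B as. (B, as) \<in> F \<union> F' \<longrightarrow> map h as \<in> interp M' B"
      "\<forall>\<chi> d. Neg \<chi> \<in> subs (Conj \<phi> \<psi>) \<longrightarrow> d \<in> D \<union> D' \<longrightarrow> \<not> sat M (\<lambda>_. d) \<chi> \<longrightarrow> \<not> sat M' (\<lambda>_. h d) \<chi>"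
    have "sat M' v' \<phi>" using 1(2)[of M'] a unfolding certifies_def by (elim allE[of _ h] allE[of _ v']) auto
    moreover have "sat M' v' \<psi>" using 2(2)[of M'] a unfolding certifies_def by (elim allE[of _ h] allE[of _ v']) auto
    ultimately show "sat M' v' (Conj \<phi> \<psi>)" by simp
  qed
  ultimately show ?case by blast
next
  case (Disj \<phi> \<psi>)
  then consider "sat M v \<phi>" | "sat M v \<psi>" by auto
  then show ?case
  proof cases
    case 1
    then obtain D F where 1: "cert M v \<phi> D F" "\<And>M' :: 'c struct. certifies M v \<phi> D F M'" using Disj.IH(1)[of v] Disj.prems by fastforce
    have "cert M v (Disj \<phi> \<psi>) D F" using 1(1) unfolding cert_def by auto
    moreover have "certifies M v (Disj \<phi> \<psi>) D F M'" for M' :: "'c struct" using 1(2)[of M'] unfolding certifies_def by simp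
    ultimately show ?thesis by blast
  next
    case 2
    then obtain D F where 1: "cert M v \<psi> D F" "\<And>M' :: 'c struct. certifies M v \<psi> D F M'" using Disj.IH(2)[of v] Disj.prems by fastforce
    have "cert M v (Disj \<phi> \<psi>) D F" using 1(1) unfolding cert_def by auto
    moreover have "certifies M v (Disj \<phi> \<psi>) D F M'" for M' :: "'c struct" using 1(2)[of M'] unfolding certifies_def by simp
    ultimately show ?thesis by blast
  qed
next
  case (Ex x \<phi>)
  obtain a where a: "a \<in> universe M" "sat M (v(x := a)) \<phi>" using Ex.prems by auto
  have "range (v(x := a)) \<subseteq> universe M" using Ex.prems a by auto
  then obtain D F where 1: "cert M (v(x := a)) \<phi> D F" "\<And>M' :: 'c struct. certifies M (v(x := a)) \<phi> D F M'"
    using Ex.IH[of "v(x := a)"] Ex.prems a by fastforce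
  have "card (insert a D) \<le> form_length (Ex x \<phi>)" using 1(1) unfolding cert_def by (simp add: card_insert_if)
  then have "cert M v (Ex x \<phi>) (insert a D) F" using 1(1) a unfolding cert_def by auto
  moreover have "certifies M v (Ex x \<phi>) (insert a D) F M'" for M' :: "'c struct"
    unfolding certifies_def
  proof (intro allI impI)
    fix h v' assume b: "h ` (insert a D) \<subseteq> universe M'" "\<forall>y\<in>fv (Ex x \<phi>). v' y = h (v y)"
      "\<forall>B as. (B, as) \<in> F \<longrightarrow> map h as \<in> interp M' B"
      "\<forall>\<chi> d. Neg \<chi> \<in> subs (Ex x \<phi>) \<longrightarrow> d \<in> insert a D \<longrightarrow> \<not> sat M (\<lambda>_. d) \<chi> \<longrightarrow> \<not> sat M' (\<lambda>_. h d) \<chi>"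
    have "sat M' (v'(x := h a)) \<phi>"
      using 1(2)[of M'] b unfolding certifies_def by (elim allE[of _ h] allE[of _ "v'(x := h a)"]) auto
    then show "sat M' v' (Ex x \<phi>)" using b(1) by auto
  qed
  ultimately show ?case by blast
next
  case (Neg \<chi>)
  obtain x where x: "fv \<chi> \<subseteq> {x}" using Neg.prems by auto
  have "cert M v (Neg \<chi>) {v x} {}" using Neg.prems form_length_pos[of \<chi>] unfolding cert_def by auto
  moreover have "certifies M v (Neg \<chi>) {v x} {} M'" for M' :: "'c struct"
    unfolding certifies_def
  proof (intro allI impI)
    fix h v' assume v': "\<forall>y\<in>fv (Neg \<chi>). v' y = h (v y)"
      and n: "\<forall>\<chi>' d. Neg \<chi>' \<in> subs (Neg \<chi>) \<longrightarrow> d \<in> {v x} \<longrightarrow> \<not> sat M (\<lambda>_. d) \<chi>' \<longrightarrow> \<not> sat M' (\<lambda>_. h d) \<chi>'"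
    have "sat M v \<chi> = sat M (\<lambda>_. v x) \<chi>" using x by (intro sat_cong) auto
    moreover have "sat M' v' \<chi> = sat M' (\<lambda>_. h (v x)) \<chi>" using x v' by (intro sat_cong) auto
    ultimately show "sat M' v' (Neg \<chi>)" using n Neg.prems(1) by simp
  qed
  ultimately show ?case by blast
qed

lemma sat_foldr_Ex:
  "sat M v \<phi> \<Longrightarrow> range v \<subseteq> universe M \<Longrightarrow> sat M v (foldr Ex vs \<phi>)"
proof (induction vs)
  case (Cons x vs)
  then have "sat M (v(x := v x)) (foldr Ex vs \<phi>)" by simp
  moreover have "v x \<in> universe M" using Cons.prems(2) by auto
  ultimately show ?case unfolding foldr.simps comp_apply sat.simps by (rule bexI)
qed simp

lemma foldr_Ex_sat:
  "sat M v (foldr Ex vs \<phi>) \<Longrightarrow> range v \<subseteq> universe M \<Longrightarrow> \<exists>v'. range v' \<subseteq> universe M \<and> sat M v' \<phi>"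
proof (induction vs arbitrary: v)
  case (Cons x vs)
  then obtain a where "a \<in> universe M" "sat M (v(x := a)) (foldr Ex vs \<phi>)" by auto
  moreover have "range (v(x := a)) \<subseteq> universe M" using Cons.prems(2) calculation(1) by auto
  ultimately show ?case using Cons.IH by blast
qed auto

lemma foldr_Ex:
  "fv (foldr Ex vs \<phi>) = fv \<phi> - set vs" "unfo \<sigma> (foldr Ex vs \<phi>) = unfo \<sigma> \<phi>"
  "form_length (foldr Ex vs \<phi>) = form_length \<phi> + 2 * length vs"
  by (induction vs) auto

text \<open>Facts over base symbols become elements, linked to their arguments by \<open>EE\<close>; loops of \<open>PC\<close> and
  \<open>NC\<close> record the truth values of unary subformulas, so that homomorphisms preserve them.\<close>

datatype ix = TT nat | EE nat | SY rel_symbol | PC form | NC form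

section \<open>The given model as a structure with bags\<close>

definition mate :: "nat \<Rightarrow> nat" where "mate u = (if odd u then u + 1 else u - 1)"

type_synonym fel = "nat + rel_symbol \<times> nat list"

locale closed_model =
  fixes \<sigma> :: signature and \<Phi> :: form and M0 :: "nat struct"
  assumes unfo: "unfo \<sigma> \<Phi>" and closed: "fv \<Phi> = {}" and adm: "admissible \<sigma> M0"
    and finU: "finite (universe M0)"
begin

abbreviation "U \<equiv> universe M0"
abbreviation "n \<equiv> form_length \<Phi>"

text \<open>Members of \<open>Cl\<close> have at most one free variable; they are evaluated under constant assignments.\<close>

definition Cl :: "form set" where "Cl = insert \<Phi> {\<psi>. Neg \<psi> \<in> subs \<Phi>}"
text \<open>\<open>num_pairs \<sigma>\<close> is not bounded by the length of \<open>\<Phi>\<close>,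
  so only pairs with a member in \<open>\<Phi>\<close> are kept, and whole pairs so that
  \<open>mate\<close> stays inside.\<close>

definition US :: "nat set" where
  "US = {u. 1 \<le> u \<and> u \<le> 2 * num_pairs \<sigma> \<and> (\<exists>t. T t \<in> syms \<Phi> \<and> (t + 1) div 2 = (u + 1) div 2)}"
definition FA :: "(rel_symbol \<times> nat list) set" where
  "FA = {(B, as). B \<in> syms \<Phi> \<and> (\<exists>b. B = Base b) \<and> as \<in> interp M0 B}"
definition AA :: "fel set" where "AA = Inl ` U \<union> Inr ` FA"

text \<open>A homomorphism preserves the presence of a loop but not its absence; therefore both
  truth values of a formula get a loop of their own.\<close>

fun rr :: "ix \<Rightarrow> fel rel" where
  "rr (TT u) = {(Inl a, Inl b) | a b. a \<in> U \<and> b \<in> U \<and> [a, b] \<in> interp M0 (T u)}"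
| "rr (EE k) = {(Inr (B, as), Inl (as ! k)) | B as. (B, as) \<in> FA \<and> k < length as}"
| "rr (SY B) = {(Inr (B, as), Inr (B, as)) | as. (B, as) \<in> FA}"
| "rr (PC \<psi>) = {(Inl a, Inl a) | a. a \<in> U \<and> sat M0 (\<lambda>_. a) \<psi>}"
| "rr (NC \<psi>) = {(Inl a, Inl a) | a. a \<in> U \<and> \<not> sat M0 (\<lambda>_. a) \<psi>}"

definition JJ :: "ix set" where "JJ = TT ` US"
definition II :: "ix set" where
  "II = JJ \<union> EE ` {..<n} \<union> SY ` syms \<Phi> \<union> PC ` Cl \<union> NC ` Cl"
fun ivv :: "ix \<Rightarrow> ix" where "ivv (TT u) = TT (mate u)" | "ivv i = i"

definition DF :: "nat \<Rightarrow> form \<Rightarrow> nat set \<times> (rel_symbol \<times> nat list) set" where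
  "DF a \<psi> = (SOME p. cert M0 (\<lambda>_. a) \<psi> (fst p) (snd p) \<and>
     (\<forall>M' :: fel el struct. certifies M0 (\<lambda>_. a) \<psi> (fst p) (snd p) M'))"
text \<open>The bag of an element holds certificates for all formulas of \<open>Cl\<close> that are
  true there. Facts over distinguished symbols are dropped by \<open>FA\<close>; they remain
  edges.\<close>

definition WW :: "fel \<Rightarrow> fel set" where
  "WW x = (case x of Inr f \<Rightarrow> {x}
     | Inl a \<Rightarrow> insert x (\<Union>\<psi>\<in>{\<psi> \<in> Cl. sat M0 (\<lambda>_. a) \<psi>}. Inl ` fst (DF a \<psi>) \<union> Inr ` (snd (DF a \<psi>) \<inter> FA)))"

lemma Cl_prop:
  assumes "\<psi> \<in> Cl"
  shows "unfo \<sigma> \<psi>" "form_length \<psi> \<le> n" "syms \<psi> \<subseteq> syms \<Phi>" "\<And>\<chi>. Neg \<chi> \<in> subs \<psi> \<Longrightarrow> \<chi> \<in> Cl \<and> form_length \<chi> < form_length \<psi>"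
proof -
  have sub: "\<psi> \<in> subs \<Phi>"
    using assms subs_self[of \<Phi>] subs_trans[of "Neg \<psi>" \<Phi>] subs_self[of \<psi>] unfolding Cl_def by auto
  show "unfo \<sigma> \<psi>" using subs_unfo[OF sub unfo] .
  show "form_length \<psi> \<le> n" using subs_length[OF sub] .
  show "syms \<psi> \<subseteq> syms \<Phi>" using subs_syms[OF sub] .
  show "\<chi> \<in> Cl \<and> form_length \<chi> < form_length \<psi>" if "Neg \<chi> \<in> subs \<psi>" for \<chi>
    using that subs_trans[OF sub] subs_length[OF that] unfolding Cl_def by auto
qed

lemma Cl_fin: "finite Cl" "card Cl \<le> n + 1"
proof -
  have "inj_on Neg {\<psi>. Neg \<psi> \<in> subs \<Phi>}" by (auto simp: inj_on_def)
  moreover have s: "Neg ` {\<psi>. Neg \<psi> \<in> subs \<Phi>} \<subseteq> subs \<Phi>" by auto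
  ultimately have f: "finite {\<psi>. Neg \<psi> \<in> subs \<Phi>}" and "card {\<psi>. Neg \<psi> \<in> subs \<Phi>} \<le> card (subs \<Phi>)"
    using subs_finite[of \<Phi>] by (auto intro: inj_on_finite card_inj_on_le)
  then show "finite Cl" "card Cl \<le> n + 1" unfolding Cl_def using subs_card[of \<Phi>] by (auto simp: card_insert_if)
qed

lemma structM0: "arity \<sigma> B = Some k \<Longrightarrow> as \<in> interp M0 B \<Longrightarrow> length as = k \<and> set as \<subseteq> U"
  using adm unfolding admissible_def is_struct_def by blast

lemma FA_prop:
  assumes "(B, as) \<in> FA"
  shows "arity \<sigma> B = Some (length as)" "length as < n" "set as \<subseteq> U" "as \<in> interp M0 B" "B \<in> syms \<Phi>"
proof -
  have B: "B \<in> syms \<Phi>" "as \<in> interp M0 B" using assms by (auto simp: FA_def)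
  then obtain k where "arity \<sigma> B = Some k" "k < n" using syms_arity[OF B(1) unfo] by blast
  then show "arity \<sigma> B = Some (length as)" "length as < n" "set as \<subseteq> U" "as \<in> interp M0 B" "B \<in> syms \<Phi>"
    using structM0[OF _ B(2)] B by auto
qed

lemma finAA: "finite AA"
proof -
  have "FA \<subseteq> (syms \<Phi>) \<times> {as. set as \<subseteq> U \<and> length as \<le> n}"
  proof (rule subrelI)
    fix B as assume "(B, as) \<in> FA"
    from FA_prop[OF this] show "(B, as) \<in> syms \<Phi> \<times> {as. set as \<subseteq> U \<and> length as \<le> n}" by simp
  qed
  then have "finite FA" using syms_finite finite_lists_length_le[OF finU] finite_subset by (meson finite_SigmaI)
  then show ?thesis using finU by (simp add: AA_def)
qed

lemma rr_A: "rr i \<subseteq> AA \<times> AA"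
  using subsetD[OF FA_prop(3) nth_mem] by (cases i) (auto simp: AA_def)

lemma US_fin: "finite US" "card US \<le> 2 * n"
proof -
  define P where "P = (\<lambda>t. (t + 1) div 2) ` {t. T t \<in> syms \<Phi>}"
  have inj: "inj_on T {t. T t \<in> syms \<Phi>}" by (auto simp: inj_on_def)
  have sub: "T ` {t. T t \<in> syms \<Phi>} \<subseteq> syms \<Phi>" by auto
  have fin: "finite {t. T t \<in> syms \<Phi>}" using inj_on_finite[OF inj sub syms_finite] .
  have "card {t. T t \<in> syms \<Phi>} \<le> n"
    using card_inj_on_le[OF inj sub syms_finite] syms_card[of \<Phi>] by linarith
  then have cP: "card P \<le> n" unfolding P_def using card_image_le[OF fin, of "\<lambda>t. (t + 1) div 2"] by linarith
  have US: "US \<subseteq> (\<Union>p\<in>P. {2 * p - 1, 2 * p})"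
  proof
    fix u assume "u \<in> US"
    then obtain t where t: "T t \<in> syms \<Phi>" "(t + 1) div 2 = (u + 1) div 2" unfolding US_def by auto
    have "u = 2 * ((u + 1) div 2) - 1 \<or> u = 2 * ((u + 1) div 2)" by presburger
    then show "u \<in> (\<Union>p\<in>P. {2 * p - 1, 2 * p})" using t unfolding P_def by force
  qed
  have finP: "finite P" unfolding P_def using fin by simp
  have fin2: "finite (\<Union>p\<in>P. {2 * p - 1, 2 * p})" by (intro finite_UN_I finP) simp
  then show "finite US" using US finite_subset by blast
  have "card US \<le> card (\<Union>p\<in>P. {2 * p - 1, 2 * p})" by (rule card_mono[OF fin2 US])
  also have "\<dots> \<le> (\<Sum>p\<in>P. card {2 * p - 1, 2 * p})" by (rule card_UN_le[OF finP])
  also have "\<dots> \<le> card P * 2" using sum_bounded_above[of P "\<lambda>p. card {2 * p - 1, 2 * p}" 2] by (simp add: card_insert_if)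
  finally show "card US \<le> 2 * n" using cP by simp
qed

lemma mate_bounds:
  fixes u p :: nat
  assumes "1 \<le> u" "u \<le> 2 * p"
  shows "1 \<le> mate u" "mate u \<le> 2 * p" "(mate u + 1) div 2 = (u + 1) div 2"
  using assms unfolding mate_def by (cases "odd u"; simp; presburger)+

lemma mate_US: "u \<in> US \<Longrightarrow> mate u \<in> US"
  unfolding US_def mem_Collect_eq using mate_bounds by metis

lemma rel_mate:
  assumes "u \<in> US" shows "dist_rel M0 (mate u) = (dist_rel M0 u)\<inverse>"
proof -
  have inv: "dist_rel M0 (2 * p) = (dist_rel M0 (2 * p - 1))\<inverse>" if "p \<in> {1..num_pairs \<sigma>}" for p
    using adm that by (simp add: admissible_def)
  show ?thesis
  proof (cases "odd u")
    case True
    then obtain k where u: "u = 2 * k + 1" by (elim oddE)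
    then have "k + 1 \<in> {1..num_pairs \<sigma>}" using assms by (auto simp: US_def)
    from inv[OF this] show ?thesis using u by (simp add: mate_def)
  next
    case False
    then obtain k where u: "u = 2 * k" by blast
    then have "k \<in> {1..num_pairs \<sigma>}" using assms by (auto simp: US_def)
    from inv[OF this] show ?thesis using u False by (simp add: mate_def)
  qed
qed

lemma DF:
  assumes "a \<in> U" "\<psi> \<in> Cl" "sat M0 (\<lambda>_. a) \<psi>"
  shows "cert M0 (\<lambda>_. a) \<psi> (fst (DF a \<psi>)) (snd (DF a \<psi>))"
    and "certifies M0 (\<lambda>_. a) \<psi> (fst (DF a \<psi>)) (snd (DF a \<psi>)) (M' :: fel el struct)"
proof -
  have "range (\<lambda>_ :: nat. a) \<subseteq> U" using assms(1) by auto
  from cert_ex[OF assms(3) this Cl_prop(1)[OF assms(2)], where 'c = "fel el"]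
  have "\<exists>p. cert M0 (\<lambda>_. a) \<psi> (fst p) (snd p) \<and> (\<forall>M' :: fel el struct. certifies M0 (\<lambda>_. a) \<psi> (fst p) (snd p) M')"
    by auto
  from someI_ex[OF this] show "cert M0 (\<lambda>_. a) \<psi> (fst (DF a \<psi>)) (snd (DF a \<psi>))"
    "certifies M0 (\<lambda>_. a) \<psi> (fst (DF a \<psi>)) (snd (DF a \<psi>)) (M' :: fel el struct)"
    unfolding DF_def by blast+
qed

lemma WW_self: "x \<in> WW x" by (auto simp: WW_def split: sum.splits)

lemma WW_A: assumes "x \<in> AA" shows "WW x \<subseteq> AA"
proof (cases x)
  case (Inr f) then show ?thesis using assms by (simp add: WW_def)
next
  case (Inl a)
  then have a: "a \<in> U" using assms by (auto simp: AA_def)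
  have "fst (DF a \<psi>) \<subseteq> U" if "\<psi> \<in> Cl" "sat M0 (\<lambda>_. a) \<psi>" for \<psi> using DF(1)[OF a that] by (simp add: cert_def)
  then show ?thesis using Inl assms by (auto simp: WW_def AA_def)
qed

lemma WW_card: assumes "x \<in> AA" shows "card (WW x) \<le> 1 + (n + 1) * (2 * n)"
proof (cases x)
  case (Inr f) then show ?thesis by (simp add: WW_def)
next
  case (Inl a)
  then have a: "a \<in> U" using assms by (auto simp: AA_def)
  let ?C = "{\<psi> \<in> Cl. sat M0 (\<lambda>_. a) \<psi>}"
  let ?f = "\<lambda>\<psi>. Inl ` fst (DF a \<psi>) \<union> Inr ` (snd (DF a \<psi>) \<inter> FA) :: fel set"
  have f: "card (?f \<psi>) \<le> 2 * n" if "\<psi> \<in> ?C" for \<psi>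
  proof -
    have c: "cert M0 (\<lambda>_. a) \<psi> (fst (DF a \<psi>)) (snd (DF a \<psi>))" using DF(1)[OF a] that by auto
    have fl: "form_length \<psi> \<le> n" using Cl_prop(2) that by auto
    have "card (Inl ` fst (DF a \<psi>) :: fel set) \<le> card (fst (DF a \<psi>))" using c by (intro card_image_le) (simp add: cert_def)
    moreover have "card (Inr ` (snd (DF a \<psi>) \<inter> FA) :: fel set) \<le> card (snd (DF a \<psi>) \<inter> FA)"
      using c by (intro card_image_le) (simp add: cert_def)
    moreover have "card (snd (DF a \<psi>) \<inter> FA) \<le> card (snd (DF a \<psi>))" using c by (intro card_mono) (auto simp: cert_def)
    moreover have "card (fst (DF a \<psi>)) \<le> form_length \<psi>" "card (snd (DF a \<psi>)) \<le> form_length \<psi>" using c by (auto simp: cert_def)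
    ultimately show ?thesis using card_Un_le[of "Inl ` fst (DF a \<psi>) :: fel set" "Inr ` (snd (DF a \<psi>) \<inter> FA)"] fl by linarith
  qed
  have finC: "finite ?C" using Cl_fin(1) by simp
  have "card (\<Union>\<psi>\<in>?C. ?f \<psi>) \<le> (\<Sum>\<psi>\<in>?C. card (?f \<psi>))" by (rule card_UN_le[OF finC])
  also have "\<dots> \<le> card ?C * (2 * n)" using sum_bounded_above[of ?C "\<lambda>\<psi>. card (?f \<psi>)" "2 * n"] f by simp
  also have "\<dots> \<le> (n + 1) * (2 * n)"
  proof (rule mult_le_mono1)
    have "card ?C \<le> card Cl" using Cl_fin(1) by (intro card_mono) auto
    then show "card ?C \<le> n + 1" using Cl_fin(2) by linarith
  qed
  finally have u: "card (\<Union>\<psi>\<in>?C. ?f \<psi>) \<le> (n + 1) * (2 * n)" .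
  have "WW x = insert x (\<Union>\<psi>\<in>?C. ?f \<psi>)" unfolding WW_def Inl by simp
  then have "card (WW x) \<le> Suc (card (\<Union>\<psi>\<in>?C. ?f \<psi>))" by (simp add: card_insert_le_m1)
  then show ?thesis using u by simp
qed

lemma bag_structure: "bag_structure AA rr II JJ ivv WW"
proof
  show "finite AA" by (rule finAA)
  show "finite II" unfolding II_def JJ_def using US_fin Cl_fin syms_finite by simp
  show "JJ \<subseteq> II" unfolding II_def by auto
  show "rr i \<subseteq> AA \<times> AA" for i by (rule rr_A)
  fix j assume "j \<in> JJ"
  then obtain u where j: "j = TT u" "u \<in> US" by (auto simp: JJ_def)
  have "trans (dist_rel M0 u)" using adm j by (auto simp: admissible_def US_def)
  then have "[a, c] \<in> interp M0 (T u)" if "[a, b] \<in> interp M0 (T u)" "[b, c] \<in> interp M0 (T u)" for a b c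
    using that unfolding dist_rel_def trans_def by blast
  then show "trans (rr j)" unfolding j trans_def by auto
  show "ivv j \<in> JJ" using j mate_US by (simp add: JJ_def)
  have "[a, b] \<in> interp M0 (T (mate u)) \<longleftrightarrow> [b, a] \<in> interp M0 (T u)" for a b
    using rel_mate[OF j(2)] unfolding dist_rel_def by auto
  then show "rr (ivv j) = (rr j)\<inverse>" unfolding j by auto
next
  show "a \<in> WW a" for a by (rule WW_self)
  show "WW a \<subseteq> AA" if "a \<in> AA" for a by (rule WW_A[OF that])
qed

end

section \<open>Decoding a component into a model\<close>

locale decoded_model = closed_model + bag_structure AA rr II JJ ivv WW "2 * form_length \<Phi>" +
  fixes C :: "(fel, ix) comp" and a0 :: nat
  assumes gd: "good AA (Inl a0) C" and a0: "a0 \<in> universe M0"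
begin

definition UT :: "fel el set" where "UT = {b \<in> cB C. cp C b \<in> Inl ` U}"
definition vl :: "fel el \<Rightarrow> nat" where "vl b = projl (cp C b)"
text \<open>A base fact is decoded only if one bag contains its element and all its arguments, so
  the whole fact with its links sits in one chart. Distinguished symbols outside \<open>US\<close>
  become empty.\<close>

fun itp :: "rel_symbol \<Rightarrow> fel el list set" where
  "itp (Base s) = {map (\<lambda>a. cg C c (Inl a)) as | c as. c \<in> cB C \<and> Inr (Base s, as) \<in> WW (cp C c) \<and> Inl ` set as \<subseteq> WW (cp C c)}"
| "itp (T u) = {[x, y] | x y. u \<in> US \<and> x \<in> UT \<and> y \<in> UT \<and> (Inl x, Inl y) \<in> cQ C (TT u)}"
definition MT :: "fel el struct" where "MT = \<lparr>universe = UT, interp = itp\<rparr>"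

lemma MT_sel: "universe MT = UT" "interp MT = itp" by (auto simp: MT_def)

lemma vl: "b \<in> UT \<Longrightarrow> cp C b = Inl (vl b) \<and> vl b \<in> U" by (auto simp: UT_def vl_def)

lemma colour_I: "\<psi> \<in> Cl \<Longrightarrow> PC \<psi> \<in> II \<and> NC \<psi> \<in> II" by (auto simp: II_def)
lemma Phi_Cl: "\<Phi> \<in> Cl" by (simp add: Cl_def)

text \<open>Every element has a loop for \<open>PC \<Phi>\<close> or \<open>NC \<Phi>\<close> and no
  fact has one, so types separate elements from facts. The other loops fix the truth of all formulas
  in \<open>Cl\<close>.\<close>

lemma eqv_elem:
  assumes "eqv x (Inl a)" "a \<in> U"
  shows "\<exists>b\<in>U. x = Inl b \<and> (\<forall>\<psi>\<in>Cl. sat M0 (\<lambda>_. b) \<psi> = sat M0 (\<lambda>_. a) \<psi>)"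
proof -
  have P: "(x, x) \<in> rr (PC \<psi>)" if "\<psi> \<in> Cl" "sat M0 (\<lambda>_. a) \<psi>" for \<psi>
    using eqv_loop[OF eqv_sym[OF assms(1)], of "PC \<psi>"] colour_I[OF that(1)] that assms(2) by simp
  have Q: "(x, x) \<in> rr (NC \<psi>)" if "\<psi> \<in> Cl" "\<not> sat M0 (\<lambda>_. a) \<psi>" for \<psi>
    using eqv_loop[OF eqv_sym[OF assms(1)], of "NC \<psi>"] colour_I[OF that(1)] that assms(2) by simp
  obtain b where b: "x = Inl b" "b \<in> U" using P[OF Phi_Cl] Q[OF Phi_Cl] by (cases "sat M0 (\<lambda>_. a) \<Phi>") auto
  have "sat M0 (\<lambda>_. b) \<psi> = sat M0 (\<lambda>_. a) \<psi>" if "\<psi> \<in> Cl" for \<psi>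
    using P[OF that] Q[OF that] b by (cases "sat M0 (\<lambda>_. a) \<psi>") auto
  then show ?thesis using b by blast
qed

lemma io_AA:
  assumes "c \<in> cB C" "x \<in> WW (cp C c)" shows "io AA C c x = Inl (cg C c x)"
proof -
  have "WW (cp C c) \<subseteq> AA" using goodD(4)[OF gd assms(1)] WW_A by blast
  then show ?thesis using assms(2) by (auto simp: io_def)
qed

lemma io_self: "c \<in> cB C \<Longrightarrow> io AA C c (cp C c) = Inl c"
  using io_center[OF gd order_refl] by blast

lemma cg_UT:
  assumes c: "c \<in> cB C" and a: "Inl a \<in> WW (cp C c)"
  shows "cg C c (Inl a) \<in> UT" "\<And>\<psi>. \<psi> \<in> Cl \<Longrightarrow> sat M0 (\<lambda>_. vl (cg C c (Inl a))) \<psi> = sat M0 (\<lambda>_. a) \<psi>"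
proof -
  have A: "Inl a \<in> AA" using a goodD(4)[OF gd c] WW_A by blast
  then have aU: "a \<in> U" by (auto simp: AA_def)
  have e: "eqv (cp C (cg C c (Inl a))) (Inl a)" "cg C c (Inl a) \<in> cB C"
    using goodD(5,6)[OF gd c a A] by auto
  obtain b where b: "b \<in> U" "cp C (cg C c (Inl a)) = Inl b" "\<forall>\<psi>\<in>Cl. sat M0 (\<lambda>_. b) \<psi> = sat M0 (\<lambda>_. a) \<psi>"
    using eqv_elem[OF e(1) aU] by blast
  show "cg C c (Inl a) \<in> UT" using e(2) b by (auto simp: UT_def)
  show "sat M0 (\<lambda>_. vl (cg C c (Inl a))) \<psi> = sat M0 (\<lambda>_. a) \<psi>" if "\<psi> \<in> Cl" for \<psi>
    using b that by (simp add: vl_def)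
qed

lemma Inr_W: "c \<in> cB C \<Longrightarrow> Inr f \<in> WW (cp C c) \<Longrightarrow> f \<in> FA"
proof -
  assume c: "c \<in> cB C" and f: "Inr f \<in> WW (cp C c)"
  have "(Inr f :: fel) \<in> AA" using WW_A[OF goodD(4)[OF gd c]] f by blast
  then show "f \<in> FA" by (auto simp: AA_def)
qed

lemma admissible_MT: "admissible \<sigma> MT"
proof -
  have "cr C \<in> UT" using goodD(2,3)[OF gd] a0 by (simp add: UT_def)
  moreover have "itp B \<subseteq> {as. length as = k \<and> set as \<subseteq> UT}" if k: "arity \<sigma> B = Some k" for B k
  proof (cases B)
    case (Base s)
    show ?thesis
    proof
      fix bs assume "bs \<in> itp B"
      then obtain c as where c: "bs = map (\<lambda>a. cg C c (Inl a)) as" "c \<in> cB C"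
        "Inr (Base s, as) \<in> WW (cp C c)" "Inl ` set as \<subseteq> WW (cp C c)" using Base by auto
      have "length as = k" using FA_prop(1)[OF Inr_W[OF c(2,3)]] k Base by simp
      moreover have "set bs \<subseteq> UT" using c cg_UT(1)[OF c(2)] by auto
      ultimately show "bs \<in> {as. length as = k \<and> set as \<subseteq> UT}" using c(1) by simp
    qed
  next
    case (T u)
    then have "k = 2" using k by (auto split: if_splits)
    then show ?thesis using T by auto
  qed
  ultimately have "is_struct \<sigma> MT" unfolding is_struct_def MT_sel by blast
  moreover have dr: "(x, y) \<in> dist_rel MT u \<longleftrightarrow> u \<in> US \<and> x \<in> UT \<and> y \<in> UT \<and> (Inl x, Inl y) \<in> cQ C (TT u)" for u x y
    by (auto simp: dist_rel_def MT_sel)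
  have "trans (dist_rel MT u)" for u
  proof (cases "u \<in> US")
    case True
    then have "trans (cQ C (TT u))" using goodD(8)[OF gd] by (simp add: JJ_def)
    then show ?thesis unfolding trans_def using dr by blast
  next
    case False
    then show ?thesis unfolding trans_def using dr by blast
  qed
  moreover have "dist_rel MT (2 * u) = (dist_rel MT (2 * u - 1))\<inverse>" if u: "u \<in> {1..num_pairs \<sigma>}" for u
  proof -
    have m: "mate (2 * u - 1) = 2 * u" "mate (2 * u) = 2 * u - 1" using u by (auto simp: mate_def)
    then have U: "2 * u - 1 \<in> US \<longleftrightarrow> 2 * u \<in> US" using mate_US by metis
    have "cQ C (TT (2 * u)) = (cQ C (TT (2 * u - 1)))\<inverse>" if "2 * u - 1 \<in> US"
      using goodD(9)[OF gd, of "TT (2 * u - 1)"] that m by (simp add: JJ_def)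
    then show ?thesis using dr U by auto
  qed
  ultimately show ?thesis unfolding admissible_def by blast
qed

text \<open>A certificate for \<open>\<psi>\<close> at \<open>vl b\<close> lies in the bag of
  \<open>b\<close>, and gluing sends it to centers. Edges are preserved by the chart, base facts by
  the definition of \<open>itp\<close>, negated formulas by equality of types and
  \<open>IH\<close>.\<close>

lemma sat_decoded_if:
  assumes IH: "\<And>\<chi> b. Neg \<chi> \<in> subs \<psi> \<Longrightarrow> b \<in> UT \<Longrightarrow> sat MT (\<lambda>_. b) \<chi> = sat M0 (\<lambda>_. vl b) \<chi>"
    and psi: "\<psi> \<in> Cl" and b: "b \<in> UT" and s: "sat M0 (\<lambda>_. vl b) \<psi>"
  shows "sat MT (\<lambda>_. b) \<psi>"
proof -
  let ?a = "vl b" let ?D = "fst (DF (vl b) \<psi>)" and ?F = "snd (DF (vl b) \<psi>)"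
  have bC: "b \<in> cB C" using b by (simp add: UT_def)
  have a: "cp C b = Inl ?a" "?a \<in> U" using vl[OF b] by auto
  note df = DF[OF a(2) psi s]
  have c: "?D \<subseteq> U" "\<And>B as. (B, as) \<in> ?F \<Longrightarrow> as \<in> interp M0 B \<and> set as \<subseteq> ?D \<and> B \<in> syms \<psi>"
    using df(1) unfolding cert_def by auto
  have W: "Inl ` ?D \<subseteq> WW (cp C b)" "Inr ` (?F \<inter> FA) \<subseteq> WW (cp C b)"
    unfolding a(1) WW_def using psi s by auto
  let ?h = "\<lambda>d. cg C b (Inl d)"
  have hb: "?h ?a = b" using goodD(7)[OF gd bC] a(1) by simp
  have hD: "?h d \<in> UT" "\<And>\<chi>. \<chi> \<in> Cl \<Longrightarrow> sat M0 (\<lambda>_. vl (?h d)) \<chi> = sat M0 (\<lambda>_. d) \<chi>" if "d \<in> ?D" for d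
    using cg_UT[OF bC, of d] W(1) that by auto
  have F: "map ?h as \<in> interp MT B" if F: "(B, as) \<in> ?F" for B as
  proof (cases B)
    case (Base t)
    have "(B, as) \<in> FA" using c(2)[OF F] Cl_prop(3)[OF psi] Base by (auto simp: FA_def)
    then have "Inr (Base t, as) \<in> WW (cp C b)" using W(2) F Base by auto
    moreover have "Inl ` set as \<subseteq> WW (cp C b)" using c(2)[OF F] W(1) by auto
    ultimately have "map ?h as \<in> itp (Base t)" using bC by auto
    then show ?thesis using Base by (simp add: MT_sel)
  next
    case (T u)
    have sy: "T u \<in> syms \<Phi>" using c(2)[OF F] Cl_prop(3)[OF psi] T by auto
    then obtain k where k: "arity \<sigma> (T u) = Some k" using syms_arity unfo by blast
    then have u: "u \<in> US" "k = 2" using sy by (auto simp: US_def split: if_splits)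
    have "length as = 2" using structM0[OF k] c(2)[OF F] T u by auto
    then obtain x y where xy: "as = [x, y]" by (auto simp: length_Suc_conv numeral_2_eq_2)
    have D: "x \<in> ?D" "y \<in> ?D" and i: "[x, y] \<in> interp M0 (T u)" using c(2)[OF F] xy T by auto
    have "(Inl x, Inl y) \<in> rr (TT u)" using D i c(1) by auto
    then have "(io AA C b (Inl x), io AA C b (Inl y)) \<in> cQ C (TT u)"
      using goodD(10)[OF gd _ bC] u by (simp add: JJ_def)
    moreover have "Inl x \<in> WW (cp C b)" "Inl y \<in> WW (cp C b)" using W(1) D by blast+
    ultimately have "(Inl (?h x), Inl (?h y)) \<in> cQ C (TT u)" by (simp only: io_AA[OF bC])
    then show ?thesis using u hD(1) D xy T by (simp add: MT_sel)
  qed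
  have neg: "\<not> sat MT (\<lambda>_. ?h d) \<chi>" if "Neg \<chi> \<in> subs \<psi>" "d \<in> ?D" "\<not> sat M0 (\<lambda>_. d) \<chi>" for \<chi> d
    using IH[OF that(1) hD(1)[OF that(2)]] hD(2)[OF that(2)] Cl_prop(4)[OF psi that(1)] that(3) by simp
  show ?thesis
  proof (rule df(2)[of MT, unfolded certifies_def, rule_format])
    show "?h ` ?D \<subseteq> universe MT" using hD(1) unfolding MT_sel by blast
    show "b = ?h ?a" by (rule hb[symmetric])
  qed (rule F neg; assumption)+
qed

text \<open>A certificate in the new model has at most \<open>n\<close> elements and
  \<open>n\<close> facts. With one more center for each base fact this makes \<open>2 * n\<close>
  points, which is the value of \<open>K\<close>; a local map fixing the chart of \<open>b\<close>
  takes them back to \<open>M0\<close>.\<close>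

lemma sat_if_decoded:
  assumes IH: "\<And>\<chi> b. Neg \<chi> \<in> subs \<psi> \<Longrightarrow> b \<in> UT \<Longrightarrow> sat MT (\<lambda>_. b) \<chi> = sat M0 (\<lambda>_. vl b) \<chi>"
    and psi: "\<psi> \<in> Cl" and b: "b \<in> UT" and s: "sat MT (\<lambda>_. b) \<psi>"
  shows "sat M0 (\<lambda>_. vl b) \<psi>"
proof -
  have "range (\<lambda>_ :: nat. b) \<subseteq> universe MT" using b by (auto simp: MT_sel)
  from cert_ex[OF s this Cl_prop(1)[OF psi], where 'c = nat]
  obtain E F where ct: "cert MT (\<lambda>_. b) \<psi> E F" and cf: "certifies MT (\<lambda>_. b) \<psi> E F M0" by blast
  have c: "finite E" "E \<subseteq> UT" "card E \<le> n" "finite F" "card F \<le> n"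
    "\<And>B as. (B, as) \<in> F \<Longrightarrow> as \<in> itp B \<and> set as \<subseteq> E \<and> B \<in> syms \<psi>"
    using ct Cl_prop(2)[OF psi] unfolding cert_def MT_sel by auto
  have bC: "b \<in> cB C" and EC: "E \<subseteq> cB C" using b c(2) by (auto simp: UT_def)
  \<comment> \<open>\<open>w f\<close> recovers a bag from which the fact \<open>f\<close> was
    decoded, and \<open>pf f\<close> is the center glued at its fact element.\<close>
  define wt where "wt f p \<longleftrightarrow> snd f = map (\<lambda>a. cg C (fst p) (Inl a)) (snd p) \<and> fst p \<in> cB C \<and>
    Inr (fst f, snd p) \<in> WW (cp C (fst p)) \<and> Inl ` set (snd p) \<subseteq> WW (cp C (fst p))" for f and p :: "fel el \<times> nat list"
  define w where "w f = (SOME p. wt f p)" for f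
  define pf where "pf f = cg C (fst (w f)) (Inr (fst f, snd (w f)))" for f
  define FB where "FB = {f \<in> F. \<exists>t. fst f = Base t}"
  have w: "wt f (w f)" if fFB: "f \<in> FB" for f
  proof -
    obtain t bs where f: "f = (Base t, bs)" "f \<in> F" using fFB unfolding FB_def by (cases f) auto
    then have "bs \<in> itp (Base t)" using c(6) by blast
    then have "\<exists>p. wt f p" unfolding wt_def f(1) by fastforce
    then show ?thesis unfolding w_def by (rule someI_ex)
  qed
  define S :: "(fel el + fel el \<times> fel) set" where "S = Inl ` E \<union> Inl ` pf ` FB"
  have finS: "finite S" unfolding S_def FB_def using c by simp
  have "card S \<le> 2 * n"
  proof -
    have fB: "finite FB" unfolding FB_def using c(4) by simp
    have "card (Inl ` E :: (fel el + fel el \<times> fel) set) \<le> n" using card_image_le[OF c(1)] c(3) by (meson order_trans)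
    moreover have "card (Inl ` pf ` FB :: (fel el + fel el \<times> fel) set) \<le> card FB"
      using card_image_le[of "pf ` FB"] card_image_le[OF fB] fB by (meson finite_imageI order_trans)
    moreover have "card FB \<le> card F" unfolding FB_def using c(4) by (intro card_mono) auto
    ultimately show ?thesis unfolding S_def
      using card_Un_le[of "Inl ` E :: (fel el + fel el \<times> fel) set" "Inl ` pf ` FB"] c(5) by linarith
  qed
  moreover have pfch: "io AA C (fst (w f)) (Inr (fst f, snd (w f))) = Inl (pf f)" if "f \<in> FB" for f
    using io_AA w[OF that] unfolding wt_def pf_def by blast
  have "S \<subseteq> cov (io AA C) (cB C)"
  proof
    fix u assume "u \<in> S"
    then consider e where "e \<in> E" "u = Inl e" | f where "f \<in> FB" "u = Inl (pf f)" unfolding S_def by auto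
    then show "u \<in> cov (io AA C) (cB C)"
    proof cases
      case 1
      then have "u = io AA C e (cp C e)" "e \<in> cB C" "cp C e \<in> AA" using io_self EC goodD(4)[OF gd] by auto
      then show ?thesis unfolding cov_def by blast
    next
      case 2
      have "fst (w f) \<in> cB C" "Inr (fst f, snd (w f)) \<in> WW (cp C (fst (w f)))" using w[OF 2(1)] unfolding wt_def by auto
      moreover from this have "Inr (fst f, snd (w f)) \<in> AA" using goodD(4)[OF gd] WW_A by blast
      ultimately show ?thesis unfolding 2(2) pfch[OF 2(1), symmetric] cov_def by blast
    qed
  qed
  ultimately obtain h where h: "\<And>x. x \<in> AA \<Longrightarrow> h (io AA C b x) = x"
      "partial_hom (cB C) (io AA C) (cQ C) (S \<union> io AA C b ` AA) h"
    using locally_mapsD[OF goodD(12)[OF gd] bC _ finS] by blast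
  note hD = partial_homD[OF h(2)]
  have hb: "h (Inl b) = cp C b" using h(1)[of "cp C b"] io_self[OF bC] goodD(4)[OF gd bC] by simp
  have loop: "(h (Inl d), h (Inl d)) \<in> rr i" if d: "d \<in> E" and i: "i \<in> II" "(cp C d, cp C d) \<in> rr i" for d i
  proof -
    have "d \<in> cB C" "Inl d \<in> S" using d EC unfolding S_def by auto
    then show ?thesis using hD(2)[OF i(1) _ i(2)] io_self by fastforce
  qed
  define h' where "h' d = projl (h (Inl d))" for d
  \<comment> \<open>The image of an element could be a fact or a different element; one of the two
    loops for \<open>\<Phi>\<close> rules out a fact.\<close>
  have hE: "h (Inl d) = Inl (h' d) \<and> h' d \<in> U" if d: "d \<in> E" for d
  proof -
    have v: "cp C d = Inl (vl d)" "vl d \<in> U" using vl c(2) d by auto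
    show ?thesis
    proof (cases "sat M0 (\<lambda>_. vl d) \<Phi>")
      case True
      then show ?thesis using loop[OF d, of "PC \<Phi>"] v colour_I[OF Phi_Cl] by (auto simp: h'_def)
    next
      case False
      then show ?thesis using loop[OF d, of "NC \<Phi>"] v colour_I[OF Phi_Cl] by (auto simp: h'_def)
    qed
  qed
  have F: "map h' bs \<in> interp M0 B" if f: "(B, bs) \<in> F" for B bs
  proof (cases B)
    case (T u)
    obtain x y where xy: "bs = [x, y]" "u \<in> US" "(Inl x, Inl y) \<in> cQ C (TT u)" using c(6)[OF f] T by auto
    have E: "x \<in> E" "y \<in> E" using c(6)[OF f] xy by auto
    then have "(h (Inl x), h (Inl y)) \<in> rr (TT u)" using hD(3)[of "TT u" "Inl x" "Inl y"] xy unfolding S_def JJ_def by auto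
    then show ?thesis using hE E T xy by auto
  next
    case (Base t)
    let ?f = "(B, bs)" let ?c = "fst (w ?f)" and ?as = "snd (w ?f)"
    have fB: "?f \<in> FB" using f Base by (simp add: FB_def)
    have w': "bs = map (\<lambda>a. cg C ?c (Inl a)) ?as" "?c \<in> cB C" "Inr (B, ?as) \<in> WW (cp C ?c)" "Inl ` set ?as \<subseteq> WW (cp C ?c)"
      using w[OF fB] unfolding wt_def by auto
    have FA: "(B, ?as) \<in> FA" using Inr_W[OF w'(2,3)] .
    have pS: "Inl (pf ?f) \<in> S" unfolding S_def using fB by blast
    have pio: "io AA C ?c (Inr (B, ?as)) = Inl (pf ?f)" using pfch[OF fB] by simp
    \<comment> \<open>The loop for \<open>SY B\<close> keeps the image a fact over \<open>B\<close>,
      and the links \<open>EE k\<close> force its arguments to be the images of the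
      arguments.\<close>
    have "SY B \<in> II" using FA_prop(5)[OF FA] by (simp add: II_def)
    moreover have "(Inr (B, ?as), Inr (B, ?as)) \<in> rr (SY B)" using FA by simp
    ultimately have "(h (Inl (pf ?f)), h (Inl (pf ?f))) \<in> rr (SY B)"
      using hD(2)[OF _ w'(2), of "SY B" "Inr (B, ?as)" "Inr (B, ?as)"] pio pS by simp
    then obtain as' where as': "h (Inl (pf ?f)) = Inr (B, as')" "(B, as') \<in> FA" by auto
    have len: "length as' = length ?as" using FA_prop(1)[OF FA] FA_prop(1)[OF as'(2)] by simp
    have "h' (bs ! k) = as' ! k" if k: "k < length bs" for k
    proof -
      have k': "k < length ?as" using k w'(1) by (metis length_map)
      have bk: "bs ! k = cg C ?c (Inl (?as ! k))" using k' w'(1) by (metis nth_map)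
      have inW: "Inl (?as ! k) \<in> WW (cp C ?c)" using w'(4) k' by auto
      have io: "io AA C ?c (Inl (?as ! k)) = Inl (bs ! k)" using io_AA[OF w'(2) inW] bk by simp
      have bE: "bs ! k \<in> E" using c(6)[OF f] k by auto
      have bS: "Inl (bs ! k) \<in> S" unfolding S_def using bE by blast
      have "EE k \<in> II" using FA_prop(2)[OF FA] k' by (auto simp: II_def)
      moreover have "(Inr (B, ?as), Inl (?as ! k)) \<in> rr (EE k)" using FA k' by auto
      ultimately have "(h (Inl (pf ?f)), h (Inl (bs ! k))) \<in> rr (EE k)"
        using hD(2)[OF _ w'(2), of "EE k" "Inr (B, ?as)" "Inl (?as ! k)"] unfolding pio io using pS bS by blast
      then show ?thesis using as'(1) by (auto simp: h'_def)
    qed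
    moreover have "length bs = length as'" using len w'(1) by (metis length_map)
    ultimately have "map h' bs = as'" by (simp add: list_eq_iff_nth_eq)
    then show ?thesis using FA_prop(4)[OF as'(2)] by simp
  qed
  have neg: "\<not> sat M0 (\<lambda>_. h' d) \<chi>" if x: "Neg \<chi> \<in> subs \<psi>" "d \<in> E" "\<not> sat MT (\<lambda>_. d) \<chi>" for \<chi> d
  proof -
    have d: "d \<in> UT" using x(2) c(2) by auto
    have "\<not> sat M0 (\<lambda>_. vl d) \<chi>" using IH[OF x(1) d] x(3) by simp
    then have "(cp C d, cp C d) \<in> rr (NC \<chi>)" using vl[OF d] by auto
    then have "(h (Inl d), h (Inl d)) \<in> rr (NC \<chi>)" using loop[OF x(2)] colour_I Cl_prop(4)[OF psi x(1)] by blast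
    then show ?thesis using hE[OF x(2)] by auto
  qed
  have "h' b = vl b" using hb by (simp add: h'_def vl_def)
  then have vb: "vl b = h' b" by (rule sym)
  show ?thesis
  proof (rule cf[unfolded certifies_def, rule_format])
    show "h' ` E \<subseteq> U" using hE by blast
    show "vl b = h' b" by (rule vb)
  qed (rule F neg; assumption)+
qed

text \<open>Formulas under a negation in a member of \<open>Cl\<close> are shorter members of
  \<open>Cl\<close>, so both directions follow by induction on the length.\<close>

lemma sat_decoded_iff: "\<psi> \<in> Cl \<Longrightarrow> b \<in> UT \<Longrightarrow> sat MT (\<lambda>_. b) \<psi> = sat M0 (\<lambda>_. vl b) \<psi>"
proof (induction "form_length \<psi>" arbitrary: \<psi> b rule: less_induct)
  case less
  have IH: "sat MT (\<lambda>_. b) \<chi> = sat M0 (\<lambda>_. vl b) \<chi>" if "Neg \<chi> \<in> subs \<psi>" "b \<in> UT" for \<chi> b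
    using less.hyps Cl_prop(4)[OF less.prems(1) that(1)] that(2) by blast
  show ?case using sat_decoded_if[OF IH less.prems] sat_if_decoded[OF IH less.prems] by blast
qed

lemma target_model:
  assumes "sat M0 v \<Phi>"
  shows "finite_model \<sigma> MT \<Phi>" "card (universe MT) \<le> card (cB C)"
proof -
  have root: "cr C \<in> UT" using goodD(2,3)[OF gd] a0 by (simp add: UT_def)
  have "sat M0 (\<lambda>_. vl (cr C)) \<Phi> = sat M0 v \<Phi>" by (rule sat_cong) (simp add: closed)
  then have "sat MT (\<lambda>_. cr C) \<Phi>" using sat_decoded_iff[OF Phi_Cl root] assms by simp
  moreover have "finite UT" using goodD(1)[OF gd] by (simp add: UT_def)
  ultimately show "finite_model \<sigma> MT \<Phi>" using admissible_MT root
    unfolding finite_model_def MT_sel by (intro conjI exI[of _ "\<lambda>_. cr C"]) auto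
  show "card (universe MT) \<le> card (cB C)" unfolding MT_sel UT_def using goodD(1)[OF gd] by (intro card_mono) auto
qed

end


section \<open>Numerical estimates and the final bound\<close>

lemma linear_le_power2: "n \<ge> 1 \<Longrightarrow> 8 * n \<le> 2 ^ (n + 3)" "n \<ge> 1 \<Longrightarrow> 2 * n + 3 \<le> 2 ^ (n + 2)"
  "1 + (n + 1) * (2 * n) \<le> 2 ^ (2 * n + 2)" for n :: nat
proof -
  have n: "n + 1 \<le> 2 ^ n" using less_exp[of n] by (simp add: Suc_le_eq)
  show "8 * n \<le> 2 ^ (n + 3)" using n by (simp add: power_add)
  show "n \<ge> 1 \<Longrightarrow> 2 * n + 3 \<le> 2 ^ (n + 2)" using n by (simp add: power_add)
  have "(n + 1) * (n + 1) \<le> 2 ^ n * 2 ^ n" using n by (intro mult_le_mono)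
  also have "\<dots> = 2 ^ (2 * n)" by (simp add: power_add[symmetric] mult_2)
  finally have "4 * ((n + 1) * (n + 1)) \<le> 2 ^ (2 * n + 2)" by (simp add: power_add)
  then show "1 + (n + 1) * (2 * n) \<le> 2 ^ (2 * n + 2)" by (simp add: algebra_simps)
qed

lemma (in closed_model) small_model:
  assumes "sat M0 v \<Phi>"
  shows "\<exists>M :: nat struct. finite_model \<sigma> M \<Phi> \<and>
    card (universe M) \<le> 2 ^ (2 ^ (2 ^ (8 * n * ((2 * n + 1) * (2 * n + 1)) + (8 * n + 18))))"
proof -
  have n1: "1 \<le> n" by (rule form_length_pos)
  interpret bag_structure AA rr II JJ ivv WW "2 * form_length \<Phi>" by (rule bag_structure)
  have "universe M0 \<noteq> {}" using adm by (simp add: admissible_def is_struct_def)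
  then obtain a0 where a0: "a0 \<in> U" by blast
  define m where "m = 1 + (n + 1) * (2 * n)"
  define D where "D = (2 * (2 * (card JJ * (M + 1)) + 4) + 1) * (2 * n + 3)"
  \<comment> \<open>\<open>a\<close> bounds \<open>card II * (K + 1) ^ 2\<close> for
    \<open>K = 2 * n\<close>, and \<open>E\<close> is chosen for \<open>M + 1 \<le> 2 ^ E\<close>.
    In \<open>D\<close> the factor with \<open>M\<close> is at most \<open>2 ^ (n + 4 + E)\<close>
    and the other one at most \<open>2 ^ (n + 2)\<close>, which gives \<open>d\<close>.\<close>
  define a where "a = 8 * n * ((2 * n + 1) * (2 * n + 1))"
  define E where "E = 2 ^ a + (1 :: nat)"
  define d where "d = 2 * n + E + 6"
  have cJ: "card JJ \<le> 2 * n" unfolding JJ_def using card_image_le[OF US_fin(1), of TT] US_fin(2) by linarith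
  have cI: "card II \<le> 8 * n"
  proof -
    have "card II \<le> card JJ + card (EE ` {..<n}) + card (SY ` syms \<Phi>) + card (PC ` Cl) + card (NC ` Cl)"
      unfolding II_def by (intro order_trans[OF card_Un_le] add_le_mono order_refl)
    moreover have "card (EE ` {..<n}) \<le> n" using card_image_le[of "{..<n}" EE] by simp
    moreover have "card (SY ` syms \<Phi>) \<le> n" using card_image_le[OF syms_finite, of SY \<Phi>] syms_card[of \<Phi>] by linarith
    moreover have "card (PC ` Cl) \<le> n + 1" using card_image_le[OF Cl_fin(1), of PC] Cl_fin(2) by linarith
    moreover have "card (NC ` Cl) \<le> n + 1" using card_image_le[OF Cl_fin(1), of NC] Cl_fin(2) by linarith
    ultimately show ?thesis using cJ n1 by linarith
  qed
  have ME: "M + 1 \<le> 2 ^ E"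
  proof -
    have "card II * ((2 * n + 1) * (2 * n + 1)) \<le> a" unfolding a_def using cI by (rule mult_le_mono1)
    then have "(2 :: nat) ^ (2 ^ (card II * ((2 * n + 1) * (2 * n + 1)))) \<le> 2 ^ (2 ^ a)"
      by (intro power_increasing) auto
    then have "M \<le> 2 ^ (2 ^ a)" using number_of_types_le by linarith
    moreover have "(1 :: nat) \<le> 2 ^ (2 ^ a)" by simp
    ultimately show ?thesis unfolding E_def by (simp only: power_add power_one_right mult_2_right)
  qed
  have Dd: "D \<le> 2 ^ d"
  proof -
    have "4 * card JJ \<le> 2 ^ (n + 3)" using cJ linear_le_power2(1)[OF n1] by linarith
    then have "4 * card JJ * (M + 1) \<le> 2 ^ (n + 3) * 2 ^ E" using ME by (rule mult_le_mono)
    moreover have "(9 :: nat) \<le> 2 ^ (n + 3) * 2 ^ E"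
    proof -
      have "(2 :: nat) ^ 4 \<le> 2 ^ (n + 3 + E)" by (intro power_increasing) (auto simp: E_def)
      then have "2 ^ 4 \<le> (2 :: nat) ^ (n + 3) * 2 ^ E" unfolding power_add[of 2 "n + 3" E] .
      moreover have "(9 :: nat) \<le> 2 ^ 4" by simp
      ultimately show ?thesis by (rule order_trans[rotated])
    qed
    ultimately have "2 * (2 * (card JJ * (M + 1)) + 4) + 1 \<le> 2 ^ (n + 3) * 2 ^ E + 2 ^ (n + 3) * 2 ^ E"
      by (simp only: distrib_left mult.assoc[symmetric])
    also have "\<dots> = 2 ^ (n + 4 + E)" by (simp add: power_add)
    finally have "D \<le> 2 ^ (n + 4 + E) * 2 ^ (n + 2)"
      unfolding D_def using linear_le_power2(2)[OF n1] by (rule mult_le_mono)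
    also have "\<dots> = 2 ^ d" unfolding d_def power_add[symmetric] by (rule arg_cong[of _ _ "\<lambda>k. 2 ^ k"]) simp
    finally show ?thesis .
  qed
  have D1: "1 \<le> D" unfolding D_def by simp
  have m1: "1 \<le> m" unfolding m_def by simp
  have cards: "card {j \<in> JJ. \<not> tot AA j} \<le> 2 * n"
  proof -
    have "finite JJ" unfolding JJ_def using US_fin(1) by simp
    then have "card {j \<in> JJ. \<not> tot AA j} \<le> card JJ" by (intro card_mono) auto
    then show ?thesis using cJ by linarith
  qed
  have "Inl a0 \<in> AA" using a0 by (simp add: AA_def)
  then obtain C where C: "good AA (Inl a0) C" "card (cB C) \<le> comp_bound m D (Suc (2 * n))"
    using exists_good[of m D AA "Inl a0" "2 * n"] WW_card m1 cards unfolding m_def D_def by auto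
  interpret decoded_model \<sigma> \<Phi> M0 C a0 by unfold_locales (rule C(1), rule a0)
  have "comp_bound m D (Suc (2 * n)) \<le> 2 ^ (((2 ^ d) * (2 * (2 * n + 2) + 6)) ^ Suc (2 * n))"
    by (rule comp_bound_le[OF ME Dd D1 _ m1]) (use linear_le_power2(3)[of n] in \<open>auto simp: m_def d_def\<close>)
  also have "\<dots> \<le> 2 ^ (2 ^ (2 ^ (a + (8 * n + 18))))"
  proof (rule power_increasing)
    have "2 * (2 * n + 2) + 6 \<le> (2 :: nat) ^ (2 * (2 * n + 2) + 6)" by (simp add: less_imp_le)
    then have "2 ^ d * (2 * (2 * n + 2) + 6) \<le> (2 :: nat) ^ (d + (2 * (2 * n + 2) + 6))" by (simp add: power_add)
    then have "(2 ^ d * (2 * (2 * n + 2) + 6)) ^ Suc (2 * n) \<le> ((2 :: nat) ^ (d + (2 * (2 * n + 2) + 6))) ^ Suc (2 * n)"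
      by (rule power_mono) simp
    also have "\<dots> = 2 ^ ((d + (2 * (2 * n + 2) + 6)) * Suc (2 * n))" by (rule power_mult[symmetric])
    also have "\<dots> \<le> 2 ^ (2 ^ (a + (8 * n + 18)))"
    proof (rule power_increasing)
      have "d + (2 * (2 * n + 2) + 6) = 2 ^ a + (6 * n + 17)" unfolding d_def E_def by simp
      also have "\<dots> \<le> 2 ^ a * (6 * n + 18)"
      proof -
        have "6 * n + 17 \<le> 2 ^ a * (6 * n + 17)" by simp
        then show ?thesis by (simp add: algebra_simps)
      qed
      also have "\<dots> \<le> 2 ^ a * 2 ^ (6 * n + 18)" by (intro mult_le_mono2) (simp add: less_imp_le)
      finally have "(d + (2 * (2 * n + 2) + 6)) * Suc (2 * n) \<le> 2 ^ a * 2 ^ (6 * n + 18) * 2 ^ (2 * n)"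
        by (rule mult_le_mono) (use less_exp[of "2 * n"] in \<open>simp add: Suc_le_eq\<close>)
      also have "\<dots> = 2 ^ (a + (8 * n + 18))" unfolding power_add[symmetric] by (rule arg_cong[of _ _ "\<lambda>k. 2 ^ k"]) simp
      finally show "(d + (2 * (2 * n + 2) + 6)) * Suc (2 * n) \<le> 2 ^ (a + (8 * n + 18))" .
    qed simp
    finally show "(2 ^ d * (2 * (2 * n + 2) + 6)) ^ Suc (2 * n) \<le> 2 ^ (2 ^ (a + (8 * n + 18)))" .
  qed simp
  finally have "card (universe MT) \<le> 2 ^ (2 ^ (2 ^ (a + (8 * n + 18))))"
    using target_model(2)[OF assms] C(2) by linarith
  moreover obtain N' :: "nat struct" where "finite_model \<sigma> N' \<Phi>" "card (universe N') = card (universe MT)"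
    using finite_model_nat[OF target_model(1)[OF assms]] by blast
  ultimately show ?thesis unfolding a_def by metis
qed

theorem theorem20:
  "\<exists>p :: nat poly. \<forall>(\<sigma> :: signature) (\<phi> :: form).
     unfo \<sigma> \<phi> \<and> finitely_satisfiable \<sigma> \<phi> \<longrightarrow>
     (\<exists>M :: nat struct. finite_model \<sigma> M \<phi> \<and>
        card (universe M) \<le> 2 ^ (2 ^ (2 ^ (poly p (form_length \<phi>)))))"
proof (intro exI[of _ "[:0, 24:] * ([:1, 6:] * [:1, 6:]) + [:18, 24:]"] allI impI)
  fix \<sigma> \<phi> assume "unfo \<sigma> \<phi> \<and> finitely_satisfiable \<sigma> \<phi>"
  then obtain M0 :: "nat struct" and v where unfo: "unfo \<sigma> \<phi>" and adm: "admissible \<sigma> M0"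
    and fin: "finite (universe M0)" and v: "range v \<subseteq> universe M0" "sat M0 v \<phi>"
    unfolding finitely_satisfiable_def finite_model_def by blast
  obtain vs where vs: "set vs = fv \<phi>" "distinct vs" using finite_distinct_list[OF fv_finite] by blast
  define \<Phi> where "\<Phi> = foldr Ex vs \<phi>"
  let ?n = "form_length \<Phi>" and ?k = "form_length \<phi>"
  \<comment> \<open>Existential closure adds two symbols per free variable, and there are at most
    \<open>?k\<close> of them. Putting \<open>3 * ?k\<close> for the length in the exponent of
    \<open>small_model\<close> yields the polynomial.\<close>
  have "length vs \<le> ?k" using fv_card[of \<phi>] distinct_card[OF vs(2)] vs(1) by simp
  then have len: "?n \<le> 3 * ?k" unfolding \<Phi>_def foldr_Ex by simp
  interpret closed_model \<sigma> \<Phi> M0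
    by unfold_locales (use unfo vs adm fin in \<open>auto simp: \<Phi>_def foldr_Ex\<close>)
  have "sat M0 v \<Phi>" unfolding \<Phi>_def using sat_foldr_Ex v by blast
  from small_model[OF this] obtain M :: "nat struct" where M: "finite_model \<sigma> M \<Phi>"
    "card (universe M) \<le> 2 ^ (2 ^ (2 ^ (8 * ?n * ((2 * ?n + 1) * (2 * ?n + 1)) + (8 * ?n + 18))))" by blast
  have "finite_model \<sigma> M \<phi>" using M(1) foldr_Ex_sat unfolding finite_model_def \<Phi>_def by blast
  moreover have "8 * ?n * ((2 * ?n + 1) * (2 * ?n + 1)) + (8 * ?n + 18)
      \<le> 8 * (3 * ?k) * ((2 * (3 * ?k) + 1) * (2 * (3 * ?k) + 1)) + (8 * (3 * ?k) + 18)"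
    using len by (intro add_le_mono mult_le_mono) auto
  then have "8 * ?n * ((2 * ?n + 1) * (2 * ?n + 1)) + (8 * ?n + 18)
      \<le> poly ([:0, 24:] * ([:1, 6:] * [:1, 6:]) + [:18, 24:]) ?k"
    by (simp add: algebra_simps)
  then have "(2 :: nat) ^ (2 ^ (2 ^ (8 * ?n * ((2 * ?n + 1) * (2 * ?n + 1)) + (8 * ?n + 18))))
      \<le> 2 ^ (2 ^ (2 ^ (poly ([:0, 24:] * ([:1, 6:] * [:1, 6:]) + [:18, 24:]) ?k)))"
    by (intro power_increasing) auto
  ultimately show "\<exists>M :: nat struct. finite_model \<sigma> M \<phi> \<and>
      card (universe M) \<le> 2 ^ (2 ^ (2 ^ (poly ([:0, 24:] * ([:1, 6:] * [:1, 6:]) + [:18, 24:]) (form_length \<phi>))))"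
    using M(2) by (meson order_trans)
qed

end
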